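(* Let $\mathbb{F}$ be an algebraically closed field of characteristic $p\ge 0$. Let $A$ be a (not necessarily unital) associative algebra over $\mathbb{F}$ containing a non-zero semisimple finite dimensional subalgebra $S$. Suppose that $A$ is generated by $S$ as an ideal and that $S$ is either $1$-perfect with $p\neq 2$ or $4$-perfect with $p=2$. Let $Q_1,\dots,Q_t$ be the simple components of the Lie algebra $S^{(1)}$. Then the Lie algebra $A^{(1)}$ is $\Gamma$-graded where $\Gamma$ consists of the roots of $S^{(1)}$ and all weights of the form $\lambda_i+\lambda_j$ where $1\le i<j\le t$ and $\lambda_i$ is either zero or one of the weights of the natural or conatural $Q_i$-modules (and likewise $\lambda_j$ for $Q_j$), together with $0$, which the definition of $\Gamma$-graded requires to lie in $\Gamma$.
   Context: For an associative algebra $A$, $A^{(1)}=[A,A]$ is the linear span of all commutators $[x,y]=xy-yx$, a Lie algebra under the commutator bracket; similarly $S^{(1)}=[S,S]$. "$A$ is generated by $S$ as an ideal" means that the smallest two-sided ideal of $A$ containing $S$ is $A$. An associative algebra is $k$-perfect ($k\ge1$) if it has no proper (i.e. different from the whole algebra) two-sided ideals of codimension $\le k$; for $S=\bigoplus_i M_{n_i}(\mathbb{F})$ this means $n_i>\sqrt{k}$ for all $i$. Then $S^{(1)}=\bigoplus_i\mathfrak{sl}_{n_i}(\mathbb{F})$ with components $Q_i=\mathfrak{sl}_{n_i}(\mathbb{F})$; the natural $Q_i$-module is the column space $\mathbb{F}^{n_i}$ and the conatural one is its dual. Weights of $Q_i$ are viewed as weights of $S^{(1)}$ by extending by zero on the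 Cartan subalgebras of the other components. Definition of $\Gamma$-graded: let $\Delta$ be a root system and $\Gamma$ a finite set of integral weights of $\Delta$ containing $\Delta$ and $0$. A Lie algebra $L$ over a field of characteristic zero is $(\Gamma,\mathfrak{g})$-graded (or simply $\Gamma$-graded) if ($\Gamma1$) $L$ contains as a subalgebra a finite-dimensional split semisimple Lie algebra $\mathfrak{g}=\mathfrak{h}\oplus\bigoplus_{\alpha\in\Delta}\mathfrak{g}_\alpha$ whose root system is $\Delta$ relative to a split Cartan subalgebra $\mathfrak{h}=\mathfrak{g}_0$; ($\Gamma2$) $L=\bigoplus_{\alpha\in\Gamma}L_\alpha$ where $L_\alpha=\{x\in L\mid [h,x]=\alpha(h)x \text{ for all } h\in\mathfrak{h}\}$; ($\Gamma3$) $L_0=\sum_{\alpha,-\alpha\in\Gamma\setminus\{0\}}[L_\alpha,L_{-\alpha}]$. Since this notion is defined only in characteristic zero, the conclusion has a defined meaning only for $p=0$.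
   Formalization: Proved for p = 0, the only case in which "Γ-graded" is defined; for t = 1, where no pair i < j exists and the literal claim fails (S = M_2 in A = M_3), Γ also contains the weights of the natural and conatural Q_1-modules. *)

theory Defs
  imports
    "HOL-Computational_Algebra.Polynomial"
    "HOL-Library.FuncSet"
    "Jordan_Normal_Form.Matrix"
begin

text \<open>
  Algebras and Lie algebras are linear subspaces of an ambient vector space given by a scalar
  multiplication \<open>s\<close>, together with a product \<open>m\<close> (associative, or a Lie bracket) on the ambient
  type. The type class \<open>ring\<close> does not include a unit.
\<close>

definition finite_dim :: "('f::field \<Rightarrow> 'v::ab_group_add \<Rightarrow> 'v) \<Rightarrow> 'v set \<Rightarrow> bool" where
  "finite_dim s V \<longleftrightarrow> (\<exists>B. finite B \<and> B \<subseteq> V \<and> V \<subseteq> module.span s B)"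

definition prod_span ::
  "('f::field \<Rightarrow> 'v::ab_group_add \<Rightarrow> 'v) \<Rightarrow> ('v \<Rightarrow> 'v \<Rightarrow> 'v) \<Rightarrow> 'v set \<Rightarrow> 'v set \<Rightarrow> 'v set" where
  "prod_span s m X Y = module.span s {m x y | x y. x \<in> X \<and> y \<in> Y}"

text \<open>
  \<open>desc_power s m X n\<close> is the span of the right-normed products of \<open>n + 1\<close> elements of \<open>X\<close>:
  the power \<open>X\<^sup>n\<^sup>+\<^sup>1\<close> if \<open>m\<close> is associative, a term of the lower central series if \<open>m\<close> is a bracket.
\<close>

primrec desc_power ::
  "('f::field \<Rightarrow> 'v::ab_group_add \<Rightarrow> 'v) \<Rightarrow> ('v \<Rightarrow> 'v \<Rightarrow> 'v) \<Rightarrow> 'v set \<Rightarrow> nat \<Rightarrow> 'v set" where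
  "desc_power s m X 0 = X"
| "desc_power s m X (Suc n) = prod_span s m X (desc_power s m X n)"

definition nilpotent ::
  "('f::field \<Rightarrow> 'v::ab_group_add \<Rightarrow> 'v) \<Rightarrow> ('v \<Rightarrow> 'v \<Rightarrow> 'v) \<Rightarrow> 'v set \<Rightarrow> bool" where
  "nilpotent s m X \<longleftrightarrow> (\<exists>n. desc_power s m X n = {0})"

definition direct_sum :: "'v::ab_group_add set \<Rightarrow> 'i set \<Rightarrow> ('i \<Rightarrow> 'v set) \<Rightarrow> bool" where
  "direct_sum V I W \<longleftrightarrow>
     finite I \<and> (\<forall>i\<in>I. W i \<subseteq> V) \<and> (\<forall>x\<in>V. \<exists>!f. f \<in> Pi\<^sub>E I W \<and> x = (\<Sum>i\<in>I. f i))"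


subsection \<open>Associative algebras\<close>

locale assoc_algebra = vector_space s
  for s :: "'f::field \<Rightarrow> 'a::ring \<Rightarrow> 'a" +
  assumes scale_mult_left: "s c x * y = s c (x * y)"
    and scale_mult_right: "x * s c y = s c (x * y)"

definition assoc_subalgebra :: "('f::field \<Rightarrow> 'a::ring \<Rightarrow> 'a) \<Rightarrow> 'a set \<Rightarrow> bool" where
  "assoc_subalgebra s B \<longleftrightarrow> module.subspace s B \<and> (\<forall>x\<in>B. \<forall>y\<in>B. x * y \<in> B)"

definition assoc_ideal :: "('f::field \<Rightarrow> 'a::ring \<Rightarrow> 'a) \<Rightarrow> 'a set \<Rightarrow> 'a set \<Rightarrow> bool" where
  "assoc_ideal s B I \<longleftrightarrow>
     I \<subseteq> B \<and> module.subspace s I \<and> (\<forall>b\<in>B. \<forall>x\<in>I. b * x \<in> I \<and> x * b \<in> I)"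

definition generated_ideal :: "('f::field \<Rightarrow> 'a::ring \<Rightarrow> 'a) \<Rightarrow> 'a set \<Rightarrow> 'a set \<Rightarrow> 'a set" where
  "generated_ideal s B X = \<Inter>{I. assoc_ideal s B I \<and> X \<subseteq> I}"

text \<open>The quotient \<open>V / W\<close> is spanned by the classes of at most \<open>k\<close> vectors.\<close>

definition codim_le :: "('f::field \<Rightarrow> 'v::ab_group_add \<Rightarrow> 'v) \<Rightarrow> 'v set \<Rightarrow> 'v set \<Rightarrow> nat \<Rightarrow> bool" where
  "codim_le s V W k \<longleftrightarrow>
     (\<exists>B. finite B \<and> card B \<le> k \<and> B \<subseteq> V \<and> V \<subseteq> module.span s (W \<union> B))"

definition k_perfect :: "('f::field \<Rightarrow> 'a::ring \<Rightarrow> 'a) \<Rightarrow> nat \<Rightarrow> 'a set \<Rightarrow> bool" where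
  "k_perfect s k B \<longleftrightarrow> (\<forall>I. assoc_ideal s B I \<and> codim_le s B I k \<longrightarrow> I = B)"

text \<open>For finite-dimensional algebras: the radical, i.e. the largest nilpotent ideal, is zero.\<close>

definition semisimple_algebra :: "('f::field \<Rightarrow> 'a::ring \<Rightarrow> 'a) \<Rightarrow> 'a set \<Rightarrow> bool" where
  "semisimple_algebra s B \<longleftrightarrow> (\<forall>I. assoc_ideal s B I \<and> nilpotent s (*) I \<longrightarrow> I = {0})"

definition commutator :: "'a::ring \<Rightarrow> 'a \<Rightarrow> 'a" where
  "commutator x y = x * y - y * x"

definition comm_span :: "('f::field \<Rightarrow> 'a::ring \<Rightarrow> 'a) \<Rightarrow> 'a set \<Rightarrow> 'a set" where
  "comm_span s B = prod_span s commutator B B"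


subsection \<open>Lie algebras\<close>

definition lie_algebra ::
  "('f::field \<Rightarrow> 'v::ab_group_add \<Rightarrow> 'v) \<Rightarrow> ('v \<Rightarrow> 'v \<Rightarrow> 'v) \<Rightarrow> 'v set \<Rightarrow> bool" where
  "lie_algebra s br L \<longleftrightarrow>
     vector_space s \<and> module.subspace s L \<and>
     (\<forall>x\<in>L. \<forall>y\<in>L. br x y \<in> L) \<and>
     (\<forall>x\<in>L. \<forall>y\<in>L. \<forall>z\<in>L. br (x + y) z = br x z + br y z \<and> br z (x + y) = br z x + br z y) \<and>
     (\<forall>c. \<forall>x\<in>L. \<forall>y\<in>L. br (s c x) y = s c (br x y) \<and> br x (s c y) = s c (br x y)) \<and>
     (\<forall>x\<in>L. br x x = 0) \<and>
     (\<forall>x\<in>L. \<forall>y\<in>L. \<forall>z\<in>L. br x (br y z) + br y (br z x) + br z (br x y) = 0)"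

definition lie_subalgebra ::
  "('f::field \<Rightarrow> 'v::ab_group_add \<Rightarrow> 'v) \<Rightarrow> ('v \<Rightarrow> 'v \<Rightarrow> 'v) \<Rightarrow> 'v set \<Rightarrow> 'v set \<Rightarrow> bool" where
  "lie_subalgebra s br L M \<longleftrightarrow>
     M \<subseteq> L \<and> module.subspace s M \<and> (\<forall>x\<in>M. \<forall>y\<in>M. br x y \<in> M)"

definition lie_ideal ::
  "('f::field \<Rightarrow> 'v::ab_group_add \<Rightarrow> 'v) \<Rightarrow> ('v \<Rightarrow> 'v \<Rightarrow> 'v) \<Rightarrow> 'v set \<Rightarrow> 'v set \<Rightarrow> bool" where
  "lie_ideal s br L I \<longleftrightarrow>
     I \<subseteq> L \<and> module.subspace s I \<and> (\<forall>x\<in>L. \<forall>y\<in>I. br x y \<in> I)"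

primrec derived_series ::
  "('f::field \<Rightarrow> 'v::ab_group_add \<Rightarrow> 'v) \<Rightarrow> ('v \<Rightarrow> 'v \<Rightarrow> 'v) \<Rightarrow> 'v set \<Rightarrow> nat \<Rightarrow> 'v set" where
  "derived_series s br L 0 = L"
| "derived_series s br L (Suc n) =
     prod_span s br (derived_series s br L n) (derived_series s br L n)"

definition solvable ::
  "('f::field \<Rightarrow> 'v::ab_group_add \<Rightarrow> 'v) \<Rightarrow> ('v \<Rightarrow> 'v \<Rightarrow> 'v) \<Rightarrow> 'v set \<Rightarrow> bool" where
  "solvable s br L \<longleftrightarrow> (\<exists>n. derived_series s br L n = {0})"

definition lie_semisimple ::
  "('f::field \<Rightarrow> 'v::ab_group_add \<Rightarrow> 'v) \<Rightarrow> ('v \<Rightarrow> 'v \<Rightarrow> 'v) \<Rightarrow> 'v set \<Rightarrow> bool" where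
  "lie_semisimple s br L \<longleftrightarrow> (\<forall>I. lie_ideal s br L I \<and> solvable s br I \<longrightarrow> I = {0})"

definition lie_simple ::
  "('f::field \<Rightarrow> 'v::ab_group_add \<Rightarrow> 'v) \<Rightarrow> ('v \<Rightarrow> 'v \<Rightarrow> 'v) \<Rightarrow> 'v set \<Rightarrow> bool" where
  "lie_simple s br L \<longleftrightarrow>
     (\<exists>x\<in>L. \<exists>y\<in>L. br x y \<noteq> 0) \<and> (\<forall>I. lie_ideal s br L I \<longrightarrow> I = {0} \<or> I = L)"

text \<open>For a semisimple \<open>L\<close> these are exactly the summands in its decomposition into simple ideals.\<close>

definition simple_components ::
  "('f::field \<Rightarrow> 'v::ab_group_add \<Rightarrow> 'v) \<Rightarrow> ('v \<Rightarrow> 'v \<Rightarrow> 'v) \<Rightarrow> 'v set \<Rightarrow> 'v set set" where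
  "simple_components s br L = {Q. lie_ideal s br L Q \<and> lie_simple s br Q}"


subsection \<open>Weights\<close>

text \<open>
  The dual of \<open>h\<close>. A functional is represented by a function on the ambient type that vanishes
  outside \<open>h\<close>, so that equal functionals are equal functions; sums and negatives stay in this form.
\<close>

definition dual_space :: "('f::field \<Rightarrow> 'v::ab_group_add \<Rightarrow> 'v) \<Rightarrow> 'v set \<Rightarrow> ('v \<Rightarrow> 'f) set" where
  "dual_space s h = {\<alpha>.
     (\<forall>x\<in>h. \<forall>y\<in>h. \<alpha> (x + y) = \<alpha> x + \<alpha> y) \<and> (\<forall>c. \<forall>x\<in>h. \<alpha> (s c x) = c * \<alpha> x) \<and>
     (\<forall>x. x \<notin> h \<longrightarrow> \<alpha> x = 0)}"

definition weight_space ::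
  "('f::field \<Rightarrow> 'v::ab_group_add \<Rightarrow> 'v) \<Rightarrow> ('v \<Rightarrow> 'v \<Rightarrow> 'v) \<Rightarrow> 'v set \<Rightarrow> 'v set \<Rightarrow> ('v \<Rightarrow> 'f) \<Rightarrow> 'v set"
  where "weight_space s br h L \<alpha> = {x \<in> L. \<forall>t\<in>h. br t x = s (\<alpha> t) x}"

definition roots ::
  "('f::field \<Rightarrow> 'v::ab_group_add \<Rightarrow> 'v) \<Rightarrow> ('v \<Rightarrow> 'v \<Rightarrow> 'v) \<Rightarrow> 'v set \<Rightarrow> 'v set \<Rightarrow> ('v \<Rightarrow> 'f) set" where
  "roots s br g h =
     {\<alpha> \<in> dual_space s h. \<alpha> \<noteq> (\<lambda>_. 0) \<and> weight_space s br h g \<alpha> \<noteq> {0}}"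

definition cartan_subalgebra ::
  "('f::field \<Rightarrow> 'v::ab_group_add \<Rightarrow> 'v) \<Rightarrow> ('v \<Rightarrow> 'v \<Rightarrow> 'v) \<Rightarrow> 'v set \<Rightarrow> 'v set \<Rightarrow> bool" where
  "cartan_subalgebra s br g h \<longleftrightarrow>
     lie_subalgebra s br g h \<and> nilpotent s br h \<and> {x \<in> g. \<forall>y\<in>h. br x y \<in> h} = h"

text \<open>For semisimple \<open>g\<close>: \<open>g\<close> is the direct sum of \<open>h = g\<^sub>0\<close> and the root spaces.\<close>

definition split_cartan ::
  "('f::field \<Rightarrow> 'v::ab_group_add \<Rightarrow> 'v) \<Rightarrow> ('v \<Rightarrow> 'v \<Rightarrow> 'v) \<Rightarrow> 'v set \<Rightarrow> 'v set \<Rightarrow> bool" where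
  "split_cartan s br g h \<longleftrightarrow>
     cartan_subalgebra s br g h \<and> h = weight_space s br h g (\<lambda>_. 0) \<and>
     direct_sum g (insert (\<lambda>_. 0) (roots s br g h)) (weight_space s br h g)"

text \<open>
  The coroot of a root \<open>\<alpha>\<close> is the unique \<open>t\<close> in \<open>[g\<^sub>\<alpha>, g\<^sub>-\<^sub>\<alpha>]\<close> with \<open>\<alpha> t = 2\<close>.
\<close>

definition integral_weights ::
  "('f::field \<Rightarrow> 'v::ab_group_add \<Rightarrow> 'v) \<Rightarrow> ('v \<Rightarrow> 'v \<Rightarrow> 'v) \<Rightarrow> 'v set \<Rightarrow> 'v set \<Rightarrow> ('v \<Rightarrow> 'f) set" where
  "integral_weights s br g h = {\<omega> \<in> dual_space s h.
     \<forall>\<alpha>\<in>roots s br g h.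
       \<forall>t\<in>prod_span s br (weight_space s br h g \<alpha>) (weight_space s br h g (\<lambda>x. - \<alpha> x)).
         \<alpha> t = 2 \<longrightarrow> \<omega> t \<in> \<int>}"

text \<open>\<open>L\<close> is \<open>(\<Gamma>, g)\<close>-graded, with weights taken relative to the split Cartan subalgebra \<open>h\<close> of \<open>g\<close>.\<close>

definition gamma_graded ::
  "('f::field \<Rightarrow> 'v::ab_group_add \<Rightarrow> 'v) \<Rightarrow> ('v \<Rightarrow> 'v \<Rightarrow> 'v) \<Rightarrow> 'v set \<Rightarrow> 'v set \<Rightarrow> 'v set
    \<Rightarrow> ('v \<Rightarrow> 'f) set \<Rightarrow> bool" where
  "gamma_graded s br L g h \<Gamma> \<longleftrightarrow>
     CHAR('f) = 0 \<and> lie_algebra s br L \<and>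
     finite \<Gamma> \<and> \<Gamma> \<subseteq> integral_weights s br g h \<and> insert (\<lambda>_. 0) (roots s br g h) \<subseteq> \<Gamma> \<and>
     lie_subalgebra s br L g \<and> finite_dim s g \<and> lie_semisimple s br g \<and> split_cartan s br g h \<and>
     direct_sum L \<Gamma> (weight_space s br h L) \<and>
     weight_space s br h L (\<lambda>_. 0) =
       module.span s (\<Union>\<alpha>\<in>{\<alpha> \<in> \<Gamma> - {\<lambda>_. 0}. (\<lambda>x. - \<alpha> x) \<in> \<Gamma> - {\<lambda>_. 0}}.
         prod_span s br (weight_space s br h L \<alpha>) (weight_space s br h L (\<lambda>x. - \<alpha> x)))"


subsection \<open>Natural and conatural modules\<close>

definition matrix_iso ::
  "('f::field \<Rightarrow> 'a::ring \<Rightarrow> 'a) \<Rightarrow> 'a set \<Rightarrow> nat \<Rightarrow> ('a \<Rightarrow> 'f mat) \<Rightarrow> bool" where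
  "matrix_iso s T n \<phi> \<longleftrightarrow>
     bij_betw \<phi> T (carrier_mat n n) \<and>
     (\<forall>x\<in>T. \<forall>y\<in>T. \<phi> (x + y) = \<phi> x + \<phi> y \<and> \<phi> (x * y) = \<phi> x * \<phi> y) \<and>
     (\<forall>c. \<forall>x\<in>T. \<phi> (s c x) = c \<cdot>\<^sub>m \<phi> x)"

text \<open>
  The weights of the representation \<open>\<rho>\<close> of the simple component \<open>Q\<close> of \<open>g\<close> on column vectors of
  length \<open>n\<close>, taken relative to \<open>h \<inter> Q\<close> and extended by zero on the other components. Since \<open>h\<close> is
  the direct sum of its intersections with the components, this determines \<open>\<omega>\<close> on \<open>h\<close>.
\<close>

definition extended_weights ::
  "('f::field \<Rightarrow> 'v::ab_group_add \<Rightarrow> 'v) \<Rightarrow> ('v \<Rightarrow> 'v \<Rightarrow> 'v) \<Rightarrow> 'v set \<Rightarrow> 'v set \<Rightarrow> 'v set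
    \<Rightarrow> nat \<Rightarrow> ('v \<Rightarrow> 'f mat) \<Rightarrow> ('v \<Rightarrow> 'f) set" where
  "extended_weights s br g h Q n \<rho> = {\<omega> \<in> dual_space s h.
     (\<exists>v\<in>carrier_vec n. v \<noteq> 0\<^sub>v n \<and> (\<forall>x\<in>h \<inter> Q. \<rho> x *\<^sub>v v = \<omega> x \<cdot>\<^sub>v v)) \<and>
     (\<forall>Q'\<in>simple_components s br g - {Q}. \<forall>x\<in>h \<inter> Q'. \<omega> x = 0)}"

text \<open>
  For a component \<open>Q = T\<^sup>(\<^sup>1\<^sup>)\<close> of \<open>S\<^sup>(\<^sup>1\<^sup>)\<close>, where \<open>T\<close> is an ideal of \<open>S\<close> isomorphic to a full matrix
  algebra, \<open>\<phi>\<close> identifies \<open>Q\<close> with the traceless matrices and makes column space the natural module.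
  All automorphisms of a matrix algebra are inner, so the weights do not depend on \<open>\<phi>\<close>.
\<close>

definition natural_weights ::
  "('f::field \<Rightarrow> 'a::ring \<Rightarrow> 'a) \<Rightarrow> 'a set \<Rightarrow> 'a set \<Rightarrow> 'a set \<Rightarrow> ('a \<Rightarrow> 'f) set" where
  "natural_weights s S h Q = {\<omega>. \<exists>T n \<phi>.
     assoc_ideal s S T \<and> comm_span s T = Q \<and> matrix_iso s T n \<phi> \<and>
     \<omega> \<in> extended_weights s commutator (comm_span s S) h Q n \<phi>}"

definition conatural_weights ::
  "('f::field \<Rightarrow> 'a::ring \<Rightarrow> 'a) \<Rightarrow> 'a set \<Rightarrow> 'a set \<Rightarrow> 'a set \<Rightarrow> ('a \<Rightarrow> 'f) set" where
  "conatural_weights s S h Q = {\<omega>. \<exists>T n \<phi>.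
     assoc_ideal s S T \<and> comm_span s T = Q \<and> matrix_iso s T n \<phi> \<and>
     \<omega> \<in> extended_weights s commutator (comm_span s S) h Q n (\<lambda>x. - transpose_mat (\<phi> x))}"

definition component_weights ::
  "('f::field \<Rightarrow> 'a::ring \<Rightarrow> 'a) \<Rightarrow> 'a set \<Rightarrow> 'a set \<Rightarrow> 'a set \<Rightarrow> ('a \<Rightarrow> 'f) set" where
  "component_weights s S h Q =
     insert (\<lambda>_. 0) (natural_weights s S h Q \<union> conatural_weights s S h Q)"

text \<open>
  The sums \<open>\<lambda>\<^sub>i + \<lambda>\<^sub>j\<close> range over unordered pairs of distinct components. The third set lists the sums
  in which one summand is zero. It is contained in the fourth one as soon as there are at least two
  components; it matters only if \<open>S\<^sup>(\<^sup>1\<^sup>)\<close> is simple, when there is no pair \<open>i < j\<close> at all. There the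
  natural and conatural weights have to be admitted: for \<open>S = M\<^sub>n\<close> embedded as the upper left block of
  \<open>A = M\<^sub>n\<^sub>+\<^sub>1\<close> they occur in \<open>A\<^sup>(\<^sup>1\<^sup>)\<close>.
\<close>

definition Gamma_set ::
  "('f::field \<Rightarrow> 'a::ring \<Rightarrow> 'a) \<Rightarrow> 'a set \<Rightarrow> 'a set \<Rightarrow> ('a \<Rightarrow> 'f) set" where
  "Gamma_set s S h =
     roots s commutator (comm_span s S) h \<union> {\<lambda>_. 0} \<union>
     {\<omega>. \<exists>Q\<in>simple_components s commutator (comm_span s S). \<omega> \<in> component_weights s S h Q} \<union>
     {\<omega>. \<exists>Q\<in>simple_components s commutator (comm_span s S).
          \<exists>Q'\<in>simple_components s commutator (comm_span s S). Q \<noteq> Q' \<and>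
          (\<exists>\<mu>\<in>component_weights s S h Q. \<exists>\<nu>\<in>component_weights s S h Q'. \<omega> = (\<lambda>x. \<mu> x + \<nu> x))}"

end

theory Submission
  imports Defs
begin

text \<open>
  Over an algebraically closed field a finite-dimensional semisimple algebra is semiprime, so a
  maximal set \<open>P\<close> of orthogonal primitive idempotents sums to its unit and extends to a system of
  matrix units. Every split Cartan subalgebra of \<open>S\<^sup>(\<^sup>1\<^sup>)\<close> consists of the traceless elements of
  the span of such a \<open>P\<close>. The Peirce decomposition of \<open>A\<close> relative to \<open>P\<close> and the complement of its
  sum is then the weight decomposition, with weights \<open>\<epsilon>\<^sub>e - \<epsilon>\<^sub>f\<close>, where \<open>\<epsilon> = 0\<close> for the
  complement. The condition on the zero weight space comes down to two identities: one writes
  \<open>2 [u, v]\<close> for \<open>u, v \<in> e A e\<close> by means of a second idempotent in the block of \<open>e\<close>, and the other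
  is \<open>[u v, y] = [u, v y] - [y u, v]\<close>, which applies to the complement because \<open>S\<close> generates \<open>A\<close>.
\<close>

subsection \<open>Linear algebra\<close>

text \<open>The grading has to hold for every split Cartan subalgebra, so matrix units cannot be
  fixed in advance; they must be extracted from the given subalgebra. The algebra to decompose is
  then its centralizer in \<open>S\<close>, of which no structure is known beforehand. For this
  reason the idempotents come from \<open>semiprime\<close>, a condition that passes to the corner
  orthogonal to a primitive system and that can be verified directly for the centralizer, and not
  from a decomposition into matrix algebras. Two idempotents in each block, the form that
  1-perfectness takes, serve to tell all the weights apart, also from those that involve the
  complement, and to make every component of \<open>S\<^sup>(\<^sup>1\<^sup>)\<close> nonabelian.
  \<open>A\<close> need not have a unit, so the complement exists only as an operator on either
  side. No matrix unit joins it to an idempotent of \<open>P\<close>; hence its commutators need a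
  route of their own, through products that pass through \<open>P\<close>.\<close>

lemma (in vector_space) psubspace_dim_less:
  assumes "finite B" "W \<subseteq> span B" "subspace V" "V \<subset> W"
  shows "dim V < dim W"
proof -
  obtain C where C: "C \<subseteq> V" "independent C" "V \<subseteq> span C" "card C = dim V"
    using basis_exists by blast
  have "C \<subseteq> W" using C(1) assms(4) by blast
  then obtain D where D: "C \<subseteq> D" "D \<subseteq> W" "independent D" "W \<subseteq> span D"
    using maximal_independent_subset_extend[OF _ C(2)] by blast
  have "finite D"
    using independent_span_bound[OF assms(1) D(3)] D(2) assms(2) by blast
  moreover have "C \<noteq> D"
  proof
    assume "C = D"
    then have "W \<subseteq> V" using D(4) span_minimal[OF C(1) assms(3)] by blast
    then show False using assms(4) by blast
  qed
  ultimately have "card C < card D" using D(1) by (simp add: psubset_card_mono)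
  then show ?thesis
    using C(4) basis_card_eq_dim[OF D(2,4,3)] by simp
qed

text \<open>Polynomials in \<open>f\<close> act on one nonzero vector \<open>v\<close>, with
  \<open>ev p\<close> standing for \<open>p(f) v\<close>. Finite dimension gives a nonzero
  \<open>p\<close> with \<open>ev p = 0\<close>. If its degree is least and \<open>c\<close> is a
  root, the cofactor \<open>q\<close> of \<open>X - c\<close> has \<open>ev q \<noteq> 0\<close>,
  and \<open>ev q\<close> is an eigenvector for \<open>c\<close>.\<close>

lemma exists_eigenvector:
  fixes s :: "'f::alg_closed_field \<Rightarrow> 'v::ab_group_add \<Rightarrow> 'v"
  assumes "vector_space s" and "finite B" "V \<subseteq> module.span s B" "module.subspace s V" "V \<noteq> {0}"
    and f_V: "\<And>x. x \<in> V \<Longrightarrow> f x \<in> V"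
    and f_add: "\<And>x y. f (x + y) = f x + f y" and f_scale: "\<And>c x. f (s c x) = s c (f x)"
  shows "\<exists>c. \<exists>v\<in>V. v \<noteq> 0 \<and> f v = s c v"
proof -
  interpret vector_space s by fact
  obtain v where v: "v \<in> V" "v \<noteq> 0"
    using assms(4,5) subspace_0 by blast
  interpret f: module_hom s s f
    using f_add f_scale by unfold_locales auto
  define w where "w i = (f ^^ i) v" for i
  have w_V: "w i \<in> V" for i unfolding w_def by (induction i) (auto simp: v f_V)
  have w_Suc: "f (w i) = w (Suc i)" for i unfolding w_def by simp
  define ev where "ev p = (\<Sum>i\<le>degree p. s (coeff p i) (w i))" for p
  have ev_eq: "ev p = (\<Sum>i\<le>n. s (coeff p i) (w i))" if "degree p \<le> n" for p n
    unfolding ev_def using that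
    by (intro sum.mono_neutral_left) (auto simp: coeff_eq_0)
  have ev_V: "ev p \<in> V" for p
    unfolding ev_def by (intro subspace_sum subspace_scale assms w_V)
  have ev_linear: "ev ([:-c, 1:] * q) = f (ev q) - s c (ev q)" for c q
  proof -
    let ?n = "degree q"
    have eq: "[:-c, 1:] * q = pCons 0 q - Polynomial.smult c q" by simp
    have "degree ([:-c, 1:] * q) \<le> Suc ?n"
      using degree_mult_le[of "[:-c, 1:]" q] by simp
    then have "ev ([:-c, 1:] * q)
        = (\<Sum>i\<le>Suc ?n. s (coeff (pCons 0 q) i) (w i)) - (\<Sum>i\<le>Suc ?n. s (coeff (Polynomial.smult c q) i) (w i))"
      unfolding sum_subtractf[symmetric] by (subst ev_eq[of _ "Suc ?n"]) (auto simp: eq scale_left_diff_distrib)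
    also have "(\<Sum>i\<le>Suc ?n. s (coeff (pCons 0 q) i) (w i)) = (\<Sum>i\<le>?n. s (coeff q i) (w (Suc i)))"
      by (subst sum.atMost_Suc_shift) simp
    also have "\<dots> = f (ev q)" unfolding ev_def by (simp add: f.sum f.scale w_Suc)
    also have "(\<Sum>i\<le>Suc ?n. s (coeff (Polynomial.smult c q) i) (w i)) = s c (ev q)"
      unfolding ev_def by (simp add: scale_sum_right coeff_eq_0)
    finally show ?thesis .
  qed
  have "\<exists>p. p \<noteq> 0 \<and> ev p = 0"
  \<comment> \<open>Dependence is a property of sets, which forget repetitions. Equal iterates
    \<open>w i = w j\<close> are therefore handled apart, by the polynomial
    \<open>X^i - X^j\<close>.\<close>
  proof (cases "inj_on w {..card B}")
    case False
    then obtain i j where ij: "i \<noteq> j" "w i = w j" unfolding inj_on_def by blast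
    define p :: "'f poly" where "p = monom 1 i - monom 1 j"
    have "coeff p i = 1" using ij by (simp add: p_def)
    moreover have "ev p = (\<Sum>k\<le>degree p + i + j. s (coeff p k) (w k))"
      by (rule ev_eq) simp
    then have "ev p = (\<Sum>k\<le>degree p + i + j. (if k = i then w i else 0) - (if k = j then w j else 0))"
      using ij(1) by (auto simp: p_def intro!: sum.cong)
    then have "ev p = 0" using ij(2) by (simp add: sum_subtractf)
    ultimately show ?thesis by (metis coeff_0 zero_neq_one)
  next
    case True
    let ?A = "w ` {..card B}"
    have "card ?A = Suc (card B)" using True by (simp add: card_image)
    moreover have "?A \<subseteq> span B" using w_V assms(3) by blast
    ultimately have "dependent ?A"
      using independent_span_bound[OF assms(2)] by fastforce
    then obtain u x where u: "x \<in> ?A" "u x \<noteq> 0" "(\<Sum>x\<in>?A. s (u x) x) = 0"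
      using dependent_finite[of ?A] by auto
    define p :: "'f poly" where "p = (\<Sum>i\<le>card B. monom (u (w i)) i)"
    have c: "coeff p i = (if i \<le> card B then u (w i) else 0)" for i
      by (simp add: p_def coeff_sum if_distrib)
    have "degree p \<le> card B" by (rule degree_le) (simp add: c)
    then have "ev p = (\<Sum>i\<le>card B. s (coeff p i) (w i))" by (rule ev_eq)
    also have "\<dots> = (\<Sum>x\<in>?A. s (u x) x)" by (simp add: c sum.reindex[OF True])
    finally have "ev p = 0" using u(3) by simp
    moreover obtain i where "i \<le> card B" "u (w i) \<noteq> 0" using u(1,2) by auto
    then have "p \<noteq> 0" using c[of i] by (metis coeff_0)
    ultimately show ?thesis by blast
  qed
  then obtain p where p: "p \<noteq> 0" "ev p = 0"
    and p_min: "\<And>q. q \<noteq> 0 \<Longrightarrow> ev q = 0 \<Longrightarrow> degree p \<le> degree q"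
    using ex_has_least_nat[of "\<lambda>p. p \<noteq> 0 \<and> ev p = 0" _ degree] by blast
  have "degree p \<noteq> 0"
  proof
    assume d: "degree p = 0"
    then have "ev p = s (coeff p 0) v" by (simp add: ev_def w_def)
    moreover have "coeff p 0 \<noteq> 0" using p(1) d leading_coeff_neq_0[of p] by simp
    ultimately show False using p(2) v by simp
  qed
  then obtain c where "poly p c = 0" using alg_closed_imp_poly_has_root[of p] by auto
  then obtain q where q: "p = [:-c, 1:] * q" using poly_eq_0_iff_dvd[of p c] by (auto elim: dvdE)
  have q0: "q \<noteq> 0" using p(1) q by auto
  then have "degree p = Suc (degree q)" unfolding q by (subst degree_mult_eq) auto
  then have "ev q \<noteq> 0" using p_min[OF q0] by auto
  moreover have "f (ev q) = s c (ev q)" using ev_linear[of c q] p(2) q by simp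
  ultimately show ?thesis using ev_V by blast
qed

subsection \<open>Semiprime algebras and primitive idempotents\<close>

context assoc_algebra
begin

lemma mult_sum_scale: "x * (\<Sum>i\<in>I. s (c i) (y i)) = (\<Sum>i\<in>I. s (c i) (x * y i))"
  by (simp add: sum_distrib_left scale_mult_right)

definition semiprime :: "'a set \<Rightarrow> bool" where
  "semiprime S \<longleftrightarrow> (\<forall>x\<in>S. (\<forall>y\<in>S. x * y * x = 0) \<longrightarrow> x = 0)"

lemma semiprimeD: "semiprime S \<Longrightarrow> x \<in> S \<Longrightarrow> (\<And>y. y \<in> S \<Longrightarrow> x * y * x = 0) \<Longrightarrow> x = 0"
  unfolding semiprime_def by blast

lemma subalgebraD:
  assumes "assoc_subalgebra s S"
  shows "subspace S" "\<And>x y. x \<in> S \<Longrightarrow> y \<in> S \<Longrightarrow> x * y \<in> S" "0 \<in> S"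
    "\<And>x y. x \<in> S \<Longrightarrow> y \<in> S \<Longrightarrow> x + y \<in> S" "\<And>x y. x \<in> S \<Longrightarrow> y \<in> S \<Longrightarrow> x - y \<in> S"
    "\<And>c x. x \<in> S \<Longrightarrow> s c x \<in> S" "\<And>x. x \<in> S \<Longrightarrow> - x \<in> S"
  using assms subspace_0 subspace_add subspace_diff subspace_scale subspace_neg
  unfolding assoc_subalgebra_def by auto

section \<open>Semisimple algebras as semiprime algebras\<close>

lemma semisimple_square_zero:
  assumes "semisimple_algebra s S" "assoc_ideal s S I"
    and "\<And>x y. x \<in> I \<Longrightarrow> y \<in> I \<Longrightarrow> x * y = 0"
  shows "I = {0}"
proof -
  have "0 \<in> I" using assms(2) subspace_0 unfolding assoc_ideal_def by blast
  then have "{x * y |x y. x \<in> I \<and> y \<in> I} = {0}" using assms(3) by force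
  then have "desc_power s (*) I 1 = {0}" by (simp add: prod_span_def)
  then show ?thesis using assms(1,2) unfolding semisimple_algebra_def nilpotent_def by blast
qed

text \<open>If \<open>x S x = 0\<close>, the ideal spanned by \<open>S x S\<close> has square zero,
  since \<open>(t x u) (t' x u')\<close> contains \<open>x (u t') x\<close>. As \<open>S\<close> is
  not yet known to have a unit, \<open>S x S = 0\<close> does not give \<open>x = 0\<close> at once;
  the left and right annihilators of \<open>S\<close>, themselves ideals of square zero, have to
  vanish first.\<close>

lemma semisimple_imp_semiprime:
  assumes S: "assoc_subalgebra s S" and ss: "semisimple_algebra s S"
  shows "semiprime S"
proof -
  note S' = subalgebraD[OF S]
  have l: "{y\<in>S. \<forall>t\<in>S. t * y = 0} = {0}"
  proof (rule semisimple_square_zero[OF ss])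
    show "assoc_ideal s S {y\<in>S. \<forall>t\<in>S. t * y = 0}"
      unfolding assoc_ideal_def using S'
      by (auto intro!: subspaceI simp: ring_distribs scale_mult_right mult.assoc[symmetric])
  qed auto
  have r: "{y\<in>S. \<forall>t\<in>S. y * t = 0} = {0}"
  proof (rule semisimple_square_zero[OF ss])
    show "assoc_ideal s S {y\<in>S. \<forall>t\<in>S. y * t = 0}"
      unfolding assoc_ideal_def using S'
      by (auto intro!: subspaceI simp: ring_distribs scale_mult_left mult.assoc)
  qed auto
  have SyS: "y = 0" if y: "y \<in> S" "\<And>t u. t \<in> S \<Longrightarrow> u \<in> S \<Longrightarrow> t * y * u = 0" for y
  proof -
    have "y * u = 0" if u: "u \<in> S" for u
    proof -
      have "y * u \<in> {y\<in>S. \<forall>t\<in>S. t * y = 0}" using y u S'(2) by (auto simp: mult.assoc)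
      then show ?thesis using l by auto
    qed
    then show ?thesis using r y(1) by auto
  qed
  show ?thesis unfolding semiprime_def
  proof (intro ballI impI)
    fix x assume x: "x \<in> S" "\<forall>y\<in>S. x * y * x = 0"
    let ?G = "{t * x * u |t u. t \<in> S \<and> u \<in> S}"
    have sub: "span ?G \<subseteq> S" by (rule span_minimal) (use x S' in auto)
    have "assoc_ideal s S (span ?G)"
      unfolding assoc_ideal_def
    proof (intro conjI ballI sub)
      fix b y assume b: "b \<in> S" and y: "y \<in> span ?G"
      show "b * y \<in> span ?G" using y
      proof (induction rule: span_induct_alt)
        case (step c z w)
        then obtain t u where "z = t * x * u" "t \<in> S" "u \<in> S" by blast
        then have "b * z = (b * t) * x * u" "b * t \<in> S" using b S'(2) by (auto simp: mult.assoc)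
        then have "b * z \<in> span ?G" using \<open>u \<in> S\<close> by (intro span_base) blast
        then show ?case using step by (simp add: distrib_left scale_mult_right span_add span_scale)
      qed (simp add: span_zero)
      show "y * b \<in> span ?G" using y
      proof (induction rule: span_induct_alt)
        case (step c z w)
        then obtain t u where "z = t * x * u" "t \<in> S" "u \<in> S" by blast
        then have "z * b = t * x * (u * b)" "u * b \<in> S" using b S'(2) by (auto simp: mult.assoc)
        then have "z * b \<in> span ?G" using \<open>t \<in> S\<close> by (intro span_base) blast
        then show ?case using step by (simp add: distrib_right scale_mult_left span_add span_scale)
      qed (simp add: span_zero)
    qed auto
    moreover have "y * z = 0" if y: "y \<in> span ?G" and z: "z \<in> span ?G" for y z
    proof -
      have *: "y' * z = 0" if y': "y' \<in> ?G" for y' using z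
      proof (induction rule: span_induct_alt)
        case (step c z' w)
        obtain t u where tu: "y' = t * x * u" "t \<in> S" "u \<in> S" using y' by blast
        obtain t' u' where tu': "z' = t' * x * u'" "t' \<in> S" "u' \<in> S" using step by blast
        have "y' * z' = t * (x * (u * t') * x) * u'" by (simp add: tu tu' mult.assoc)
        also have "\<dots> = 0" using x(2) S'(2)[OF tu(3) tu'(2)] by simp
        finally show ?case using step by (simp add: distrib_left scale_mult_right)
      qed simp
      show ?thesis using y
        by (induction rule: span_induct_alt) (auto simp: distrib_right scale_mult_left *)
    qed
    ultimately have "span ?G = {0}" by (rule semisimple_square_zero[OF ss])
    then have "t * x * u = 0" if "t \<in> S" "u \<in> S" for t u
      using that span_base[of "t * x * u" ?G] by auto
    then show "x = 0" using SyS x(1) by blast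
  qed
qed

text \<open>Primitivity is encoded as \<open>e S e\<close> being the line through \<open>e\<close>.
  This is the form that algebraic closedness yields, and it makes the Peirce components within a
  block one-dimensional.\<close>

definition primitive_system :: "'a set \<Rightarrow> 'a set \<Rightarrow> bool" where
  "primitive_system S P \<longleftrightarrow> finite P \<and> P \<subseteq> S \<and>
     (\<forall>e\<in>P. e \<noteq> 0 \<and> e * e = e \<and> (\<forall>x\<in>S. \<exists>c. e * x * e = s c e)) \<and>
     (\<forall>e\<in>P. \<forall>f\<in>P. e \<noteq> f \<longrightarrow> e * f = 0)"

lemma primitive_system_sum:
  assumes "primitive_system S P" "e \<in> P"
  shows "e * \<Sum>P = e" "\<Sum>P * e = e"
proof -
  have P: "finite P" "\<And>f. f \<in> P \<Longrightarrow> e * f = (if f = e then e else 0)"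
    "\<And>f. f \<in> P \<Longrightarrow> f * e = (if f = e then e else 0)"
    using assms unfolding primitive_system_def by auto
  show "e * \<Sum>P = e" "\<Sum>P * e = e"
    unfolding sum_distrib_left sum_distrib_right using P assms(2) by simp_all
qed

text \<open>Bounds the size of primitive systems in a finite-dimensional algebra, so that a largest
  one exists.\<close>

lemma primitive_system_independent:
  assumes "primitive_system S P"
  shows "independent P"
proof (rule independent_if_scalars_zero)
  show "finite P" using assms unfolding primitive_system_def by blast
  fix u e assume 0: "(\<Sum>x\<in>P. s (u x) x) = 0" and e: "e \<in> P"
  have "0 = e * (\<Sum>x\<in>P. s (u x) x)" by (simp add: 0)
  also have "\<dots> = (\<Sum>x\<in>P. if x = e then s (u e) e else 0)"
    unfolding mult_sum_scale using assms e unfolding primitive_system_def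
    by (intro sum.cong) auto
  also have "\<dots> = s (u e) e" using \<open>finite P\<close> e by simp
  finally show "u e = 0" using assms e unfolding primitive_system_def by auto
qed

end

locale alg_closed_algebra = assoc_algebra s
  for s :: "'f::alg_closed_field \<Rightarrow> 'a::ring \<Rightarrow> 'a"
begin

text \<open>The idempotent generates a left ideal of minimal dimension. Right multiplication by an
  element of \<open>e S e\<close> has an eigenvector there, and the eigenvectors form a left ideal.\<close>

lemma primitive_idempotent_exists:
  assumes S: "assoc_subalgebra s S" and "finite B" "S \<subseteq> span B"
    and sp: "semiprime S" and "S \<noteq> {0}"
  shows "\<exists>e\<in>S. e \<noteq> 0 \<and> e * e = e \<and> (\<forall>x\<in>S. \<exists>c. e * x * e = s c e)"
proof -
  note S' = subalgebraD[OF S]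
  define LI where "LI L \<longleftrightarrow> subspace L \<and> L \<subseteq> S \<and> (\<forall>x\<in>S. \<forall>l\<in>L. x * l \<in> L) \<and> L \<noteq> {0}" for L
  have "LI S" unfolding LI_def using S' assms(5) by blast
  then obtain L where L: "LI L" and least: "\<And>L'. LI L' \<Longrightarrow> dim L \<le> dim L'"
    using ex_has_least_nat[of LI S dim] by blast
  have min: "L' = L" if "LI L'" "L' \<subseteq> L" for L'
  proof (rule ccontr)
    assume "L' \<noteq> L"
    then have "dim L' < dim L"
      using psubspace_dim_less[OF assms(2), of L L'] that L assms(3) unfolding LI_def by blast
    then show False using least[OF that(1)] by simp
  qed
  have Lsub: "subspace L" and LS: "L \<subseteq> S" and Lm: "\<And>x l. x \<in> S \<Longrightarrow> l \<in> L \<Longrightarrow> x * l \<in> L" "L \<noteq> {0}"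
    using L unfolding LI_def by auto
  obtain l where l: "l \<in> L" "l \<noteq> 0" using Lm(2) subspace_0[OF Lsub] by blast
  then obtain y where y: "y \<in> S" "l * y * l \<noteq> 0" using semiprimeD[OF sp, of l] LS by blast
  \<comment> \<open>\<open>L a\<close> is a nonzero left ideal inside \<open>L\<close>, hence all of
    \<open>L\<close>. This provides \<open>e\<close> with \<open>e * a = a\<close>, the candidate
    for the idempotent.\<close>
  define a where "a = y * l"
  have a: "a \<in> L" "l * a \<noteq> 0" using Lm(1)[OF y(1) l(1)] y(2) by (auto simp: a_def mult.assoc)
  have "LI ((\<lambda>x. x * a) ` L)"
    unfolding LI_def
  proof (intro conjI ballI subspaceI)
    show "0 \<in> (\<lambda>x. x * a) ` L" using subspace_0[OF Lsub] by force
    show "(\<lambda>x. x * a) ` L \<subseteq> S" using a(1) LS S'(2) by blast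
    show "(\<lambda>x. x * a) ` L \<noteq> {0}" using a(2) l(1) by blast
  next
    fix x z assume "x \<in> (\<lambda>x. x * a) ` L" "z \<in> (\<lambda>x. x * a) ` L"
    then obtain x' z' where "x = x' * a" "z = z' * a" "x' \<in> L" "z' \<in> L" by blast
    then have "x + z = (x' + z') * a" "x' + z' \<in> L"
      using subspace_add[OF Lsub] by (auto simp: distrib_right)
    then show "x + z \<in> (\<lambda>x. x * a) ` L" by blast
  next
    fix c x assume "x \<in> (\<lambda>x. x * a) ` L"
    then obtain x' where "x = x' * a" "x' \<in> L" by blast
    then have "s c x = s c x' * a" "s c x' \<in> L"
      using subspace_scale[OF Lsub] by (auto simp: scale_mult_left)
    then show "s c x \<in> (\<lambda>x. x * a) ` L" by blast
  next
    fix t x assume "t \<in> S" "x \<in> (\<lambda>x. x * a) ` L"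
    then obtain x' where "x = x' * a" "x' \<in> L" by blast
    then have "t * x = (t * x') * a" "t * x' \<in> L"
      using Lm \<open>t \<in> S\<close> by (auto simp: mult.assoc)
    then show "t * x \<in> (\<lambda>x. x * a) ` L" by blast
  qed
  moreover have "(\<lambda>x. x * a) ` L \<subseteq> L" using a(1) Lm(1) LS by blast
  ultimately have "(\<lambda>x. x * a) ` L = L" by (rule min)
  then obtain e where e: "e \<in> L" "e * a = a" using a(1) by force
  \<comment> \<open>The annihilator of \<open>a\<close> in \<open>L\<close> is a left ideal that
    misses \<open>l\<close>, so it is zero by minimality. It contains \<open>e * e - e\<close>,
    which makes \<open>e\<close> idempotent.\<close>
  have N: "{x\<in>L. x * a = 0} = {0}"
  proof (rule ccontr)
    assume nz: "{x\<in>L. x * a = 0} \<noteq> {0}"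
    have "LI {x\<in>L. x * a = 0}"
      unfolding LI_def
    proof (intro conjI nz subspaceI ballI)
      fix x l assume "x \<in> S" "l \<in> {x\<in>L. x * a = 0}"
      then show "x * l \<in> {x\<in>L. x * a = 0}" using Lm(1) by (simp add: mult.assoc)
    qed (use LS subspace_0[OF Lsub] subspace_add[OF Lsub] subspace_scale[OF Lsub]
        in \<open>auto simp: distrib_right scale_mult_left\<close>)
    then have "{x\<in>L. x * a = 0} = L" by (rule min) auto
    then show False using l(1) a(2) by blast
  qed
  have eS: "e \<in> S" using e(1) LS by blast
  have "e * e - e \<in> {x\<in>L. x * a = 0}"
    using e Lm(1)[OF eS e(1)] subspace_diff[OF Lsub] by (auto simp: left_diff_distrib mult.assoc)
  then have ee: "e * e = e" using N by auto
  have "e \<noteq> 0" using e(2) a(2) by auto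
  moreover have "\<exists>c. e * x * e = s c e" if x: "x \<in> S" for x
  proof -
    define z where "z = e * x * e"
    have zL: "z \<in> L" using Lm(1)[OF S'(2)[OF eS x] e(1)] by (simp add: z_def)
    have "\<exists>c. \<exists>v\<in>L. v \<noteq> 0 \<and> v * z = s c v"
    proof (rule exists_eigenvector[OF vector_space_axioms assms(2)])
      show "v * z \<in> L" if "v \<in> L" for v using that Lm(1) LS zL by blast
    qed (use LS assms(3) Lsub Lm(2) in \<open>auto simp: distrib_right scale_mult_left\<close>)
    then obtain c v where v: "v \<in> L" "v \<noteq> 0" "v * z = s c v" by blast
    let ?N = "{v\<in>L. v * z = s c v}"
    have "LI ?N"
      unfolding LI_def
    proof (intro conjI subspaceI ballI)
      show "?N \<noteq> {0}" using v by blast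
      fix x l assume "x \<in> S" "l \<in> ?N"
      then show "x * l \<in> ?N" using Lm(1) by (simp add: mult.assoc scale_mult_right)
    next
      fix d x assume "x \<in> ?N"
      then show "s d x \<in> ?N" using subspace_scale[OF Lsub]
        by (simp add: scale_mult_left scale_left_commute[of d c] del: scale_scale)
    qed (use LS subspace_0[OF Lsub] subspace_add[OF Lsub]
        in \<open>auto simp: distrib_right scale_right_distrib\<close>)
    then have "?N = L" by (rule min) auto
    then have "e * z = s c e" using e(1) by blast
    moreover have "e * z = z" by (simp add: z_def mult.assoc[symmetric] ee)
    ultimately show ?thesis unfolding z_def[symmetric] by metis
  qed
  ultimately show ?thesis using eS ee by blast
qed

text \<open>A system of largest size leaves no room for another idempotent, so the corner
  \<open>S1\<close> orthogonal to it is zero. That its sum is a unit of \<open>S\<close>, which is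
  not assumed to have one, is then a second application of semiprimeness.\<close>

lemma complete_primitive_system_exists:
  assumes S: "assoc_subalgebra s S" and B: "finite B" "S \<subseteq> span B" and sp: "semiprime S"
  obtains P where "primitive_system S P" "\<And>x. x \<in> S \<Longrightarrow> \<Sum>P * x = x" "\<And>x. x \<in> S \<Longrightarrow> x * \<Sum>P = x"
proof -
  note S' = subalgebraD[OF S]
  have "primitive_system S {}" unfolding primitive_system_def by auto
  moreover have "card P \<le> card B" if "primitive_system S P" for P
  proof -
    have "P \<subseteq> span B" using that B(2) unfolding primitive_system_def by blast
    then show ?thesis
      using independent_span_bound[OF B(1) primitive_system_independent[OF that]] by blast
  qed
  ultimately obtain P where P: "primitive_system S P"
    and max: "\<And>Q. primitive_system S Q \<Longrightarrow> card Q \<le> card P"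
    using ex_has_greatest_nat[of "primitive_system S" "{}" card "Suc (card B)"]
    unfolding less_Suc_eq_le by blast
  define p where "p = \<Sum>P"
  have PD: "finite P" "P \<subseteq> S" "\<And>e. e \<in> P \<Longrightarrow> e * e = e" "\<And>e. e \<in> P \<Longrightarrow> e \<noteq> 0"
      "\<And>e x. e \<in> P \<Longrightarrow> x \<in> S \<Longrightarrow> \<exists>c. e * x * e = s c e"
      "\<And>e f. e \<in> P \<Longrightarrow> f \<in> P \<Longrightarrow> e \<noteq> f \<Longrightarrow> e * f = 0"
    using P unfolding primitive_system_def by auto
  have ep: "e * p = e" "p * e = e" if "e \<in> P" for e
    using primitive_system_sum[OF P that] by (auto simp: p_def)
  have pS: "p \<in> S" unfolding p_def using S'(1) PD(2) by (intro subspace_sum) auto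
  have p0: "x * p = 0" if "\<And>e. e \<in> P \<Longrightarrow> x * e = 0" for x
    unfolding p_def sum_distrib_left using that by simp
  have p0': "p * x = 0" if "\<And>e. e \<in> P \<Longrightarrow> e * x = 0" for x
    unfolding p_def sum_distrib_right using that by simp
  define S1 where "S1 = {x\<in>S. \<forall>e\<in>P. e * x = 0 \<and> x * e = 0}"
  \<comment> \<open>The two-sided cut by \<open>1 - p\<close>, multiplied out because no unit is
    available.\<close>
  define cut where "cut x = x - p * x - x * p + p * x * p" for x
  have cut: "cut x \<in> S1" if "x \<in> S" for x
  proof -
    have "e * cut x = 0" "cut x * e = 0" if e: "e \<in> P" for e
    proof -
      have "e * cut x = e * x - (e * p) * x - e * x * p + (e * p) * x * p"
        by (simp add: cut_def algebra_simps)
      then show "e * cut x = 0" by (simp add: ep e)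
      have "cut x * e = x * e - p * x * e - x * (p * e) + p * x * (p * e)"
        by (simp add: cut_def algebra_simps)
      then show "cut x * e = 0" by (simp add: ep e)
    qed
    then show ?thesis unfolding S1_def using that pS S' by (auto simp: cut_def)
  qed
  \<comment> \<open>For \<open>x\<close> in \<open>S1\<close> the products \<open>x S x\<close> and
    \<open>x S1 x\<close> agree. Hence semiprimeness passes from \<open>S\<close> down to
    \<open>S1\<close>, and primitivity of an idempotent of \<open>S1\<close> goes back up to
    \<open>S\<close>.\<close>
  have cut_eq: "x * cut y * x = x * y * x" if "x \<in> S1" for x y
  proof -
    have x: "x * p = 0" "p * x = 0" using that p0 p0' by (auto simp: S1_def)
    have "x * cut y * x = x * y * x - (x * p) * y * x - x * y * (p * x) + (x * p) * y * (p * x)"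
      by (simp add: cut_def algebra_simps)
    then show ?thesis by (simp add: x)
  qed
  have "S1 = {0}"
  proof (rule ccontr)
    assume nz: "S1 \<noteq> {0}"
    have sub: "assoc_subalgebra s S1"
      unfolding assoc_subalgebra_def
    proof (intro conjI ballI subspaceI)
      fix x y assume "x \<in> S1" "y \<in> S1"
      then have "x * y \<in> S" "e * (x * y) = (e * x) * y" "(x * y) * e = x * (y * e)" for e
        using S'(2) by (auto simp: S1_def mult.assoc)
      then show "x * y \<in> S1" using \<open>x \<in> S1\<close> \<open>y \<in> S1\<close> by (auto simp: S1_def)
    qed (use S' in \<open>auto simp: S1_def ring_distribs scale_mult_left scale_mult_right\<close>)
    have sp1: "semiprime S1"
      unfolding semiprime_def
    proof (intro ballI impI)
      fix x assume x: "x \<in> S1" "\<forall>y\<in>S1. x * y * x = 0"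
      have "x * y * x = 0" if "y \<in> S" for y
        using x(2) cut[OF that] cut_eq[OF x(1)] by auto
      then show "x = 0" using semiprimeD[OF sp] x(1) by (auto simp: S1_def)
    qed
    have "S1 \<subseteq> span B" using B(2) by (auto simp: S1_def)
    then obtain e where e: "e \<in> S1" "e \<noteq> 0" "e * e = e" "\<And>x. x \<in> S1 \<Longrightarrow> \<exists>c. e * x * e = s c e"
      using primitive_idempotent_exists[OF sub B(1) _ sp1 nz] by metis
    have ex: "\<exists>c. e * x * e = s c e" if "x \<in> S" for x
      using e(4)[OF cut[OF that]] cut_eq[OF e(1)] by simp
    have "e \<notin> P" using e(1,2,3) by (auto simp: S1_def)
    moreover have "primitive_system S (insert e P)"
      unfolding primitive_system_def
    proof (intro conjI ballI)
      show "insert e P \<subseteq> S" using e(1) PD(2) by (auto simp: S1_def)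
      have "\<And>f. f \<in> P \<Longrightarrow> e * f = 0 \<and> f * e = 0" using e(1) by (auto simp: S1_def)
      then show "f \<noteq> k \<longrightarrow> f * k = 0" if "f \<in> insert e P" "k \<in> insert e P" for f k
        using PD(6) that by auto
    qed (use PD(1,3,4,5) e(2,3) ex in auto)
    ultimately show False using max[of "insert e P"] card_insert_disjoint[OF PD(1)] by simp
  qed
  then have S1_0: "x = 0" if "x \<in> S" "\<And>e. e \<in> P \<Longrightarrow> e * x = 0" "\<And>e. e \<in> P \<Longrightarrow> x * e = 0" for x
    using that by (auto simp: S1_def)
  \<comment> \<open>If \<open>y\<close> is killed by \<open>P\<close> from the right, then
    \<open>(1 - p) t y\<close> lies in the zero corner \<open>S1\<close>. So
    \<open>t y = p t y\<close>, and \<open>y t y = (y p) t y = 0\<close> for all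
    \<open>t\<close>.\<close>
  have r: "y = 0" if y: "y \<in> S" "\<And>e. e \<in> P \<Longrightarrow> y * e = 0" for y
  proof (rule semiprimeD[OF sp y(1)])
    fix t assume t: "t \<in> S"
    have "t * y - p * (t * y) = 0"
    proof (rule S1_0)
      fix e assume "e \<in> P"
      then show "e * (t * y - p * (t * y)) = 0" "(t * y - p * (t * y)) * e = 0"
        using y(2) by (simp_all add: right_diff_distrib left_diff_distrib mult.assoc)
          (simp add: mult.assoc[symmetric] ep)
    qed (use t y S' pS in auto)
    then have "y * t * y = (y * p) * (t * y)" by (simp add: mult.assoc)
    then show "y * t * y = 0" using p0[OF y(2)] by simp
  qed
  have l: "y = 0" if y: "y \<in> S" "\<And>e. e \<in> P \<Longrightarrow> e * y = 0" for y
  proof (rule semiprimeD[OF sp y(1)])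
    fix t assume t: "t \<in> S"
    have "y * t - y * t * p = 0"
    proof (rule S1_0)
      fix e assume "e \<in> P"
      then show "(y * t - y * t * p) * e = 0" "e * (y * t - y * t * p) = 0"
        using y(2) by (simp_all add: right_diff_distrib left_diff_distrib mult.assoc ep)
          (simp add: mult.assoc[symmetric])
    qed (use t y S' pS in auto)
    then have "y * t * y = (y * t) * (p * y)" by (simp add: mult.assoc[symmetric])
    then show "y * t * y = 0" using p0'[OF y(2)] by simp
  qed
  show ?thesis
  proof (rule that[OF P])
    fix x assume x: "x \<in> S"
    have "e * (x - p * x) = 0" if "e \<in> P" for e
      using ep(1)[OF that] by (simp add: right_diff_distrib mult.assoc[symmetric])
    then have "x - p * x = 0" by (rule l[rotated]) (use x pS S' in auto)
    then show "\<Sum>P * x = x" by (simp add: p_def)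
    have "(x - x * p) * e = 0" if "e \<in> P" for e
      using ep(2)[OF that] by (simp add: left_diff_distrib mult.assoc)
    then have "x - x * p = 0" by (rule r[rotated]) (use x pS S' in auto)
    then show "x * \<Sum>P = x" by (simp add: p_def)
  qed
qed

end

subsection \<open>Matrix units\<close>

text \<open>The rows and columns are indexed by the primitive idempotents themselves; \<open>r\<close> maps an
  idempotent to a representative of its block.\<close>

locale matrix_units = assoc_algebra s
  for s :: "'f::field \<Rightarrow> 'a::ring \<Rightarrow> 'a" +
  fixes S P :: "'a set" and r :: "'a \<Rightarrow> 'a" and E :: "'a \<Rightarrow> 'a \<Rightarrow> 'a"
  assumes subalgebra: "assoc_subalgebra s S"
    and primitive: "primitive_system S P"
    and unit_left: "x \<in> S \<Longrightarrow> \<Sum>P * x = x"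
    and unit_right: "x \<in> S \<Longrightarrow> x * \<Sum>P = x"
    and r_in: "e \<in> P \<Longrightarrow> r e \<in> P"
    and r_r: "e \<in> P \<Longrightarrow> r (r e) = r e"
    and E_in: "e \<in> P \<Longrightarrow> f \<in> P \<Longrightarrow> r e = r f \<Longrightarrow> E e f \<in> S"
    and E_diag: "e \<in> P \<Longrightarrow> E e e = e"
    and E_mult: "e \<in> P \<Longrightarrow> f \<in> P \<Longrightarrow> k \<in> P \<Longrightarrow> r e = r f \<Longrightarrow> r f = r k \<Longrightarrow> E e f * E f k = E e k"
    and E_span: "x \<in> S \<Longrightarrow> e \<in> P \<Longrightarrow> f \<in> P \<Longrightarrow> r e = r f \<Longrightarrow> \<exists>c. e * x * f = s c (E e f)"
    and other_block: "x \<in> S \<Longrightarrow> e \<in> P \<Longrightarrow> f \<in> P \<Longrightarrow> r e \<noteq> r f \<Longrightarrow> e * x * f = 0"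

context assoc_algebra
begin

text \<open>Semiprimeness turns a nonzero \<open>u = e x f\<close> into an invertible link: some
  \<open>u y u\<close> is nonzero, so \<open>u (f y e)\<close> is a nonzero multiple of
  \<open>e\<close>, and rescaling \<open>f y e\<close> gives \<open>v\<close> with
  \<open>u v = e\<close>. Then \<open>v u\<close> is a nonzero idempotent in the line through
  \<open>f\<close>, hence \<open>f\<close> itself.\<close>

lemma linked_primitive_idempotents:
  assumes S: "assoc_subalgebra s S" and sp: "semiprime S" and P: "primitive_system S P"
    and e: "e \<in> P" and f: "f \<in> P" and link: "x \<in> S" "e * x * f \<noteq> 0"
  shows "\<exists>u\<in>S. \<exists>v\<in>S. e * u = u \<and> u * f = u \<and> f * v = v \<and> v * e = v \<and> u * v = e \<and> v * u = f"
proof -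
  note S' = subalgebraD[OF S]
  have PD: "e * e = e" "f * f = f" "e \<in> S" "f \<in> S" "e \<noteq> 0" "f \<noteq> 0"
      "\<And>x. x \<in> S \<Longrightarrow> \<exists>c. e * x * e = s c e" "\<And>x. x \<in> S \<Longrightarrow> \<exists>c. f * x * f = s c f"
    using P e f unfolding primitive_system_def by auto
  define u where "u = e * x * f"
  have u: "u \<in> S" "e * u = u" "u * f = u" "u \<noteq> 0"
    using link PD S' by (auto simp: u_def mult.assoc) (simp add: mult.assoc[symmetric])
  obtain y where y: "y \<in> S" "u * y * u \<noteq> 0" using semiprimeD[OF sp u(1)] u(4) by blast
  define w where "w = f * y * e"
  have w: "w \<in> S" "f * w = w" "w * e = w"
    using y(1) PD S' by (auto simp: w_def mult.assoc) (simp add: mult.assoc[symmetric])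
  have uwe: "e * (u * w) * e = u * w"
    using u(2) w(3) by (simp add: mult.assoc[symmetric]) (simp add: mult.assoc)
  obtain c where c: "u * w = s c e"
    using PD(7)[OF S'(2)[OF u(1) w(1)]] uwe by auto
  have "u * w * u = (u * f) * y * (e * u)" by (simp add: w_def mult.assoc)
  then have "u * w * u \<noteq> 0" using y(2) u(2,3) by simp
  then have c0: "c \<noteq> 0" using c by auto
  define v where "v = s (1 / c) w"
  have v: "v \<in> S" "f * v = v" "v * e = v" "u * v = e"
    using w c c0 S'(6) by (auto simp: v_def scale_mult_left scale_mult_right)
  have vuf: "f * (v * u) * f = v * u"
    using v(2) u(3) by (simp add: mult.assoc[symmetric]) (simp add: mult.assoc)
  obtain d where d: "v * u = s d f"
    using PD(8)[OF S'(2)[OF v(1) u(1)]] vuf by auto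
  have "u * (v * u) = u" using v(4) u(2) by (simp add: mult.assoc[symmetric])
  then have d0: "d \<noteq> 0" using d u(4) by auto
  have "v * u * (v * u) = v * (u * v) * u" by (simp add: mult.assoc)
  then have "v * u * (v * u) = v * u" using v(3,4) by simp
  then have "s (d * d) f = s d f" using d PD(2) by (simp add: scale_mult_left scale_mult_right)
  then have "d = 1" using d0 PD(6) by simp
  then show ?thesis using u v d by auto
qed

text \<open>Being linked is an equivalence relation. Every \<open>e\<close> is joined to the
  representative of its class by a pair \<open>u e\<close>, \<open>v e\<close>, and
  \<open>E e f\<close> runs from \<open>e\<close> to \<open>f\<close> through that representative;
  the product rule holds because \<open>v f * u f = r f\<close>.\<close>

lemma matrix_units_exist:
  assumes S: "assoc_subalgebra s S" and sp: "semiprime S" and P: "primitive_system S P"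
    and unit: "\<And>x. x \<in> S \<Longrightarrow> \<Sum>P * x = x" "\<And>x. x \<in> S \<Longrightarrow> x * \<Sum>P = x"
  shows "\<exists>r E. matrix_units s S P r E"
proof -
  note S' = subalgebraD[OF S]
  have PD: "finite P" "P \<subseteq> S" "\<And>e. e \<in> P \<Longrightarrow> e * e = e" "\<And>e. e \<in> P \<Longrightarrow> e \<noteq> 0"
      "\<And>e x. e \<in> P \<Longrightarrow> x \<in> S \<Longrightarrow> \<exists>c. e * x * e = s c e"
    using P unfolding primitive_system_def by auto
  define rel where "rel e f \<longleftrightarrow> f \<in> P \<and> (\<exists>x\<in>S. e * x * f \<noteq> 0)" for e f
  have uv: "\<exists>u\<in>S. \<exists>v\<in>S. e * u = u \<and> u * f = u \<and> f * v = v \<and> v * e = v \<and> u * v = e \<and> v * u = f"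
    if "e \<in> P" "rel e f" for e f
    using linked_primitive_idempotents[OF S sp P] that unfolding rel_def by blast
  have refl: "rel e e" if "e \<in> P" for e
    unfolding rel_def using PD that by (metis subsetD)
  have sym: "rel f e" if ef: "e \<in> P" "rel e f" for e f
  proof -
    obtain u v where *: "v \<in> S" "f * v = v" "v * e = v" "u * v = e" using uv[OF ef] by blast
    then have "f * v * e \<noteq> 0" using PD(4)[OF ef(1)] by (metis mult_zero_right)
    then show ?thesis using * ef(1) unfolding rel_def by blast
  qed
  have trans: "rel e k" if ef: "e \<in> P" "rel e f" and fk: "rel f k" for e f k
  proof -
    obtain u v where *: "u \<in> S" "e * u = u" "v * u = f" using uv[OF ef] by blast
    obtain y where y: "y \<in> S" "f * y * k \<noteq> 0" "k \<in> P" using fk unfolding rel_def by blast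
    have "v * (e * (u * y) * k) = v * u * y * k"
      using *(2) by (simp add: mult.assoc[symmetric])
    then have "e * (u * y) * k \<noteq> 0" using y(2) *(3) by auto
    then show ?thesis using S'(2)[OF *(1) y(1)] y(3) unfolding rel_def by blast
  qed
  have rel_P: "f \<in> P" if "rel e f" for e f using that unfolding rel_def by blast
  \<comment> \<open>The choice depends only on the predicate \<open>rel e\<close>, so idempotents of
    one class get the same representative.\<close>
  define r where "r e = (SOME f. rel e f)" for e
  have r: "rel e (r e)" if "e \<in> P" for e unfolding r_def using refl[OF that] by (rule someI)
  have r_eq: "r e = r f \<longleftrightarrow> rel e f" if "e \<in> P" "f \<in> P" for e f
  proof
    assume "rel e f"
    then have "rel e = rel f" using trans sym that by blast
    then show "r e = r f" unfolding r_def by simp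
  next
    assume "r e = r f"
    then show "rel e f" using r[OF that(1)] r[OF that(2)] trans sym that by metis
  qed
  have "\<forall>e\<in>P. \<exists>u v. u \<in> S \<and> v \<in> S \<and> e * u = u \<and> u * r e = u \<and> r e * v = v \<and> v * e = v \<and>
      u * v = e \<and> v * u = r e"
    using uv r by blast
  then obtain u v where uv: "\<And>e. e \<in> P \<Longrightarrow> u e \<in> S \<and> v e \<in> S \<and> e * u e = u e \<and> u e * r e = u e \<and>
      r e * v e = v e \<and> v e * e = v e \<and> u e * v e = e \<and> v e * u e = r e"
    by metis
  define E where "E e f = u e * v f" for e f
  have "matrix_units s S P r E"
  proof
    show "assoc_subalgebra s S" "primitive_system S P" by fact+
  next
    fix x assume "x \<in> S"
    then show "\<Sum>P * x = x" "x * \<Sum>P = x" using unit by blast+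
  next
    fix e assume e: "e \<in> P"
    then show reP: "r e \<in> P" using r rel_P by blast
    show "r (r e) = r e" using r_eq[OF e reP] r[OF e] by simp
    show "E e e = e" using uv[OF e] by (simp add: E_def)
  next
    fix e f assume ef: "e \<in> P" "f \<in> P" "r e = r f"
    show "E e f \<in> S" unfolding E_def using uv[OF ef(1)] uv[OF ef(2)] S'(2) by blast
    fix x assume x: "x \<in> S"
    \<comment> \<open>The factor \<open>u f * v e\<close> carries \<open>e * x * f\<close> back into
      \<open>e S e\<close>, where it is a multiple of \<open>e\<close>. Multiplication by
      \<open>E e f\<close> undoes this and shows the multiple of \<open>E e f\<close>.\<close>
    obtain c where c: "e * (x * (u f * v e)) * e = s c e"
      using PD(5)[OF ef(1)] S'(2) x uv[OF ef(1)] uv[OF ef(2)] by meson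
    have "s c (E e f) = e * (x * (u f * v e)) * e * (u e * v f)"
      unfolding c E_def using uv[OF ef(1)] by (simp add: scale_mult_left mult.assoc[symmetric])
    also have "\<dots> = e * x * u f * (v e * e) * u e * v f" by (simp add: mult.assoc)
    also have "\<dots> = e * x * u f * (v e * u e) * v f" using uv[OF ef(1)] by (simp add: mult.assoc)
    also have "\<dots> = e * x * (u f * r f) * v f" using uv[OF ef(1)] ef(3) by (simp add: mult.assoc)
    also have "\<dots> = e * x * f" using uv[OF ef(2)] by (simp add: mult.assoc)
    finally show "\<exists>c. e * x * f = s c (E e f)" by metis
  next
    fix e f k assume ef: "e \<in> P" "f \<in> P" "r e = r f" and k: "k \<in> P" "r f = r k"
    have "E e f * E f k = u e * (v f * u f) * v k" by (simp add: E_def mult.assoc)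
    also have "\<dots> = (u e * r e) * v k" using uv[OF ef(2)] ef(3) by simp
    also have "\<dots> = E e k" using uv[OF ef(1)] by (simp add: E_def)
    finally show "E e f * E f k = E e k" .
  next
    fix x e f assume "x \<in> S" "e \<in> P" "f \<in> P" "r e \<noteq> r f"
    then show "e * x * f = 0" using r_eq[of e f] unfolding rel_def by blast
  qed
  then show ?thesis by blast
qed

end

context matrix_units
begin

lemmas S' = subalgebraD[OF subalgebra]

lemma PD: "finite P" "P \<subseteq> S" "0 \<notin> P" "e \<in> P \<Longrightarrow> e \<in> S" "e \<in> P \<Longrightarrow> e \<noteq> 0" "e \<in> P \<Longrightarrow> e * e = e"
  "e \<in> P \<Longrightarrow> f \<in> P \<Longrightarrow> e \<noteq> f \<Longrightarrow> e * f = 0"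
  using primitive unfolding primitive_system_def by auto

lemma idempotent_mult: "e \<in> P \<Longrightarrow> f \<in> P \<Longrightarrow> e * f = (if e = f then e else 0)"
  using PD by auto

lemma unit_idempotent: "e \<in> P \<Longrightarrow> \<Sum>P * e = e" "e \<in> P \<Longrightarrow> e * \<Sum>P = e"
  using unit_left unit_right PD by auto

section \<open>Products of matrix units and coordinates with respect to them\<close>

lemma E_left:
  assumes "e \<in> P" "f \<in> P" "r e = r f" "k \<in> P"
  shows "k * E e f = (if k = e then E e f else 0)"
proof -
  have "E e f = e * E e f" using E_mult[of e e f] E_diag[of e] assms by simp
  then have "k * E e f = (k * e) * E e f" by (metis mult.assoc)
  then show ?thesis using PD(7)[of k e] \<open>E e f = e * E e f\<close> assms by (auto simp: PD(6))
qed

lemma E_right: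
  assumes "e \<in> P" "f \<in> P" "r e = r f" "k \<in> P"
  shows "E e f * k = (if k = f then E e f else 0)"
proof -
  have "E e f = E e f * f" using E_mult[of e f f] E_diag[of f] assms by simp
  then have "E e f * k = E e f * (f * k)" by (metis mult.assoc)
  then show ?thesis using PD(7)[of f k] \<open>E e f = E e f * f\<close> assms by (auto simp: PD(6))
qed

lemma E_mult_other:
  assumes "e \<in> P" "f \<in> P" "r e = r f" "k \<in> P" "l \<in> P" "r k = r l" "f \<noteq> k"
  shows "E e f * E k l = 0"
proof -
  have "E e f * E k l = (E e f * f) * (k * E k l)" using E_left E_right assms by simp
  also have "\<dots> = E e f * (f * k) * E k l" by (simp add: mult.assoc)
  finally show ?thesis using PD(7) assms by simp
qed

lemma E_nonzero:
  assumes "e \<in> P" "f \<in> P" "r e = r f"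
  shows "E e f \<noteq> 0"
proof
  assume "E e f = 0"
  then have "E e e = 0" using E_mult[OF assms(1,2,1,3)] assms(3) by simp
  then show False using E_diag PD(5) assms(1) by simp
qed

text \<open>The matrix entry of \<open>x\<close> at \<open>(e, f)\<close>. The value 0 across blocks
  and outside \<open>P\<close> lets the product formula sum over all of \<open>P\<close> and lets
  the linearity rules hold for arbitrary indices.\<close>

definition co :: "'a \<Rightarrow> 'a \<Rightarrow> 'a \<Rightarrow> 'f" where
  "co e f x = (if e \<in> P \<and> f \<in> P \<and> r e = r f then (THE c. e * x * f = s c (E e f)) else 0)"

lemma co_unique:
  assumes "e \<in> P" "f \<in> P" "r e = r f" "e * x * f = s c (E e f)"
  shows "co e f x = c"
  unfolding co_def using assms E_nonzero by (auto intro!: the_equality)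

lemma co_eq:
  assumes "x \<in> S" "e \<in> P" "f \<in> P" "r e = r f"
  shows "e * x * f = s (co e f x) (E e f)"
  using E_span[OF assms] co_unique[OF assms(2-4)] by auto

lemma co_out: "\<not> (e \<in> P \<and> f \<in> P \<and> r e = r f) \<Longrightarrow> co e f x = 0"
  unfolding co_def by metis

lemma co_add: "x \<in> S \<Longrightarrow> y \<in> S \<Longrightarrow> co e f (x + y) = co e f x + co e f y"
  by (cases "e \<in> P \<and> f \<in> P \<and> r e = r f")
    (auto simp: co_out co_eq distrib_left distrib_right scale_left_distrib intro: co_unique)

lemma co_scale: "x \<in> S \<Longrightarrow> co e f (s c x) = c * co e f x"
  by (cases "e \<in> P \<and> f \<in> P \<and> r e = r f")
    (auto simp: co_out co_eq scale_mult_left scale_mult_right intro!: co_unique)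

lemma co_zero: "co e f 0 = 0"
  using co_scale[OF S'(3), of e f 0] by simp

lemma co_diff: "x \<in> S \<Longrightarrow> y \<in> S \<Longrightarrow> co e f (x - y) = co e f x - co e f y"
  using co_add[of "x - y" y e f] S' by simp

lemma co_sum: "(\<And>i. i \<in> I \<Longrightarrow> x i \<in> S) \<Longrightarrow> co e f (sum x I) = (\<Sum>i\<in>I. co e f (x i))"
proof (induction I rule: infinite_finite_induct)
  case (insert i I)
  then have "sum x I \<in> S" by (intro subspace_sum[OF S'(1)]) auto
  then show ?case using insert by (simp add: co_add)
qed (simp_all add: co_zero)

lemma co_idempotent: "k \<in> P \<Longrightarrow> co e f k = (if e = f \<and> k = e then 1 else 0)"
proof (cases "e \<in> P \<and> f \<in> P \<and> r e = r f")
  case True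
  assume k: "k \<in> P"
  have "e * k * f = s (if e = f \<and> k = e then 1 else 0) (E e f)"
    using True k PD E_diag by (auto simp: idempotent_mult)
  then show ?thesis using co_unique True by blast
qed (auto simp: co_out)

lemma co_E:
  assumes "k \<in> P" "l \<in> P" "r k = r l"
  shows "co e f (E k l) = (if e = k \<and> f = l then 1 else 0)"
proof (cases "e \<in> P \<and> f \<in> P \<and> r e = r f")
  case True
  have "e * E k l * f = s (if e = k \<and> f = l then 1 else 0) (E e f)"
    using True assms by (auto simp: E_left E_right)
  then show ?thesis using co_unique True by blast
qed (use assms in \<open>auto simp: co_out\<close>)

lemma peirce_sum: "x \<in> S \<Longrightarrow> x = (\<Sum>e\<in>P. \<Sum>f\<in>P. e * x * f)"
proof -
  assume x: "x \<in> S"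
  have "(\<Sum>e\<in>P. \<Sum>f\<in>P. e * x * f) = \<Sum>P * x * \<Sum>P"
    by (simp add: sum_distrib_left sum_distrib_right sum.swap[of "\<lambda>e f. e * x * f"])
  then show ?thesis using x unit_left unit_right by simp
qed

lemma peirce_block:
  "x \<in> S \<Longrightarrow> e \<in> P \<Longrightarrow> f \<in> P \<Longrightarrow> e * x * f = (if r e = r f then s (co e f x) (E e f) else 0)"
  using co_eq other_block by auto

lemma co_eqI: "x \<in> S \<Longrightarrow> y \<in> S \<Longrightarrow> (\<And>e f. e \<in> P \<Longrightarrow> f \<in> P \<Longrightarrow> r e = r f \<Longrightarrow> co e f x = co e f y) \<Longrightarrow> x = y"
proof -
  assume a: "x \<in> S" "y \<in> S" "\<And>e f. e \<in> P \<Longrightarrow> f \<in> P \<Longrightarrow> r e = r f \<Longrightarrow> co e f x = co e f y"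
  have "(\<Sum>e\<in>P. \<Sum>f\<in>P. e * x * f) = (\<Sum>e\<in>P. \<Sum>f\<in>P. e * y * f)"
    using a by (intro sum.cong refl) (simp add: peirce_block)
  then show "x = y" using peirce_sum a(1,2) by metis
qed

lemma co_mult:
  assumes "x \<in> S" "y \<in> S"
  shows "co e f (x * y) = (\<Sum>k\<in>P. co e k x * co k f y)"
proof (cases "e \<in> P \<and> f \<in> P \<and> r e = r f")
  case True
  have *: "e * x * k * y * f = s (co e k x * co k f y) (E e f)" if k: "k \<in> P" for k
  proof -
    have "e * x * k * y * f = (e * x * k) * (k * y * f)"
      using PD(6)[OF k] by (simp add: mult.assoc) (metis mult.assoc)
    also have "\<dots> = s (co e k x * co k f y) (E e f)"
    proof (cases "r k = r e")
      case r: True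
      then show ?thesis using True k assms
        by (simp add: co_eq scale_mult_left scale_mult_right E_mult mult.commute)
    next
      case False
      then show ?thesis using True k assms other_block[of x e k] by (simp add: co_out)
    qed
    finally show ?thesis .
  qed
  have "e * (x * y) * f = e * x * (\<Sum>P * y) * f" using unit_left assms by (simp add: mult.assoc)
  also have "\<dots> = (\<Sum>k\<in>P. e * x * k * y * f)"
    by (simp add: sum_distrib_left sum_distrib_right mult.assoc)
  also have "\<dots> = s (\<Sum>k\<in>P. co e k x * co k f y) (E e f)" by (simp add: * scale_sum_left)
  finally show ?thesis using co_unique True by blast
next
  case False
  then have "co e k x = 0 \<or> co k f y = 0" for k by (metis co_out)
  then have "(\<Sum>k\<in>P. co e k x * co k f y) = 0" by (intro sum.neutral) simp
  then show ?thesis using co_out[OF False] by simp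
qed

lemma expansion: "x \<in> S \<Longrightarrow> x = (\<Sum>e\<in>P. \<Sum>f\<in>{f\<in>P. r f = r e}. s (co e f x) (E e f))"
proof -
  assume x: "x \<in> S"
  have "(\<Sum>f\<in>P. e * x * f) = (\<Sum>f\<in>{f\<in>P. r f = r e}. s (co e f x) (E e f))" if "e \<in> P" for e
    using that x PD(1) by (intro sum.mono_neutral_cong_right) (auto simp: peirce_block)
  then show ?thesis using peirce_sum[OF x] by simp
qed

text \<open>A block of size one would give an ideal of codimension one.\<close>

lemma one_perfect_block:
  assumes "k_perfect s 1 S" "e \<in> P"
  shows "\<exists>f\<in>P. f \<noteq> e \<and> r f = r e"
proof (rule ccontr)
  assume no: "\<not> (\<exists>f\<in>P. f \<noteq> e \<and> r f = r e)"
  then have alone: "\<And>f. f \<in> P \<Longrightarrow> f \<noteq> e \<Longrightarrow> r f \<noteq> r e" by blast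
  \<comment> \<open>As \<open>e\<close> is alone in its block, the components
    \<open>e * x * f\<close> and \<open>f * x * e\<close> with \<open>f \<noteq> e\<close> vanish;
    so \<open>e\<close> commutes with \<open>S\<close>, and every \<open>x\<close> acts on it by a
    scalar.\<close>
  have ex: "e * x = s (co e e x) e \<and> x * e = s (co e e x) e" if x: "x \<in> S" for x
  proof -
    have "e * x = (\<Sum>f\<in>P. e * x * f)"
      using unit_right[OF x] by (simp add: sum_distrib_left[symmetric] mult.assoc)
    also have "\<dots> = (\<Sum>f\<in>P. if f = e then s (co e e x) e else 0)"
      using x assms(2) E_diag by (intro sum.cong refl) (simp add: peirce_block, metis alone)
    finally have 1: "e * x = s (co e e x) e" using PD(1) assms(2) by simp
    have "x * e = (\<Sum>f\<in>P. f * x * e)"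
      using unit_left[OF x] by (simp add: sum_distrib_right[symmetric])
    also have "\<dots> = (\<Sum>f\<in>P. if f = e then s (co e e x) e else 0)"
      using x assms(2) E_diag by (intro sum.cong refl) (simp add: peirce_block, metis alone)
    finally show ?thesis using PD(1) assms(2) 1 by simp
  qed
  define I where "I = {x\<in>S. e * x = 0}"
  have "assoc_ideal s S I"
    unfolding assoc_ideal_def I_def
  proof (intro conjI ballI subspaceI)
    fix b x assume b: "b \<in> S" and x: "x \<in> {x\<in>S. e * x = 0}"
    have "e * (b * x) = s (co e e b) (e * x)"
      using ex[OF b] by (simp add: mult.assoc[symmetric] scale_mult_left)
    then show "b * x \<in> {x\<in>S. e * x = 0}" using x b S'(2) by simp
    show "x * b \<in> {x\<in>S. e * x = 0}" using x b S'(2) by (simp add: mult.assoc[symmetric])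
  qed (use S' in \<open>auto simp: distrib_left scale_mult_right\<close>)
  moreover have "codim_le s S I 1"
    unfolding codim_le_def
  proof (intro exI[of _ "{e}"] conjI subsetI)
    fix x assume x: "x \<in> S"
    have "e * (e * x) = e * x" using PD(6) assms(2) by (simp add: mult.assoc[symmetric])
    then have "x - e * x \<in> I"
      unfolding I_def using x S' PD assms(2) by (simp add: right_diff_distrib)
    then have "x - s (co e e x) e \<in> span (I \<union> {e})" using ex[OF x] by (simp add: span_base)
    moreover have "s (co e e x) e \<in> span (I \<union> {e})" by (intro span_scale span_base) auto
    ultimately have "(x - s (co e e x) e) + s (co e e x) e \<in> span (I \<union> {e})" by (rule span_add)
    then show "x \<in> span (I \<union> {e})" by simp
  qed (use assms PD in auto)
  ultimately have "I = S" using assms(1) unfolding k_perfect_def by blast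
  then have "e \<in> I" using PD(4) assms(2) by blast
  then show False using PD(5,6) assms(2) by (simp add: I_def)
qed

end

subsection \<open>Weight spaces\<close>

context assoc_algebra
begin

lemma commutator_simps:
  "commutator (x + y) z = commutator x z + commutator y z"
  "commutator z (x + y) = commutator z x + commutator z y"
  "commutator (x - y) z = commutator x z - commutator y z"
  "commutator z (x - y) = commutator z x - commutator z y"
  "commutator (s c x) y = s c (commutator x y)"
  "commutator x (s c y) = s c (commutator x y)"
  "commutator 0 x = 0" "commutator x 0 = 0" "commutator x x = 0"
  unfolding commutator_def
  by (simp_all add: algebra_simps scale_mult_left scale_mult_right scale_right_diff_distrib)

lemma commutator_sum_right: "commutator (z :: 'a) (sum f I) = (\<Sum>i\<in>I. commutator z (f i))"
  by (induction I rule: infinite_finite_induct) (simp_all add: commutator_simps)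

lemma jacobi:
  "commutator x (commutator y z) + commutator y (commutator z x) + commutator z (commutator x y) = 0"
  unfolding commutator_def by (simp add: algebra_simps)

lemma subspace_prod_span: "subspace (prod_span s br X Y)"
  unfolding prod_span_def by simp

lemma comm_span_base: "x \<in> S \<Longrightarrow> y \<in> S \<Longrightarrow> commutator x y \<in> comm_span s S"
  unfolding comm_span_def prod_span_def by (intro span_base) blast

lemma comm_span_subset:
  assumes "subspace V" "\<And>x y. x \<in> S \<Longrightarrow> y \<in> S \<Longrightarrow> commutator x y \<in> V"
  shows "comm_span s S \<subseteq> V"
  unfolding comm_span_def prod_span_def using assms by (intro span_minimal) auto

lemma subspace_comm_span: "subspace (comm_span s S)"
  unfolding comm_span_def by (rule subspace_prod_span)

lemma comm_span_subalgebra: "assoc_subalgebra s S \<Longrightarrow> comm_span s S \<subseteq> S"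
  using subalgebraD by (intro comm_span_subset) (auto simp: commutator_def)

lemma lie_algebra_comm_span: "assoc_subalgebra s S \<Longrightarrow> lie_algebra s commutator (comm_span s S)"
  unfolding lie_algebra_def
  using vector_space_axioms subspace_comm_span comm_span_base comm_span_subalgebra
  by (auto simp: commutator_simps jacobi) (meson comm_span_base comm_span_subalgebra subsetD)

lemma subspace_weight_space: "subspace L \<Longrightarrow> subspace (weight_space s commutator h L \<alpha>)"
  unfolding weight_space_def
  by (rule subspaceI)
    (auto simp: subspace_0 subspace_add subspace_scale commutator_simps scale_right_distrib mult.commute)

text \<open>Separation of eigenvectors: if \<open>t\<close> distinguishes \<open>\<alpha>\<close>
  from the new weight \<open>\<beta>\<close>, bracketing with \<open>t\<close> and subtracting
  \<open>\<beta> t\<close> times the relation removes \<open>y \<beta>\<close> and rescales the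
  other vectors, so the induction hypothesis applies. Such a \<open>t\<close> exists in
  \<open>h\<close>, since distinct elements of \<open>dual_space\<close> differ somewhere on
  \<open>h\<close>.\<close>

lemma weight_vectors_independent:
  assumes "finite \<Gamma>" "\<Gamma> \<subseteq> dual_space s h"
    and "\<And>\<alpha> t. \<alpha> \<in> \<Gamma> \<Longrightarrow> t \<in> h \<Longrightarrow> commutator t (y \<alpha>) = s (\<alpha> t) (y \<alpha>)"
    and "(\<Sum>\<alpha>\<in>\<Gamma>. y \<alpha>) = 0" "\<alpha> \<in> \<Gamma>"
  shows "y \<alpha> = 0"
  using assms
proof (induction \<Gamma> arbitrary: y \<alpha> rule: finite_induct)
  case (insert \<beta> \<Gamma>)
  have sum0: "y \<beta> + (\<Sum>\<alpha>\<in>\<Gamma>. y \<alpha>) = 0" using insert.prems(3) insert.hyps by simp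
  have \<Gamma>0: "y \<alpha> = 0" if \<alpha>: "\<alpha> \<in> \<Gamma>" for \<alpha>
  proof -
    have "\<exists>t\<in>h. \<alpha> t \<noteq> \<beta> t"
    proof (rule ccontr)
      assume "\<not> (\<exists>t\<in>h. \<alpha> t \<noteq> \<beta> t)"
      moreover have "\<alpha> t = 0 \<and> \<beta> t = 0" if "t \<notin> h" for t
        using insert.prems(1) \<alpha> that unfolding dual_space_def by blast
      ultimately have "\<alpha> = \<beta>" by (intro ext) metis
      then show False using \<alpha> insert.hyps by blast
    qed
    then obtain t where t: "t \<in> h" "\<alpha> t \<noteq> \<beta> t" by blast
    define z where "z \<gamma> = s (\<gamma> t - \<beta> t) (y \<gamma>)" for \<gamma>
    have "(\<Sum>\<gamma>\<in>\<Gamma>. z \<gamma>) = (\<Sum>\<gamma>\<in>\<Gamma>. commutator t (y \<gamma>)) - s (\<beta> t) (\<Sum>\<gamma>\<in>\<Gamma>. y \<gamma>)"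
      using insert.prems(2)[OF _ t(1)]
      by (simp add: z_def scale_left_diff_distrib sum_subtractf scale_sum_right)
    also have "\<dots> = commutator t (y \<beta> + (\<Sum>\<gamma>\<in>\<Gamma>. y \<gamma>)) - s (\<beta> t) (y \<beta> + (\<Sum>\<gamma>\<in>\<Gamma>. y \<gamma>))"
      using insert.prems(2)[OF _ t(1), of \<beta>]
      by (simp add: commutator_sum_right commutator_simps scale_right_distrib)
    also have "\<dots> = 0" by (simp only: sum0 commutator_simps scale_zero_right diff_self)
    finally have "(\<Sum>\<gamma>\<in>\<Gamma>. z \<gamma>) = 0" .
    moreover have "commutator u (z \<gamma>) = s (\<gamma> u) (z \<gamma>)" if "\<gamma> \<in> \<Gamma>" "u \<in> h" for \<gamma> u
      using insert.prems(2)[of \<gamma> u] that by (simp add: z_def commutator_simps mult.commute)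
    ultimately have "z \<alpha> = 0" using insert.IH[of z \<alpha>] insert.prems(1) \<alpha> by blast
    then show ?thesis using t(2) by (simp add: z_def)
  qed
  then have "y \<beta> = 0" using sum0 by simp
  then show ?case using \<Gamma>0 insert.prems(4) by auto
qed simp

lemma weight_direct_sum:
  assumes fin: "finite \<Gamma>" and \<Gamma>: "\<Gamma> \<subseteq> dual_space s h" and L: "subspace L"
    and gen: "L \<subseteq> span (\<Union>\<alpha>\<in>\<Gamma>. weight_space s commutator h L \<alpha>)"
  shows "direct_sum L \<Gamma> (weight_space s commutator h L)"
  unfolding direct_sum_def
proof (intro conjI ballI fin)
  let ?W = "weight_space s commutator h L"
  show "?W \<alpha> \<subseteq> L" for \<alpha> by (auto simp: weight_space_def)
  note sub = subspace_weight_space[OF L, of h]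
  fix x assume "x \<in> L"
  then have "x \<in> span (\<Union>\<alpha>\<in>\<Gamma>. ?W \<alpha>)" using gen by blast
  then have "\<exists>f. f \<in> Pi\<^sub>E \<Gamma> ?W \<and> x = (\<Sum>\<alpha>\<in>\<Gamma>. f \<alpha>)"
  proof (induction rule: span_induct_alt)
    case base
    have "(\<lambda>\<alpha>\<in>\<Gamma>. 0) \<in> Pi\<^sub>E \<Gamma> ?W" using subspace_0[OF sub] by auto
    moreover have "0 = (\<Sum>\<alpha>\<in>\<Gamma>. (\<lambda>\<alpha>\<in>\<Gamma>. 0) \<alpha>)" by (simp add: restrict_def)
    ultimately show ?case by blast
  next
    case (step c x y)
    then obtain \<beta> f where *: "\<beta> \<in> \<Gamma>" "x \<in> ?W \<beta>" "f \<in> Pi\<^sub>E \<Gamma> ?W" "y = (\<Sum>\<alpha>\<in>\<Gamma>. f \<alpha>)" by blast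
    define f' where "f' = (\<lambda>\<alpha>\<in>\<Gamma>. (if \<alpha> = \<beta> then s c x else 0) + f \<alpha>)"
    have "f' \<in> Pi\<^sub>E \<Gamma> ?W"
    proof (rule PiE_I)
      fix \<alpha> assume \<alpha>: "\<alpha> \<in> \<Gamma>"
      then have "f \<alpha> \<in> ?W \<alpha>" using *(3) by auto
      moreover have "(if \<alpha> = \<beta> then s c x else 0) \<in> ?W \<alpha>"
        using *(2) subspace_scale[OF sub] subspace_0[OF sub] by auto
      ultimately show "f' \<alpha> \<in> ?W \<alpha>" using \<alpha> subspace_add[OF sub] by (simp add: f'_def)
    qed (simp add: f'_def)
    moreover have "s c x + y = (\<Sum>\<alpha>\<in>\<Gamma>. f' \<alpha>)"
      using *(1,4) fin by (simp add: f'_def sum.distrib)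
    ultimately show ?case by blast
  qed
  moreover have "f = f'"
    if f: "f \<in> Pi\<^sub>E \<Gamma> ?W" "f' \<in> Pi\<^sub>E \<Gamma> ?W" "(\<Sum>\<alpha>\<in>\<Gamma>. f \<alpha>) = (\<Sum>\<alpha>\<in>\<Gamma>. f' \<alpha>)" for f f'
  proof (rule PiE_ext[OF f(1,2)])
    fix \<alpha> assume \<alpha>: "\<alpha> \<in> \<Gamma>"
    have "f \<alpha> - f' \<alpha> = 0"
    proof (rule weight_vectors_independent[OF fin \<Gamma> _ _ \<alpha>])
      show "(\<Sum>\<alpha>\<in>\<Gamma>. f \<alpha> - f' \<alpha>) = 0" using f(3) by (simp add: sum_subtractf)
      fix \<beta> t assume \<beta>: "\<beta> \<in> \<Gamma>" "t \<in> h"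
      have "f \<beta> - f' \<beta> \<in> ?W \<beta>"
        using PiE_mem[OF f(1) \<beta>(1)] PiE_mem[OF f(2) \<beta>(1)] by (rule subspace_diff[OF sub])
      then show "commutator t (f \<beta> - f' \<beta>) = s (\<beta> t) (f \<beta> - f' \<beta>)"
        using \<beta>(2) by (simp add: weight_space_def)
    qed
    then show "f \<alpha> = f' \<alpha>" by simp
  qed
  ultimately show "\<exists>!f. f \<in> Pi\<^sub>E \<Gamma> ?W \<and> x = (\<Sum>\<alpha>\<in>\<Gamma>. f \<alpha>)" by metis
qed

end

subsection \<open>Traceless elements\<close>

text \<open>\<open>nontrivial_block\<close> is what 1-perfectness gives in coordinates.
  Characteristic 0 makes the block sizes and the integers 2, 3 and 4 invertible, as traces and the
  values of weights at coroots require.\<close>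

locale perfect_matrix_units = matrix_units s S P r E
  for s :: "'f::field \<Rightarrow> 'a::ring \<Rightarrow> 'a" and S P r E +
  assumes nontrivial_block: "e \<in> P \<Longrightarrow> \<exists>f\<in>P. f \<noteq> e \<and> r f = r e"
    and char_0: "CHAR('f) = 0"
begin

lemma of_nat_nonzero: "n \<noteq> 0 \<Longrightarrow> of_nat n \<noteq> (0::'f)"
  using of_nat_eq_0_iff_char_dvd[of n, where ?'a='f] char_0 by simp

lemma numeral_nonzero: "(2::'f) \<noteq> 0" "(3::'f) \<noteq> 0" "(4::'f) \<noteq> 0"
  using of_nat_nonzero[of 2] of_nat_nonzero[of 3] of_nat_nonzero[of 4] by simp_all

abbreviation g :: "'a set" where "g \<equiv> comm_span s S"

text \<open>The trace of a block, indexed by any of the idempotents in that block.\<close>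

definition tr :: "'a \<Rightarrow> 'a \<Rightarrow> 'f" where
  "tr e x = (\<Sum>f\<in>{f\<in>P. r f = r e}. co f f x)"

lemma g_subset: "g \<subseteq> S"
  using comm_span_subalgebra[OF subalgebra] .

lemma tr_add: "x \<in> S \<Longrightarrow> y \<in> S \<Longrightarrow> tr e (x + y) = tr e x + tr e y"
  by (simp add: tr_def co_add sum.distrib)

lemma tr_diff: "x \<in> S \<Longrightarrow> y \<in> S \<Longrightarrow> tr e (x - y) = tr e x - tr e y"
  by (simp add: tr_def co_diff sum_subtractf)

lemma tr_scale: "x \<in> S \<Longrightarrow> tr e (s c x) = c * tr e x"
  by (simp add: tr_def co_scale sum_distrib_left)

lemma tr_commutator:
  assumes "x \<in> S" "y \<in> S"
  shows "tr e (commutator x y) = 0"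
proof -
  let ?B = "{f\<in>P. r f = r e}"
  have tr: "tr e (x * y) = (\<Sum>f\<in>?B. \<Sum>k\<in>?B. co f k x * co k f y)" if "x \<in> S" "y \<in> S" for x y
  proof -
    have "(\<Sum>k\<in>P. co f k x * co k f y) = (\<Sum>k\<in>?B. co f k x * co k f y)" if "f \<in> ?B" for f
      using PD(1) that by (intro sum.mono_neutral_right) (auto simp: co_out)
    then show ?thesis using that by (simp add: tr_def co_mult)
  qed
  have "tr e (x * y) = tr e (y * x)"
    unfolding tr[OF assms] tr[OF assms(2,1)] by (subst sum.swap) (simp add: mult.commute)
  then show ?thesis using assms S'(2) by (simp add: commutator_def tr_diff)
qed

text \<open>Sorted by blocks, the sum of \<open>co e e x\<close> times \<open>r e\<close> has the
  traces as coefficients and is therefore 0. Subtracting it replaces each \<open>e\<close> on the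
  diagonal by \<open>e - r e\<close>. The assumptions ask only for generators with nonzero
  coefficient, so the lemma also serves for elements of a single block and for diagonal
  elements.\<close>

lemma traceless_generators:
  assumes x: "x \<in> S" and tr0: "\<And>e. e \<in> P \<Longrightarrow> tr e x = 0" and V: "subspace V"
    and off: "\<And>e f. e \<in> P \<Longrightarrow> f \<in> P \<Longrightarrow> r e = r f \<Longrightarrow> e \<noteq> f \<Longrightarrow> co e f x \<noteq> 0 \<Longrightarrow> E e f \<in> V"
    and diag: "\<And>e. e \<in> P \<Longrightarrow> co e e x \<noteq> 0 \<Longrightarrow> e - r e \<in> V"
  shows "x \<in> V"
proof -
  let ?B = "\<lambda>e. {f\<in>P. r f = r e}"
  have "(\<Sum>e\<in>P. s (co e e x) (r e)) = (\<Sum>b\<in>r ` P. \<Sum>e\<in>{e\<in>P. r e = b}. s (co e e x) (r e))"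
    by (rule sum.image_gen[OF PD(1)])
  also have "\<dots> = (\<Sum>b\<in>r ` P. s (\<Sum>e\<in>{e\<in>P. r e = b}. co e e x) b)"
    by (intro sum.cong refl) (simp add: scale_sum_left)
  also have "\<dots> = 0" using tr0 by (intro sum.neutral) (auto simp: tr_def)
  finally have rep0: "(\<Sum>e\<in>P. s (co e e x) (r e)) = 0" .
  have split: "(\<Sum>f\<in>?B e. s (co e f x) (E e f)) = s (co e e x) e + (\<Sum>f\<in>?B e - {e}. s (co e f x) (E e f))"
    if "e \<in> P" for e
    using that PD(1) E_diag by (subst sum.remove[of _ e]) auto
  have "x = (\<Sum>e\<in>P. s (co e e x) e + (\<Sum>f\<in>?B e - {e}. s (co e f x) (E e f)))"
    using expansion[OF x] split by simp
  also have "\<dots> = (\<Sum>e\<in>P. s (co e e x) e) + (\<Sum>e\<in>P. \<Sum>f\<in>?B e - {e}. s (co e f x) (E e f))"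
    by (rule sum.distrib)
  also have "(\<Sum>e\<in>P. s (co e e x) e) = (\<Sum>e\<in>P. s (co e e x) (e - r e)) + (\<Sum>e\<in>P. s (co e e x) (r e))"
    by (simp add: scale_right_diff_distrib sum_subtractf)
  finally have x_eq: "x = (\<Sum>e\<in>P. s (co e e x) (e - r e)) + (\<Sum>e\<in>P. \<Sum>f\<in>?B e - {e}. s (co e f x) (E e f))"
    using rep0 by simp
  have 1: "s (co e e x) (e - r e) \<in> V" if "e \<in> P" for e
    using diag[OF that] subspace_scale[OF V] subspace_0[OF V] by (cases "co e e x = 0") simp_all
  have 2: "s (co e f x) (E e f) \<in> V" if "e \<in> P" "f \<in> ?B e - {e}" for e f
    using off[of e f] that subspace_scale[OF V] subspace_0[OF V] by (cases "co e f x = 0") auto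
  have "(\<Sum>e\<in>P. s (co e e x) (e - r e)) + (\<Sum>e\<in>P. \<Sum>f\<in>?B e - {e}. s (co e f x) (E e f)) \<in> V"
    by (intro subspace_add[OF V] subspace_sum[OF V] 1 2)
  then show ?thesis using x_eq by simp
qed

lemma E_in_g:
  assumes "e \<in> P" "f \<in> P" "r e = r f" "e \<noteq> f"
  shows "E e f \<in> g"
proof -
  have "commutator e (E e f) = E e f"
    unfolding commutator_def using E_left[OF assms(1-3), of e] E_right[OF assms(1-3), of e] assms by simp
  then show ?thesis using comm_span_base[OF PD(4)[OF assms(1)] E_in[OF assms(1-3)]] by simp
qed

lemma commutator_E:
  assumes "e \<in> P" "f \<in> P" "r e = r f"
  shows "commutator (E e f) (E f e) = e - f"
  unfolding commutator_def
  using E_mult[OF assms(1,2,1,3) assms(3)[symmetric]] E_mult[OF assms(2,1,2) assms(3)[symmetric] assms(3)]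
    E_diag assms(1,2) by simp

lemma diff_in_g:
  assumes "e \<in> P" "f \<in> P" "r e = r f"
  shows "e - f \<in> g"
  using comm_span_base[OF E_in[OF assms] E_in[OF assms(2,1) assms(3)[symmetric]]]
  unfolding commutator_E[OF assms] .

lemma g_iff: "x \<in> g \<longleftrightarrow> x \<in> S \<and> (\<forall>e\<in>P. tr e x = 0)"
proof
  assume "x \<in> g"
  moreover have "g \<subseteq> {x\<in>S. \<forall>e\<in>P. tr e x = 0}"
  proof (rule comm_span_subset)
    show "subspace {x\<in>S. \<forall>e\<in>P. tr e x = 0}"
      using S' by (intro subspaceI) (auto simp: tr_add tr_scale tr_def[of _ 0] co_zero)
    show "commutator x y \<in> {x\<in>S. \<forall>e\<in>P. tr e x = 0}" if "x \<in> S" "y \<in> S" for x y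
      using that S' tr_commutator by (simp add: commutator_def)
  qed
  ultimately show "x \<in> S \<and> (\<forall>e\<in>P. tr e x = 0)" by blast
next
  assume "x \<in> S \<and> (\<forall>e\<in>P. tr e x = 0)"
  then show "x \<in> g"
    using traceless_generators[of x g] subspace_comm_span E_in_g diff_in_g r_in r_r by simp
qed

lemma g_commutator: "x \<in> S \<Longrightarrow> y \<in> S \<Longrightarrow> commutator x y \<in> g"
  by (rule comm_span_base)

text \<open>The average of the trace over each block, times the unit of the block, is central, and
  removing it leaves a traceless element. Questions about commuting with all of \<open>S\<close>
  thereby reduce to \<open>g\<close>.\<close>

lemma central_part:
  assumes x: "x \<in> S"
  shows "\<exists>z\<in>S. (\<forall>y\<in>S. y * z = z * y) \<and> x - z \<in> g"
proof -
  define n where "n e = card {f\<in>P. r f = r e}" for e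
  define z where "z = (\<Sum>e\<in>P. s (tr e x / of_nat (n e)) e)"
  have zS: "z \<in> S" unfolding z_def by (intro subspace_sum[OF S'(1)] S'(6) PD(4))
  have ez: "e * z = s (tr e x / of_nat (n e)) e" "z * e = s (tr e x / of_nat (n e)) e" if "e \<in> P" for e
    unfolding z_def mult_sum_scale sum_distrib_right scale_mult_left using that PD(1)
    by (simp_all add: idempotent_mult if_distrib[of "s _"] cong: if_cong)
  have trr: "tr f x / of_nat (n f) = tr e x / of_nat (n e)" if "r f = r e" for e f
    using that by (simp add: tr_def n_def)
  have "y * z = z * y" if y: "y \<in> S" for y
  proof (rule co_eqI)
    fix e f assume ef: "e \<in> P" "f \<in> P" "r e = r f"
    have "e * (y * z) * f = e * y * (z * f)" by (simp add: mult.assoc)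
    also have "\<dots> = s (tr f x / of_nat (n f)) (e * y * f)" using ez ef by (simp add: scale_mult_right)
    also have "\<dots> = (e * z) * y * f" using ez ef trr[where e = e and f = f] by (simp add: scale_mult_left)
    also have "\<dots> = e * (z * y) * f" by (simp add: mult.assoc)
    finally show "co e f (y * z) = co e f (z * y)" using ef unfolding co_def by simp
  qed (use y zS S' in auto)
  moreover have "tr e (x - z) = 0" if e: "e \<in> P" for e
  proof -
    have "co f f z = tr f x / of_nat (n f)" if "f \<in> P" for f
      by (rule co_unique) (simp_all add: that ez(1)[OF that] PD(6)[OF that] E_diag[OF that] scale_mult_left)
    then have "co f f z = tr e x / of_nat (n e)" if "f \<in> {f\<in>P. r f = r e}" for f
      using trr[where f = f and e = e] that by (metis (mono_tags, lifting) mem_Collect_eq)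
    then have "tr e z = (\<Sum>f\<in>{f\<in>P. r f = r e}. tr e x / of_nat (n e))"
      unfolding tr_def[of e z] by (intro sum.cong refl)
    also have "\<dots> = tr e x"
    proof -
      have "n e \<noteq> 0" using e PD(1) by (auto simp: n_def)
      then show ?thesis using of_nat_nonzero by (simp add: n_def)
    qed
    finally show ?thesis using tr_diff[OF x zS] by simp
  qed
  then have "x - z \<in> g" using g_iff S'(5)[OF x zS] by blast
  ultimately show ?thesis using zS by blast
qed

subsection \<open>The diagonal Cartan subalgebra\<close>

definition h :: "'a set" where
  "h = {t\<in>g. \<forall>e\<in>P. \<forall>f\<in>P. e \<noteq> f \<longrightarrow> co e f t = 0}"

lemma h_S: "t \<in> h \<Longrightarrow> t \<in> S"
  using g_subset by (auto simp: h_def)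

lemma h_mult:
  assumes "t \<in> h" "e \<in> P"
  shows "e * t = s (co e e t) e" "t * e = s (co e e t) e"
proof -
  have t: "t \<in> S" "\<And>f. f \<in> P \<Longrightarrow> f \<noteq> e \<Longrightarrow> co e f t = 0 \<and> co f e t = 0"
    using assms h_S by (auto simp: h_def)
  have "e * t = (\<Sum>f\<in>P. e * t * f)"
    using unit_right[OF t(1)] by (simp add: sum_distrib_left[symmetric] mult.assoc)
  also have "\<dots> = (\<Sum>f\<in>P. if f = e then s (co e e t) e else 0)"
    using t assms(2) E_diag by (intro sum.cong refl) (simp add: peirce_block)
  finally show "e * t = s (co e e t) e" using PD(1) assms(2) by simp
  have "t * e = (\<Sum>f\<in>P. f * t * e)"
    using unit_left[OF t(1)] by (simp add: sum_distrib_right[symmetric])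
  also have "\<dots> = (\<Sum>f\<in>P. if f = e then s (co e e t) e else 0)"
    using t assms(2) E_diag by (intro sum.cong refl) (simp add: peirce_block)
  finally show "t * e = s (co e e t) e" using PD(1) assms(2) by simp
qed

lemma subspace_h: "subspace h"
  unfolding h_def using subspace_comm_span[of S] g_subset
  by (intro subspaceI) (auto simp: subspace_0 subspace_add subspace_scale co_zero co_add co_scale subset_iff)

text \<open>This description involves neither \<open>r\<close> nor \<open>E\<close>, so it can be
  matched with a split Cartan subalgebra given from outside.\<close>

lemma h_eq_span: "h = g \<inter> span P"
proof
  show "h \<subseteq> g \<inter> span P"
  proof
    fix t assume t: "t \<in> h"
    have "t = (\<Sum>e\<in>P. e * t)"
      using unit_left[OF h_S[OF t]] by (simp add: sum_distrib_right[symmetric])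
    also have "\<dots> = (\<Sum>e\<in>P. s (co e e t) e)" using h_mult[OF t] by simp
    also have "\<dots> \<in> span P" by (intro span_sum span_scale span_base)
    finally show "t \<in> g \<inter> span P" using t by (simp add: h_def)
  qed
  show "g \<inter> span P \<subseteq> h"
  proof
    fix t assume t: "t \<in> g \<inter> span P"
    have "span P \<subseteq> {t\<in>S. \<forall>e\<in>P. \<forall>f\<in>P. e \<noteq> f \<longrightarrow> co e f t = 0}"
      by (intro span_minimal subspaceI) (use S' PD(4) in \<open>auto simp: co_zero co_add co_scale co_idempotent\<close>)
    then show "t \<in> h" using t by (auto simp: h_def)
  qed
qed

lemma diff_in_h: "e \<in> P \<Longrightarrow> f \<in> P \<Longrightarrow> r e = r f \<Longrightarrow> e - f \<in> h"
  unfolding h_eq_span using diff_in_g by (auto intro: span_diff span_base)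

section \<open>Weights of the diagonal subalgebra\<close>

definition eps :: "'a \<Rightarrow> 'a \<Rightarrow> 'f" where
  "eps e t = (if t \<in> h then co e e t else 0)"

definition wt :: "'a \<Rightarrow> 'a \<Rightarrow> 'a \<Rightarrow> 'f" where
  "wt e f = (\<lambda>t. eps e t - eps f t)"

lemma eps_dual: "eps e \<in> dual_space s h"
  unfolding dual_space_def eps_def using subspace_h h_S
  by (auto simp: co_add co_scale subspace_add subspace_scale)

lemma dual_diff: "\<alpha> \<in> dual_space s V \<Longrightarrow> \<beta> \<in> dual_space s V \<Longrightarrow> (\<lambda>x. \<alpha> x - \<beta> x) \<in> dual_space s V"
  unfolding dual_space_def by (simp add: algebra_simps)

lemma dual_add: "\<alpha> \<in> dual_space s V \<Longrightarrow> \<beta> \<in> dual_space s V \<Longrightarrow> (\<lambda>x. \<alpha> x + \<beta> x) \<in> dual_space s V"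
  unfolding dual_space_def by (simp add: algebra_simps)

lemma dual_neg: "\<alpha> \<in> dual_space s V \<Longrightarrow> (\<lambda>x. - \<alpha> x) \<in> dual_space s V"
  unfolding dual_space_def by simp

lemma dual_zero: "(\<lambda>x. 0) \<in> dual_space s V"
  unfolding dual_space_def by simp

lemma dual_eqI:
  assumes "\<alpha> \<in> dual_space s V" "\<beta> \<in> dual_space s V" "\<And>t. t \<in> V \<Longrightarrow> \<alpha> t = \<beta> t"
  shows "\<alpha> = \<beta>"
proof
  fix t show "\<alpha> t = \<beta> t" using assms by (cases "t \<in> V") (auto simp: dual_space_def)
qed

lemma wt_dual: "wt e f \<in> dual_space s h"
  unfolding wt_def by (intro dual_diff eps_dual)

lemma eps_diff:
  assumes "a \<in> P" "b \<in> P" "r a = r b"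
  shows "eps k (a - b) = (if k = a then 1 else 0) - (if k = b then 1 else 0)"
  using diff_in_h[OF assms] assms PD(4) by (auto simp: eps_def co_diff co_idempotent)

lemma eps_0: "eps 0 = (\<lambda>_. 0)"
  using PD(3) by (auto simp: eps_def co_out)

text \<open>Within a block the element \<open>e - f\<close> gives the value 2. Otherwise
  \<open>f\<close> is the complement or lies in another block; then a second idempotent
  \<open>k\<close> of the block of \<open>e\<close> is needed, and \<open>e - k\<close> gives the
  value 1.\<close>

lemma wt_neq:
  assumes "e \<in> insert 0 P" "f \<in> insert 0 P" "e \<noteq> f"
  shows "\<exists>t\<in>h. wt e f t \<noteq> 0"
proof -
  have *: "\<exists>t\<in>h. wt e f t \<noteq> 0" if e: "e \<in> P" and "e \<noteq> f" for e f
  proof (cases "f \<in> P \<and> r f = r e")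
    case True
    then have "e - f \<in> h" "wt e f (e - f) = 2"
      using diff_in_h[of e f] eps_diff[of e f] that by (auto simp: wt_def)
    then show ?thesis using numeral_nonzero by metis
  next
    case False
    obtain k where k: "k \<in> P" "k \<noteq> e" "r k = r e" using nontrivial_block[OF e] by blast
    then have "e - k \<in> h" "wt e f (e - k) = 1"
      using diff_in_h[of e k] eps_diff[of e k] that False by (auto simp: wt_def)
    then show ?thesis by (metis zero_neq_one)
  qed
  show ?thesis
  proof (cases "e \<in> P")
    case False
    then have "f \<in> P" "e = 0" using assms by auto
    then obtain t where "t \<in> h" "wt f e t \<noteq> 0" using *[of f e] assms by blast
    moreover have "wt e f t = - wt f e t" by (simp add: wt_def)
    ultimately show ?thesis by (metis neg_equal_0_iff_equal)
  qed (use * assms in blast)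
qed

text \<open>At \<open>e - f\<close> the weight \<open>wt k l\<close> takes one of the values -2, -1,
  0, 1, 2, and it is 2 only for \<open>(k, l) = (e, f)\<close>. The other values differ from 2
  because 1, 2, 3 and 4 are nonzero.\<close>

lemma wt_eq_cases:
  assumes "e \<in> P" "f \<in> P" "r e = r f" "e \<noteq> f" "k \<in> P" "l \<in> P"
    and "wt k l (e - f) = wt e f (e - f)"
  shows "k = e \<and> l = f"
proof (rule ccontr)
  assume "\<not> (k = e \<and> l = f)"
  moreover have "(1::'f) \<noteq> 2" "(1::'f) \<noteq> 3"
    using add_left_cancel[of 1 0 "1::'f"] add_left_cancel[of 1 0 "2::'f"] numeral_nonzero(1) by simp_all
  ultimately show False
    using assms numeral_nonzero unfolding wt_def eps_diff[OF assms(1-3)]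
    by (auto split: if_splits)
qed

subsection \<open>Peirce components\<close>

text \<open>The index 0, which is not in \<open>P\<close>, stands for the complement \<open>1 - \<Sum>P\<close> of the unit of \<open>S\<close>;
  correspondingly \<open>eps 0 = 0\<close>.\<close>

definition lp :: "'a \<Rightarrow> 'a \<Rightarrow> 'a" where
  "lp e x = (if e = 0 then x - \<Sum>P * x else e * x)"

definition rp :: "'a \<Rightarrow> 'a \<Rightarrow> 'a" where
  "rp e x = (if e = 0 then x - x * \<Sum>P else x * e)"

definition pc :: "'a \<Rightarrow> 'a \<Rightarrow> 'a \<Rightarrow> 'a" where
  "pc e f x = lp e (rp f x)"

lemma lp_mult: "lp e (x * y) = lp e x * y"
  by (simp add: lp_def algebra_simps)

lemma rp_mult: "rp e (x * y) = x * rp e y"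
  by (simp add: rp_def algebra_simps)

lemma lp_rp: "lp e (rp f x) = rp f (lp e x)"
  by (simp add: lp_def rp_def algebra_simps)

text \<open>Associativity with a factor between \<open>x\<close> and \<open>y\<close>, valid for the
  formal factor \<open>1 - \<Sum>P\<close> as well.\<close>

lemma middle: "rp e x * y = x * lp e y"
  by (simp add: lp_def rp_def algebra_simps)

lemma lp_linear: "lp e (x + y) = lp e x + lp e y" "lp e (x - y) = lp e x - lp e y"
  "lp e (s c x) = s c (lp e x)" "lp e 0 = 0"
  by (simp_all add: lp_def algebra_simps scale_mult_right scale_right_diff_distrib)

lemma rp_linear: "rp e (x + y) = rp e x + rp e y" "rp e (x - y) = rp e x - rp e y"
  "rp e (s c x) = s c (rp e x)" "rp e 0 = 0"
  by (simp_all add: rp_def algebra_simps scale_mult_left scale_right_diff_distrib)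

lemma pc_linear: "pc e f (x + y) = pc e f x + pc e f y" "pc e f (x - y) = pc e f x - pc e f y"
  "pc e f (s c x) = s c (pc e f x)" "pc e f 0 = 0"
  by (simp_all add: pc_def lp_linear rp_linear)

lemma lp_lp:
  assumes "e \<in> insert 0 P" "f \<in> insert 0 P"
  shows "lp e (lp f x) = (if e = f then lp e x else 0)"
proof -
  have "\<Sum>P * (\<Sum>P * x) = \<Sum>P * x"
    using unit_left[of "\<Sum>P"] subspace_sum[OF S'(1), of P "\<lambda>x. x"] PD(4)
    by (simp add: mult.assoc[symmetric])
  moreover have "\<Sum>P * (e * x) = e * x" "e * (\<Sum>P * x) = e * x" if "e \<in> P" for e
    using unit_idempotent[OF that] by (simp_all add: mult.assoc[symmetric])
  moreover have "e * (f * x) = (if e = f then e * x else 0)" if "e \<in> P" "f \<in> P" for e f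
    using idempotent_mult[OF that] by (simp add: mult.assoc[symmetric])
  ultimately show ?thesis
    using assms PD(3) unfolding lp_def by (auto simp: right_diff_distrib)
qed

lemma rp_rp:
  assumes "e \<in> insert 0 P" "f \<in> insert 0 P"
  shows "rp e (rp f x) = (if e = f then rp e x else 0)"
proof -
  have "x * \<Sum>P * \<Sum>P = x * \<Sum>P"
    using unit_left[of "\<Sum>P"] subspace_sum[OF S'(1), of P "\<lambda>x. x"] PD(4)
    by (simp add: mult.assoc)
  moreover have "x * \<Sum>P * e = x * e" "x * e * \<Sum>P = x * e" if "e \<in> P" for e
    using unit_idempotent[OF that] by (simp_all add: mult.assoc)
  moreover have "x * f * e = (if e = f then x * e else 0)" if "e \<in> P" "f \<in> P" for e f
    using idempotent_mult[OF that(2,1)] by (simp add: mult.assoc)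
  ultimately show ?thesis
    using assms PD(3) unfolding rp_def by (auto simp: left_diff_distrib)
qed

lemma pc_pc:
  assumes "e \<in> insert 0 P" "f \<in> insert 0 P" "k \<in> insert 0 P" "l \<in> insert 0 P"
  shows "pc e f (pc k l x) = (if e = k \<and> f = l then pc e f x else 0)"
proof -
  have "pc e f (pc k l x) = lp e (lp k (rp f (rp l x)))" by (simp add: pc_def lp_rp)
  then show ?thesis using assms by (simp add: lp_lp rp_rp lp_linear pc_def)
qed

lemma lp_sum: "(\<Sum>e\<in>insert 0 P. lp e x) = x"
proof -
  have "(\<Sum>e\<in>P. lp e x) = \<Sum>P * x"
    unfolding sum_distrib_right using PD(3) by (intro sum.cong) (auto simp: lp_def)
  then show ?thesis using PD(1,3) by (simp add: lp_def)
qed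

lemma rp_sum: "(\<Sum>e\<in>insert 0 P. rp e x) = x"
proof -
  have "(\<Sum>e\<in>P. rp e x) = x * \<Sum>P"
    unfolding sum_distrib_left using PD(3) by (intro sum.cong) (auto simp: rp_def)
  then show ?thesis using PD(1,3) by (simp add: rp_def)
qed

lemma pc_sum: "x = (\<Sum>e\<in>insert 0 P. \<Sum>f\<in>insert 0 P. pc e f x)"
  unfolding pc_def by (subst sum.swap) (simp only: lp_sum rp_sum)

lemma pc_S:
  assumes "x \<in> S" "e \<in> P" "f \<in> P"
  shows "pc e f x = e * x * f"
  using assms PD(3) by (auto simp: pc_def lp_def rp_def mult.assoc)

lemma lp_h:
  assumes "t \<in> h" "e \<in> insert 0 P"
  shows "lp e (t * x) = s (eps e t) (lp e x)" "t * lp e x = s (eps e t) (lp e x)"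
proof -
  have p: "\<Sum>P * t = t" "t * \<Sum>P = t" using unit_left unit_right h_S[OF assms(1)] by auto
  \<comment> \<open>For \<open>e = 0\<close> both equations read \<open>0 = 0\<close>: the unit
    \<open>\<Sum>P\<close> fixes \<open>t\<close> from both sides, so the complement annihilates
    it.\<close>
  have *: "lp e t = s (eps e t) e" "rp e t = s (eps e t) e"
    using assms h_mult[OF assms(1), of e] p PD(3)
    by (auto simp: lp_def rp_def eps_0) (auto simp: eps_def)
  have e: "s (eps e t) e * x = s (eps e t) (lp e x)"
    using PD(3) by (cases "e = 0") (auto simp: eps_0 lp_def scale_mult_left)
  show "lp e (t * x) = s (eps e t) (lp e x)" unfolding lp_mult *(1) e ..
  show "t * lp e x = s (eps e t) (lp e x)" unfolding middle[symmetric] *(2) e ..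
qed

lemma rp_h:
  assumes "t \<in> h" "e \<in> insert 0 P"
  shows "rp e (x * t) = s (eps e t) (rp e x)" "rp e x * t = s (eps e t) (rp e x)"
proof -
  have p: "\<Sum>P * t = t" "t * \<Sum>P = t" using unit_left unit_right h_S[OF assms(1)] by auto
  have *: "lp e t = s (eps e t) e" "rp e t = s (eps e t) e"
    using assms h_mult[OF assms(1), of e] p PD(3)
    by (auto simp: lp_def rp_def eps_0) (auto simp: eps_def)
  have e: "x * s (eps e t) e = s (eps e t) (rp e x)"
    using PD(3) by (cases "e = 0") (auto simp: eps_0 rp_def scale_mult_right)
  show "rp e (x * t) = s (eps e t) (rp e x)" unfolding rp_mult *(2) e ..
  show "rp e x * t = s (eps e t) (rp e x)" unfolding middle *(1) e ..
qed

lemma pc_commutator: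
  assumes "t \<in> h" "e \<in> insert 0 P" "f \<in> insert 0 P"
  shows "pc e f (commutator t x) = s (wt e f t) (pc e f x)"
    and "commutator t (pc e f x) = s (wt e f t) (pc e f x)"
proof -
  have "pc e f (commutator t x) = rp f (lp e (t * x)) - lp e (rp f (x * t))"
    by (simp add: commutator_def pc_def lp_rp lp_linear rp_linear)
  then show "pc e f (commutator t x) = s (wt e f t) (pc e f x)"
    unfolding lp_h[OF assms(1,2)] rp_h[OF assms(1,3)]
    by (simp add: wt_def pc_def lp_rp lp_linear rp_linear scale_left_diff_distrib)
  have "commutator t (pc e f x) = t * lp e (rp f x) - rp f (lp e x) * t"
    by (simp add: commutator_def pc_def lp_rp)
  then show "commutator t (pc e f x) = s (wt e f t) (pc e f x)"
    unfolding lp_h[OF assms(1,2)] rp_h[OF assms(1,3)]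
    by (simp add: wt_def pc_def lp_rp scale_left_diff_distrib)
qed

text \<open>Peirce projections commute with the action of \<open>h\<close>, so a component of
  another weight would be an eigenvector for two different scalars.\<close>

lemma pc_weight_vector:
  assumes "x \<in> weight_space s commutator h L \<alpha>" "e \<in> insert 0 P" "f \<in> insert 0 P"
    and "t \<in> h" "wt e f t \<noteq> \<alpha> t"
  shows "pc e f x = 0"
proof -
  have "commutator t x = s (\<alpha> t) x" using assms(1,4) by (simp add: weight_space_def)
  then have "s (wt e f t) (pc e f x) = s (\<alpha> t) (pc e f x)"
    using pc_commutator(1)[OF assms(4,2,3), of x] by (metis pc_linear(3))
  then show ?thesis using assms(5) by simp
qed

lemma weight_zero:
  assumes "x \<in> weight_space s commutator h L (\<lambda>_. 0)" "e \<in> insert 0 P" "f \<in> insert 0 P" "e \<noteq> f"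
  shows "pc e f x = 0"
  using wt_neq[OF assms(2-4)] pc_weight_vector[OF assms(1-3)] by auto

subsection \<open>Roots\<close>

lemma E_weight:
  assumes "e \<in> P" "f \<in> P" "r e = r f" "e \<noteq> f"
  shows "E e f \<in> weight_space s commutator h g (wt e f)"
proof -
  have "pc e f (E e f) = E e f"
    unfolding pc_S[OF E_in[OF assms(1-3)] assms(1,2)]
    using E_left[OF assms(1-3), of e] E_right[OF assms(1-3), of f] assms(1,2) by simp
  then have "commutator t (E e f) = s (wt e f t) (E e f)" if "t \<in> h" for t
    using pc_commutator(2)[OF that, of e f "E e f"] assms by simp
  then show ?thesis using E_in_g[OF assms] by (simp add: weight_space_def)
qed

lemma h_abelian:
  assumes "t \<in> h" "u \<in> h"
  shows "commutator t u = 0"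
proof -
  have "t * u = u * t"
  proof (rule co_eqI)
    fix e f assume e: "e \<in> P" and f: "f \<in> P"
    have "e * (t * u) * f = e * t * (u * f)" "e * (u * t) * f = e * u * (t * f)"
      by (simp_all add: mult.assoc)
    then have "e * (t * u) * f = e * (u * t) * f"
      using h_mult[OF assms(1) e] h_mult[OF assms(2) e] h_mult[OF assms(1) f] h_mult[OF assms(2) f]
        idempotent_mult[OF e f]
      by (auto simp: scale_mult_left scale_mult_right mult.commute)
    then show "co e f (t * u) = co e f (u * t)" unfolding co_def by simp
  qed (use assms h_S S'(2) in blast)+
  then show ?thesis by (simp add: commutator_def)
qed

text \<open>The one element \<open>e - f\<close> already separates \<open>wt e f\<close> from the
  weight of every other matrix position, so all entries of \<open>x\<close> except the one at
  \<open>(e, f)\<close> vanish.\<close>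

lemma root_weight_space:
  assumes e: "e \<in> P" "f \<in> P" "r e = r f" "e \<noteq> f"
    and x: "x \<in> weight_space s commutator h g (wt e f)"
  shows "\<exists>c. x = s c (E e f)"
proof -
  have xS: "x \<in> S" using x g_subset by (auto simp: weight_space_def)
  have "x = s (co e f x) (E e f)"
  proof (rule co_eqI[OF xS])
    show "s (co e f x) (E e f) \<in> S" using E_in[OF e(1-3)] S'(6) by blast
    fix k l assume kl: "k \<in> P" "l \<in> P" "r k = r l"
    show "co k l x = co k l (s (co e f x) (E e f))"
    proof (cases "k = e \<and> l = f")
      case False
      have "wt k l (e - f) \<noteq> wt e f (e - f)"
        using wt_eq_cases[OF e kl(1,2)] False by blast
      then have "pc k l x = 0"
        using pc_weight_vector[OF x, of k l] kl(1,2) diff_in_h[OF e(1-3)] by blast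
      then have "k * x * l = s 0 (E k l)" using pc_S[OF xS kl(1,2)] by simp
      then have "co k l x = 0" using co_unique[OF kl] by blast
      then show ?thesis using False co_E[OF e(1-3), of k l] E_in[OF e(1-3)] by (auto simp: co_scale)
    qed (use co_E[OF e(1-3), of k l] E_in[OF e(1-3)] in \<open>simp add: co_scale\<close>)
  qed
  then show ?thesis by blast
qed

lemma roots_eq: "roots s commutator g h = {wt e f |e f. e \<in> P \<and> f \<in> P \<and> r e = r f \<and> e \<noteq> f}"
proof (intro equalityI subsetI)
  fix \<alpha> assume "\<alpha> \<in> roots s commutator g h"
  then have \<alpha>: "\<alpha> \<in> dual_space s h" "\<alpha> \<noteq> (\<lambda>_. 0)" "weight_space s commutator h g \<alpha> \<noteq> {0}"
    by (auto simp: roots_def)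
  then obtain x where x: "x \<in> weight_space s commutator h g \<alpha>" "x \<noteq> 0"
    using subspace_0[OF subspace_weight_space[OF subspace_comm_span]] by blast
  have xS: "x \<in> S" using x g_subset by (auto simp: weight_space_def)
  obtain e f where ef: "e \<in> P" "f \<in> P" "r e = r f" "co e f x \<noteq> 0"
    using co_eqI[OF xS S'(3)] x(2) by (auto simp: co_zero)
  have "pc e f x \<noteq> 0" using pc_S[OF xS ef(1,2)] co_eq[OF xS ef(1-3)] ef(4) E_nonzero[OF ef(1-3)] by simp
  then have "wt e f t = \<alpha> t" if "t \<in> h" for t
    using pc_weight_vector[OF x(1), of e f t] ef(1,2) that by auto
  then have "\<alpha> = wt e f" using dual_eqI[OF \<alpha>(1) wt_dual] by metis
  moreover have "e \<noteq> f" using calculation \<alpha>(2) by (auto simp: wt_def)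
  ultimately show "\<alpha> \<in> {wt e f |e f. e \<in> P \<and> f \<in> P \<and> r e = r f \<and> e \<noteq> f}" using ef(1-3) by blast
next
  fix \<alpha> assume "\<alpha> \<in> {wt e f |e f. e \<in> P \<and> f \<in> P \<and> r e = r f \<and> e \<noteq> f}"
  then obtain e f where ef: "\<alpha> = wt e f" "e \<in> P" "f \<in> P" "r e = r f" "e \<noteq> f" by blast
  have "wt e f \<noteq> (\<lambda>_. 0)" using wt_neq[of e f] ef by auto
  then show "\<alpha> \<in> roots s commutator g h"
    using ef wt_dual E_weight[OF ef(2-5)] E_nonzero[OF ef(2-4)] by (auto simp: roots_def)
qed

lemma finite_roots: "finite (roots s commutator g h)"
proof (rule finite_subset)
  show "roots s commutator g h \<subseteq> (\<lambda>(e, f). wt e f) ` (P \<times> P)" unfolding roots_eq by auto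
qed (use PD(1) in simp)

lemma weight_space_zero: "weight_space s commutator h g (\<lambda>_. 0) = h"
proof
  show "h \<subseteq> weight_space s commutator h g (\<lambda>_. 0)"
    using h_abelian by (auto simp: weight_space_def h_def)
  show "weight_space s commutator h g (\<lambda>_. 0) \<subseteq> h"
  proof
    fix x assume x: "x \<in> weight_space s commutator h g (\<lambda>_. 0)"
    then have xg: "x \<in> g" by (simp add: weight_space_def)
    have "co e f x = 0" if ef: "e \<in> P" "f \<in> P" "e \<noteq> f" for e f
    proof (cases "r e = r f")
      case True
      have "e * x * f = s 0 (E e f)"
        using weight_zero[OF x, of e f] pc_S[of x e f] xg g_subset ef by auto
      then show ?thesis using co_unique[OF ef(1,2) True] by blast
    qed (simp add: co_out)
    then show "x \<in> h" using xg by (simp add: h_def)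
  qed
qed

lemma split_cartan_h: "split_cartan s commutator g h"
proof -
  have hg: "h \<subseteq> g" by (auto simp: h_def)
  have "nilpotent s commutator h"
    unfolding nilpotent_def
  proof (rule exI[of _ 1])
    have "{commutator x y |x y. x \<in> h \<and> y \<in> h} = {0}"
      using h_abelian subspace_0[OF subspace_h] by force
    then show "desc_power s commutator h 1 = {0}" by (simp add: prod_span_def)
  qed
  moreover have "lie_subalgebra s commutator g h"
    unfolding lie_subalgebra_def using hg subspace_h h_abelian subspace_0[OF subspace_h] by simp
  moreover have "{x \<in> g. \<forall>y\<in>h. commutator x y \<in> h} = h"
  proof (intro equalityI subsetI)
    fix x assume "x \<in> {x \<in> g. \<forall>y\<in>h. commutator x y \<in> h}"
    then have x: "x \<in> g" "x \<in> S" "\<And>y. y \<in> h \<Longrightarrow> commutator x y \<in> h" using g_subset by auto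
    have "co e f x = 0" if ef: "e \<in> P" "f \<in> P" "e \<noteq> f" for e f
    proof (cases "r e = r f")
      case True
      \<comment> \<open>The entry of \<open>[t, x]\<close> at \<open>(e, f)\<close> is
        \<open>wt e f t\<close> times that of \<open>x\<close>. It is 0 because
        \<open>[t, x]\<close> is diagonal, and the factor is chosen nonzero.\<close>
      obtain t where t: "t \<in> h" "wt e f t \<noteq> 0" using wt_neq[of e f] ef by blast
      have tx: "commutator t x \<in> h"
      proof -
        have "commutator t x = - commutator x t" by (simp add: commutator_def)
        then show ?thesis using x(3)[OF t(1)] subspace_neg[OF subspace_h] by simp
      qed
      then have "co e f (commutator t x) = 0" using ef by (simp add: h_def)
      then have "pc e f (commutator t x) = 0"
        using pc_S[OF h_S[OF tx] ef(1,2)] co_eq[OF h_S[OF tx] ef(1,2) True] by simp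
      then have "pc e f x = 0" using pc_commutator(1)[OF t(1), of e f x] ef t(2) by simp
      then have "e * x * f = s 0 (E e f)" using pc_S[OF x(2) ef(1,2)] by simp
      then show ?thesis using co_unique[OF ef(1,2) True] by blast
    qed (simp add: co_out)
    then show "x \<in> h" using x(1) by (simp add: h_def)
  qed (use hg h_abelian subspace_0[OF subspace_h] in auto)
  ultimately have "cartan_subalgebra s commutator g h" unfolding cartan_subalgebra_def by blast
  moreover have "direct_sum g (insert (\<lambda>_. 0) (roots s commutator g h)) (weight_space s commutator h g)"
  proof (rule weight_direct_sum)
    show "g \<subseteq> span (\<Union>\<alpha>\<in>insert (\<lambda>_. 0) (roots s commutator g h). weight_space s commutator h g \<alpha>)"
      (is "g \<subseteq> span ?W")
    proof
      fix x assume "x \<in> g"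
      then have x: "x \<in> S" "\<And>e. e \<in> P \<Longrightarrow> tr e x = 0" using g_iff by auto
      show "x \<in> span ?W"
      proof (rule traceless_generators[OF x subspace_span])
        fix e f assume ef: "e \<in> P" "f \<in> P" "r e = r f" "e \<noteq> f"
        then show "E e f \<in> span ?W"
          using E_weight[OF ef] roots_eq by (intro span_base) blast
      next
        fix e assume e: "e \<in> P"
        have "e - r e \<in> weight_space s commutator h g (\<lambda>_. 0)"
          unfolding weight_space_zero using diff_in_h[OF e r_in[OF e]] r_r[OF e] by simp
        then show "e - r e \<in> span ?W" by (intro span_base) blast
      qed
    qed
  qed (use finite_roots dual_zero subspace_comm_span in \<open>auto simp: roots_def\<close>)
  ultimately show ?thesis unfolding split_cartan_def weight_space_zero by blast
qed

end

subsection \<open>Simple components\<close>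

context perfect_matrix_units
begin

definition block_unit :: "'a \<Rightarrow> 'a" where
  "block_unit b = \<Sum>{f\<in>P. r f = r b}"

text \<open>A condition on the row index suffices, since entries across two blocks are 0 by the
  convention for \<open>co\<close>.\<close>

definition block :: "'a \<Rightarrow> 'a set" where
  "block b = {x\<in>S. \<forall>e f. r e \<noteq> r b \<longrightarrow> co e f x = 0}"

definition sl :: "'a \<Rightarrow> 'a set" where
  "sl b = comm_span s (block b)"

lemma block_cong: "r b = r b' \<Longrightarrow> block b = block b'"
  by (simp add: block_def)

lemma sl_cong: "r b = r b' \<Longrightarrow> sl b = sl b'"
  unfolding sl_def using block_cong by metis

lemma block_unit_S: "block_unit b \<in> S"
  unfolding block_unit_def by (intro subspace_sum[OF S'(1)]) (use PD(4) in auto)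

lemma idempotent_block_unit:
  assumes "e \<in> P"
  shows "e * block_unit b = (if r e = r b then e else 0)"
    and "block_unit b * e = (if r e = r b then e else 0)"
proof -
  have "e * block_unit b = (\<Sum>f\<in>{f\<in>P. r f = r b}. if f = e then e else 0)"
    unfolding block_unit_def sum_distrib_left using assms
    by (intro sum.cong refl) (simp add: idempotent_mult)
  then show "e * block_unit b = (if r e = r b then e else 0)" using assms PD(1) by simp
  have "block_unit b * e = (\<Sum>f\<in>{f\<in>P. r f = r b}. if f = e then e else 0)"
    unfolding block_unit_def sum_distrib_right using assms
    by (intro sum.cong refl) (simp add: idempotent_mult)
  then show "block_unit b * e = (if r e = r b then e else 0)" using assms PD(1) by simp
qed

lemma co_block_unit:
  assumes "x \<in> S" "e \<in> P" "f \<in> P" "r e = r f"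
  shows "co e f (block_unit b * x) = (if r e = r b then co e f x else 0)"
    and "co e f (x * block_unit b) = (if r e = r b then co e f x else 0)"
proof -
  have "e * (block_unit b * x) * f = (if r e = r b then e * x * f else 0)"
    using idempotent_block_unit(1)[OF assms(2), of b] by (simp add: mult.assoc[symmetric])
  then show "co e f (block_unit b * x) = (if r e = r b then co e f x else 0)"
    by (intro co_unique[OF assms(2-4)]) (simp add: co_eq[OF assms])
  have "e * (x * block_unit b) * f = (if r f = r b then e * x * f else 0)"
    using idempotent_block_unit(2)[OF assms(3), of b] by (simp add: mult.assoc)
  then show "co e f (x * block_unit b) = (if r e = r b then co e f x else 0)"
    by (intro co_unique[OF assms(2-4)]) (simp add: co_eq[OF assms] assms(4)[symmetric])
qed

lemma block_unit_central: "x \<in> S \<Longrightarrow> block_unit b * x = x * block_unit b"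
  by (rule co_eqI) (simp_all add: S'(2) block_unit_S co_block_unit)

lemma block_subset: "block b \<subseteq> S"
  by (auto simp: block_def)

lemma block_unit_mult: "x \<in> S \<Longrightarrow> block_unit b * x \<in> block b"
proof -
  assume x: "x \<in> S"
  have "co e f (block_unit b * x) = 0" if "r e \<noteq> r b" for e f
  proof (cases "e \<in> P \<and> f \<in> P \<and> r e = r f")
    case True
    then show ?thesis using co_block_unit(1)[OF x, of e f b] that by simp
  qed (rule co_out)
  then show ?thesis unfolding block_def using S'(2)[OF block_unit_S x] by blast
qed

lemma block_unit_id: "x \<in> block b \<Longrightarrow> block_unit b * x = x" "x \<in> block b \<Longrightarrow> x * block_unit b = x"
proof -
  assume x: "x \<in> block b"
  then have xS: "x \<in> S" using block_subset by blast
  show "block_unit b * x = x"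
    by (rule co_eqI) (use x xS S'(2) block_unit_S in \<open>simp_all add: co_block_unit block_def\<close>)
  then show "x * block_unit b = x" using block_unit_central[OF xS] by simp
qed

lemma idempotent_in_block: "e \<in> P \<Longrightarrow> e \<in> block e"
  using PD(4) by (auto simp: block_def co_idempotent)

lemma E_in_block: "e \<in> P \<Longrightarrow> f \<in> P \<Longrightarrow> r e = r f \<Longrightarrow> E e f \<in> block e"
  using E_in by (auto simp: block_def co_E)

lemma block_ideal: "assoc_ideal s S (block b)"
  unfolding assoc_ideal_def
proof (intro conjI ballI subspaceI block_subset)
  fix y x assume y: "y \<in> S" and x: "x \<in> block b"
  have "y * x = block_unit b * (y * x)"
    using block_unit_id(1)[OF x] block_unit_central[OF y] by (metis mult.assoc)
  then show "y * x \<in> block b" using block_unit_mult S'(2)[OF y] x block_subset by (metis subsetD)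
  have "x * y = block_unit b * (x * y)"
    using block_unit_id(1)[OF x] by (metis mult.assoc)
  then show "x * y \<in> block b" using block_unit_mult S'(2)[OF _ y] x block_subset by (metis subsetD)
qed (use S' in \<open>auto simp: block_def co_zero co_add co_scale\<close>)

lemma subspace_block: "subspace (block b)"
  using block_ideal by (simp add: assoc_ideal_def)

lemma block_subalgebra: "assoc_subalgebra s (block b)"
  using block_ideal block_subset unfolding assoc_subalgebra_def assoc_ideal_def by blast

lemma sl_subset_block: "sl b \<subseteq> block b"
  unfolding sl_def by (rule comm_span_subalgebra[OF block_subalgebra])

text \<open>Multiplication by the central idempotent \<open>block_unit b\<close> is a homomorphism
  from \<open>S\<close> onto the block, so it takes commutators of \<open>S\<close> to commutators
  of the block and fixes the elements already there.\<close>

lemma sl_eq: "sl b = block b \<inter> g"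
proof
  have "sl b \<subseteq> g"
    unfolding sl_def using comm_span_base block_subset
    by (intro comm_span_subset subspace_comm_span) blast
  then show "sl b \<subseteq> block b \<inter> g" using sl_subset_block by blast
  have "g \<subseteq> {x. block_unit b * x \<in> sl b}"
  proof (rule comm_span_subset)
    show "subspace {x. block_unit b * x \<in> sl b}"
      unfolding sl_def using subspace_comm_span[of "block b"]
      by (intro subspaceI) (simp_all add: subspace_0 subspace_add subspace_scale distrib_left scale_mult_right)
    fix x y assume xy: "x \<in> S" "y \<in> S"
    have "block_unit b * (u * v) = (block_unit b * u) * (block_unit b * v)" if "u \<in> S" "v \<in> S" for u v
      using block_unit_id(2)[OF block_unit_mult[OF that(1)]] by (simp add: mult.assoc[symmetric])
    then have "block_unit b * commutator x y = commutator (block_unit b * x) (block_unit b * y)"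
      using xy by (simp add: commutator_def right_diff_distrib)
    also have "\<dots> \<in> sl b" unfolding sl_def using xy block_unit_mult by (intro comm_span_base)
    finally show "commutator x y \<in> {x. block_unit b * x \<in> sl b}" by simp
  qed
  then show "block b \<inter> g \<subseteq> sl b" using block_unit_id(1) by force
qed

lemma subspace_sl: "subspace (sl b)"
  unfolding sl_def by (rule subspace_comm_span)

lemma E_in_sl: "e \<in> P \<Longrightarrow> f \<in> P \<Longrightarrow> r e = r f \<Longrightarrow> e \<noteq> f \<Longrightarrow> E e f \<in> sl e"
  unfolding sl_eq using E_in_block E_in_g by blast

lemma diff_in_sl:
  assumes "e \<in> P" "f \<in> P" "r e = r f"
  shows "e - f \<in> sl e"
proof -
  have "f \<in> block e" using idempotent_in_block[OF assms(2)] block_cong[OF assms(3)] by simp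
  then show ?thesis
    unfolding sl_eq using diff_in_g[OF assms] idempotent_in_block[OF assms(1)] subspace_diff[OF subspace_block] by blast
qed

lemma sl_generators:
  assumes "subspace V" "\<And>e f. e \<in> P \<Longrightarrow> f \<in> P \<Longrightarrow> r e = r b \<Longrightarrow> r f = r b \<Longrightarrow> e \<noteq> f \<Longrightarrow> E e f \<in> V"
    and "\<And>e f. e \<in> P \<Longrightarrow> f \<in> P \<Longrightarrow> r e = r b \<Longrightarrow> r f = r b \<Longrightarrow> e - f \<in> V"
  shows "sl b \<subseteq> V"
proof
  fix x assume "x \<in> sl b"
  then have "x \<in> block b" "x \<in> g" by (simp_all add: sl_eq)
  then have x: "x \<in> S" "\<And>e. e \<in> P \<Longrightarrow> tr e x = 0" "\<And>e f. co e f x \<noteq> 0 \<Longrightarrow> r e = r b"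
    using g_iff by (auto simp: block_def)
  show "x \<in> V"
    by (rule traceless_generators[OF x(1,2) assms(1)])
      (use assms(2,3) x(3) r_in r_r in metis)+
qed

section \<open>Lie ideals of \<open>g\<close>\<close>

lemma lie_ideal_sl: "lie_ideal s commutator g (sl b)"
  unfolding lie_ideal_def
proof (intro conjI ballI subspace_sl)
  show "sl b \<subseteq> g" by (simp add: sl_eq)
  fix x y assume x: "x \<in> g" and y: "y \<in> sl b"
  have "x \<in> S" "y \<in> block b" using x y g_subset sl_subset_block by blast+
  then have "commutator x y \<in> block b"
    using block_ideal[of b] subspace_diff[OF subspace_block] by (simp add: commutator_def assoc_ideal_def)
  moreover have "commutator x y \<in> g" using \<open>x \<in> S\<close> \<open>y \<in> block b\<close> block_subset g_commutator by blast
  ultimately show "commutator x y \<in> sl b" by (simp add: sl_eq)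
qed

text \<open>On a block, \<open>x\<close> acts by bracket like its block component
  \<open>block_unit b * x\<close>, which is again traceless. So results on ideals of
  \<open>g\<close> become available for ideals of a component, which is how its simplicity is
  shown.\<close>

lemma lie_ideal_of_sl:
  assumes "lie_ideal s commutator (sl b) I"
  shows "lie_ideal s commutator g I"
  unfolding lie_ideal_def
proof (intro conjI ballI)
  have I: "I \<subseteq> sl b" "subspace I" "\<And>x y. x \<in> sl b \<Longrightarrow> y \<in> I \<Longrightarrow> commutator x y \<in> I"
    using assms by (auto simp: lie_ideal_def)
  show "I \<subseteq> g" using I(1) by (auto simp: sl_eq)
  show "subspace I" by fact
  fix x y assume x: "x \<in> g" and y: "y \<in> I"
  have xS: "x \<in> S" and yb: "y \<in> block b" using x y g_subset I(1) sl_subset_block by blast+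
  have "tr e (block_unit b * x) = 0" if e: "e \<in> P" for e
  proof -
    have "tr e (block_unit b * x) = (if r e = r b then tr e x else 0)"
      unfolding tr_def using xS by (simp add: co_block_unit)
    then show ?thesis using x e g_iff by auto
  qed
  then have "block_unit b * x \<in> g" using S'(2)[OF block_unit_S xS] g_iff by blast
  then have "block_unit b * x \<in> sl b" using block_unit_mult[OF xS] by (simp add: sl_eq)
  then have "commutator (block_unit b * x) y \<in> I" using I(3) y by blast
  moreover have "commutator (block_unit b * x) y = commutator x y"
    unfolding commutator_def using block_unit_id[OF yb] block_unit_central[OF xS] by (metis mult.assoc)
  ultimately show "commutator x y \<in> I" by simp
qed

text \<open>For off-diagonal \<open>E f e\<close>, bracketing twice isolates one matrix entry:
  \<open>[E f e, [E f e, x]] = - 2 E f e x E f e\<close>.\<close>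

lemma ideal_contains_unit:
  assumes "lie_ideal s commutator g I" "I \<noteq> {0}"
  shows "\<exists>e\<in>P. \<exists>f\<in>P. r e = r f \<and> e \<noteq> f \<and> E e f \<in> I"
proof -
  have I: "I \<subseteq> g" "subspace I" "\<And>x y. x \<in> g \<Longrightarrow> y \<in> I \<Longrightarrow> commutator x y \<in> I"
    using assms by (auto simp: lie_ideal_def)
  have scaleD: "x \<in> I" if "s c x \<in> I" "c \<noteq> 0" for c x
    using subspace_scale[OF I(2) that(1), of "1 / c"] that(2) by simp
  obtain x where x: "x \<in> I" "x \<noteq> 0" using assms(2) subspace_0[OF I(2)] by blast
  have xS: "x \<in> S" and xg: "x \<in> g" using x I(1) g_subset by blast+
  show ?thesis
  proof (cases "x \<in> h")
    case False
    then obtain e f where ef: "e \<in> P" "f \<in> P" "e \<noteq> f" "co e f x \<noteq> 0" using xg by (auto simp: h_def)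
    then have r: "r e = r f" using co_out by blast
    define F where "F = E f e"
    have F: "F \<in> g" "F * F = 0" "F * e = F" "f * F = F"
      unfolding F_def
      using E_in_g[OF ef(2,1) r[symmetric]] E_mult_other[OF ef(2,1) r[symmetric] ef(2,1) r[symmetric]]
        E_right[OF ef(2,1) r[symmetric], of e] E_left[OF ef(2,1) r[symmetric], of f] ef by auto
    have "F * x * F = F * (e * x * f) * F" using F(3,4) by (metis mult.assoc)
    also have "\<dots> = s (co e f x) (F * E e f * F)"
      by (simp add: co_eq[OF xS ef(1,2) r] scale_mult_left scale_mult_right)
    also have "F * E e f * F = F"
      unfolding F_def using E_mult[OF ef(2,1,2) r[symmetric] r] E_diag[OF ef(2)] F(4) F_def by simp
    finally have FxF: "F * x * F = s (co e f x) F" .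
    have "commutator F (commutator F x) = (F * F) * x - F * x * F - F * x * F + x * (F * F)"
      by (simp add: commutator_def algebra_simps)
    also have "\<dots> = - (F * x * F + F * x * F)" using F(2) by simp
    also have "\<dots> = s (- 2 * co e f x) F"
      unfolding FxF scale_left_distrib[symmetric] scale_minus_left[symmetric]
      by (simp only: mult_minus_left mult_2)
    finally have "s (- 2 * co e f x) F \<in> I" using I(3)[OF F(1) I(3)[OF F(1) x(1)]] by simp
    then have "F \<in> I" by (rule scaleD) (use numeral_nonzero(1) ef(4) in simp)
    then show ?thesis using ef r unfolding F_def by metis
  next
    case True
    obtain e f where ef: "e \<in> P" "f \<in> P" "co e f x \<noteq> 0"
      using co_eqI[OF xS S'(3)] x(2) by (auto simp: co_zero)
    then have "e = f" using True by (auto simp: h_def)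
    then have e: "e \<in> P" "co e e x \<noteq> 0" using ef by simp_all
    \<comment> \<open>A diagonal that is constant on the block would have the block size times a
      nonzero scalar as trace, which is nonzero in characteristic 0.\<close>
    have "\<exists>f\<in>P. r f = r e \<and> co f f x \<noteq> co e e x"
    proof (rule ccontr)
      assume "\<not> (\<exists>f\<in>P. r f = r e \<and> co f f x \<noteq> co e e x)"
      then have "tr e x = of_nat (card {f\<in>P. r f = r e}) * co e e x"
        unfolding tr_def by (simp add: sum.cong[of _ _ _ "\<lambda>_. co e e x"])
      moreover have "card {f\<in>P. r f = r e} \<noteq> 0" using e(1) PD(1) by auto
      ultimately have "tr e x \<noteq> 0" using of_nat_nonzero e(2) by simp
      then show False using xg e(1) g_iff by blast
    qed
    then obtain f where f: "f \<in> P" "r f = r e" "co f f x \<noteq> co e e x" by blast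
    have ne: "e \<noteq> f" using f(3) by blast
    have "commutator x (E e f) = s (wt e f x) (E e f)"
      using E_weight[OF e(1) f(1) f(2)[symmetric] ne] True by (simp add: weight_space_def)
    moreover have "wt e f x \<noteq> 0" using f(3) True by (simp add: wt_def eps_def)
    moreover have "commutator x (E e f) \<in> I"
    proof -
      have "commutator x (E e f) = - commutator (E e f) x" by (simp add: commutator_def)
      then show ?thesis
        using I(3)[OF E_in_g[OF e(1) f(1) f(2)[symmetric] ne] x(1)] subspace_neg[OF I(2)] by simp
    qed
    ultimately have "E e f \<in> I" using scaleD by simp
    then show ?thesis using e f ne by metis
  qed
qed

text \<open>One off-diagonal unit generates the whole component: brackets with further units move
  its row and column, and \<open>[E k l, E l k] = k - l\<close> gives the diagonal part.\<close>

lemma ideal_contains_sl: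
  assumes "lie_ideal s commutator g I" "I \<noteq> {0}"
  shows "\<exists>b\<in>P. sl b \<subseteq> I"
proof -
  have I: "I \<subseteq> g" "subspace I" "\<And>x y. x \<in> g \<Longrightarrow> y \<in> I \<Longrightarrow> commutator x y \<in> I"
    using assms by (auto simp: lie_ideal_def)
  have I': "commutator y x \<in> I" if "x \<in> g" "y \<in> I" for x y
  proof -
    have "commutator y x = - commutator x y" by (simp add: commutator_def)
    then show ?thesis using I(3)[OF that] subspace_neg[OF I(2)] by simp
  qed
  obtain e f where ef: "e \<in> P" "f \<in> P" "r e = r f" "e \<noteq> f" "E e f \<in> I"
    using ideal_contains_unit[OF assms] by blast
  have comm: "commutator (E a c) (E c d) = E a d"
    if "a \<in> P" "c \<in> P" "d \<in> P" "r a = r c" "r c = r d" "a \<noteq> d" for a c d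
    using E_mult[OF that(1-5)] E_mult_other[OF that(2,3,5,1,2,4)] that(6) by (simp add: commutator_def)
  have left: "E k d \<in> I" if "E c d \<in> I" "k \<in> P" "c \<in> P" "d \<in> P" "r k = r c" "r c = r d" "k \<noteq> d" "k \<noteq> c" for c d k
    using I(3)[OF E_in_g[OF that(2,3,5,8)] that(1)] comm[OF that(2-7)] by simp
  have right: "E c k \<in> I" if "E c d \<in> I" "c \<in> P" "d \<in> P" "k \<in> P" "r c = r d" "r d = r k" "c \<noteq> k" "d \<noteq> k" for c d k
    using I'[OF E_in_g[OF that(3,4,6,8)] that(1)] comm[OF that(2-7)] by simp
  \<comment> \<open>The opposite unit cannot be reached by moving one index at a time, since this
    would pass through a diagonal unit when the block has size 2. It is obtained from
    \<open>f - e\<close> and \<open>[f - e, E f e] = 2 E f e\<close>.\<close>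
  have fe: "E f e \<in> I"
  proof -
    have "commutator (E f e) (E e f) = f - e" by (rule commutator_E[OF ef(2,1) ef(3)[symmetric]])
    then have "f - e \<in> I" using I(3)[OF E_in_g[OF ef(2,1) ef(3)[symmetric]] ef(5)] ef(4) by simp
    then have "commutator (f - e) (E f e) \<in> I"
      using I' E_in_g[OF ef(2,1) ef(3)[symmetric]] ef(4) by blast
    moreover have "commutator (f - e) (E f e) = s (wt f e (f - e)) (E f e)"
      using E_weight[OF ef(2,1) ef(3)[symmetric]] diff_in_h[OF ef(2,1) ef(3)[symmetric]] ef(4)
      by (auto simp: weight_space_def)
    moreover have "wt f e (f - e) = 2"
      using ef(4) by (auto simp: wt_def eps_diff[OF ef(2,1) ef(3)[symmetric]])
    ultimately have "s 2 (E f e) \<in> I" by simp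
    then show ?thesis using subspace_scale[OF I(2), of "s 2 (E f e)" "1/2"] numeral_nonzero by simp
  qed
  \<comment> \<open>The path goes from \<open>E e f\<close> to \<open>E k f\<close> to
    \<open>E k l\<close>. For \<open>k = f\<close> the middle unit would be diagonal, so that case
    starts from \<open>E f e\<close> instead.\<close>
  have all: "E k l \<in> I" if kl: "k \<in> P" "l \<in> P" "r k = r e" "r l = r e" "k \<noteq> l" for k l
  proof (cases "k = f")
    case True
    show ?thesis
    proof (cases "l = e")
      case False
      have "E f l \<in> I"
        by (rule right[OF fe ef(2,1) kl(2)]) (use ef kl True False in auto)
      then show ?thesis using True by simp
    qed (use True fe in simp)
  next
    case False
    have kf: "E k f \<in> I"
    proof (cases "k = e")
      case False
      show ?thesis by (rule left[OF ef(5) kl(1) ef(1,2)]) (use ef kl False \<open>k \<noteq> f\<close> in auto)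
    qed (use ef in simp)
    show ?thesis
    proof (cases "l = f")
      case False
      show ?thesis by (rule right[OF kf kl(1) ef(2) kl(2)]) (use ef kl False in auto)
    qed (use kf in simp)
  qed
  have "sl e \<subseteq> I"
  proof (rule sl_generators[OF I(2)])
    show "E k l \<in> I" if "k \<in> P" "l \<in> P" "r k = r e" "r l = r e" "k \<noteq> l" for k l
      by (rule all[OF that])
    show "k - l \<in> I" if kl: "k \<in> P" "l \<in> P" "r k = r e" "r l = r e" for k l
    proof (cases "k = l")
      case False
      have r: "r k = r l" using kl by simp
      show ?thesis
        using I(3)[OF E_in_g[OF kl(1,2) r False] all[OF kl(2,1,4,3) False[symmetric]]]
        unfolding commutator_E[OF kl(1,2) r] .
    qed (use subspace_0[OF I(2)] in simp)
  qed
  then show ?thesis using ef(1) by blast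
qed

lemma sl_nonzero:
  assumes "b \<in> P"
  shows "\<exists>e\<in>sl b. \<exists>f\<in>sl b. commutator e f \<noteq> 0"
proof -
  obtain f where f: "f \<in> P" "f \<noteq> b" "r f = r b" using nontrivial_block[OF assms] by blast
  have "commutator (E b f) (E f b) \<noteq> 0"
    unfolding commutator_E[OF assms f(1) f(3)[symmetric]] using f(2) by simp
  moreover have "E b f \<in> sl b" "E f b \<in> sl b"
    using E_in_sl[OF assms f(1) f(3)[symmetric] f(2)[symmetric]] E_in_sl[OF f(1) assms f(3,2)]
    unfolding sl_cong[OF f(3)] by this+
  ultimately show ?thesis by blast
qed

lemma sl_not_zero: "b \<in> P \<Longrightarrow> sl b \<noteq> {0}"
  using sl_nonzero[of b] commutator_simps(9) by force

text \<open>Follows from \<open>[e - f, E e f] = 2 E e f\<close> and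
  \<open>[E e f, E f e] = e - f\<close>. A component inside an ideal thus stays inside every term of
  its derived series, which excludes nonzero solvable ideals.\<close>

lemma sl_perfect: "sl b \<subseteq> prod_span s commutator (sl b) (sl b)"
proof (rule sl_generators[OF subspace_prod_span])
  have base: "commutator x y \<in> prod_span s commutator (sl b) (sl b)" if "x \<in> sl b" "y \<in> sl b" for x y
    unfolding prod_span_def using that by (intro span_base) blast
  fix e f assume ef: "e \<in> P" "f \<in> P" "r e = r b" "r f = r b"
  have r: "r e = r f" using ef by simp
  note sl = sl_cong[OF ef(3)] sl_cong[OF ef(4)]
  show "e - f \<in> prod_span s commutator (sl b) (sl b)"
  proof (cases "e = f")
    case False
    then show ?thesis
      using base[of "E e f" "E f e"] commutator_E[OF ef(1,2) r] E_in_sl[OF ef(1,2) r]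
        E_in_sl[OF ef(2,1) r[symmetric]] sl by auto
  qed (use subspace_0[OF subspace_prod_span] in simp)
  assume ne: "e \<noteq> f"
  have "commutator (e - f) (E e f) = s (wt e f (e - f)) (E e f)"
    using E_weight[OF ef(1,2) r ne] diff_in_h[OF ef(1,2) r] by (auto simp: weight_space_def)
  moreover have "wt e f (e - f) = 2"
    using ne by (auto simp: wt_def eps_diff[OF ef(1,2) r])
  ultimately have "s 2 (E e f) \<in> prod_span s commutator (sl b) (sl b)"
    using base[of "e - f" "E e f"] diff_in_sl[OF ef(1,2) r] E_in_sl[OF ef(1,2) r ne] sl by simp
  then show "E e f \<in> prod_span s commutator (sl b) (sl b)"
    using subspace_scale[OF subspace_prod_span, of "s 2 (E e f)" _ _ _ "1/2"] numeral_nonzero by simp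
qed

lemma prod_span_mono: "X \<subseteq> X' \<Longrightarrow> Y \<subseteq> Y' \<Longrightarrow> prod_span s br X Y \<subseteq> prod_span s br X' Y'"
  unfolding prod_span_def by (intro span_mono) blast

lemma semisimple_g: "lie_semisimple s commutator g"
  unfolding lie_semisimple_def
proof (intro allI impI)
  fix I assume I: "lie_ideal s commutator g I \<and> solvable s commutator I"
  show "I = {0}"
  proof (rule ccontr)
    assume "I \<noteq> {0}"
    then obtain b where b: "b \<in> P" "sl b \<subseteq> I" using ideal_contains_sl I by blast
    have "sl b \<subseteq> derived_series s commutator I n" for n
    proof (induction n)
      case (Suc n)
      then show ?case using order_trans[OF sl_perfect prod_span_mono[OF Suc Suc]] by simp
    qed (use b in simp)
    then have "sl b \<subseteq> {0}" using I unfolding solvable_def by metis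
    then show False using sl_not_zero[OF b(1)] subspace_0[OF subspace_sl] by blast
  qed
qed

lemma sl_inj:
  assumes "b \<in> P" "sl b \<subseteq> sl b'"
  shows "r b = r b'"
proof -
  obtain f where f: "f \<in> P" "f \<noteq> b" "r f = r b" using nontrivial_block[OF assms(1)] by blast
  have "E b f \<in> block b'"
    using E_in_sl[OF assms(1) f(1) f(3)[symmetric] f(2)[symmetric]] assms(2) sl_subset_block by blast
  moreover have "co b f (E b f) = 1" using co_E[OF assms(1) f(1) f(3)[symmetric]] by simp
  ultimately show ?thesis by (auto simp: block_def)
qed

lemma simple_components_eq: "simple_components s commutator g = sl ` P"
proof (intro equalityI subsetI)
  fix Q assume "Q \<in> simple_components s commutator g"
  then have Q: "lie_ideal s commutator g Q" "lie_simple s commutator Q"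
    by (auto simp: simple_components_def)
  have "Q \<noteq> {0}" using Q(2) by (auto simp: lie_simple_def commutator_simps)
  then obtain b where b: "b \<in> P" "sl b \<subseteq> Q" using ideal_contains_sl Q(1) by blast
  have "lie_ideal s commutator Q (sl b)"
    using lie_ideal_sl[of b] b(2) Q(1) unfolding lie_ideal_def by blast
  then have "sl b = Q" using Q(2) sl_not_zero[OF b(1)] unfolding lie_simple_def by blast
  then show "Q \<in> sl ` P" using b(1) by blast
next
  fix Q assume "Q \<in> sl ` P"
  then obtain b where b: "b \<in> P" "Q = sl b" by blast
  have "I = {0} \<or> I = sl b" if I: "lie_ideal s commutator (sl b) I" for I
  proof (cases "I = {0}")
    case False
    then obtain b' where b': "b' \<in> P" "sl b' \<subseteq> I"
      using ideal_contains_sl lie_ideal_of_sl[OF I] by blast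
    have "I \<subseteq> sl b" using I by (simp add: lie_ideal_def)
    then have "sl b' = sl b" using b' sl_inj[of b' b] sl_cong by blast
    then show ?thesis using b'(2) \<open>I \<subseteq> sl b\<close> by blast
  qed simp
  then have "lie_simple s commutator (sl b)"
    unfolding lie_simple_def using sl_nonzero[OF b(1)] by blast
  then show "Q \<in> simple_components s commutator g"
    using lie_ideal_sl b by (simp add: simple_components_def)
qed

end

subsection \<open>Weights of the natural and conatural modules\<close>

lemma row_unit_vec:
  assumes "(A::'f::field mat) \<in> carrier_mat n n" "i < n" "j < n"
  shows "(A *\<^sub>v unit_vec n j) $ i = A $$ (i, j)"
  using assms by simp

text \<open>Irreducibility of the column space: a single nonzero column, at a position where
  \<open>v\<close> does not vanish, is enough.\<close>

lemma exists_matrix_mapping_vec: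
  fixes v w :: "'f::field vec"
  assumes "v \<in> carrier_vec n" "v \<noteq> 0\<^sub>v n" "w \<in> carrier_vec n"
  shows "\<exists>M\<in>carrier_mat n n. M *\<^sub>v v = w"
proof -
  obtain k where k: "k < n" "v $ k \<noteq> 0"
    using assms(1,2) by (metis carrier_vecD eq_vecI index_zero_vec)
  define M where "M = mat n n (\<lambda>(i, j). if j = k then w $ i / v $ k else 0)"
  have "M *\<^sub>v v = w"
  proof (rule eq_vecI)
    fix i assume "i < dim_vec w"
    then have i: "i < n" using assms(3) by simp
    have "(M *\<^sub>v v) $ i = (\<Sum>j\<in>{0..<n}. (if j = k then w $ i / v $ k else 0) * v $ j)"
      using i assms(1) by (simp add: M_def scalar_prod_def)
    also have "\<dots> = (\<Sum>j\<in>{0..<n}. if j = k then w $ i else 0)"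
      using k by (intro sum.cong) auto
    finally show "(M *\<^sub>v v) $ i = w $ i" using k by simp
  qed (use assms(3) in \<open>simp add: M_def\<close>)
  then show ?thesis by (intro bexI[of _ M]) (simp_all add: M_def)
qed

context perfect_matrix_units
begin

text \<open>Stated for maps that are multiplicative on commuting pairs, so that it also applies to the
  transpose of a representation.\<close>

lemma matrix_weight:
  assumes b: "b \<in> P" and T: "assoc_ideal s S T" "comm_span s T = sl b"
    and inj: "inj_on \<psi> T" and surj: "\<psi> ` T = carrier_mat n n"
    and add: "\<And>x y. x \<in> T \<Longrightarrow> y \<in> T \<Longrightarrow> \<psi> (x + y) = \<psi> x + \<psi> y"
    and scale: "\<And>c x. x \<in> T \<Longrightarrow> \<psi> (s c x) = c \<cdot>\<^sub>m \<psi> x"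
    and mult: "\<And>x y. x \<in> T \<Longrightarrow> y \<in> T \<Longrightarrow> x * y = y * x \<Longrightarrow> \<psi> (x * y) = \<psi> x * \<psi> y"
    and v: "v \<in> carrier_vec n" "v \<noteq> 0\<^sub>v n"
    and weight: "\<And>x. x \<in> h \<inter> sl b \<Longrightarrow> \<psi> x *\<^sub>v v = \<omega> x \<cdot>\<^sub>v v"
  shows "\<exists>e\<in>P. r e = r b \<and> (\<forall>x\<in>h \<inter> sl b. \<omega> x = eps e x)"
proof -
  have TS: "T \<subseteq> S" "subspace T" "\<And>x y. x \<in> S \<Longrightarrow> y \<in> T \<Longrightarrow> x * y \<in> T"
    "\<And>x y. x \<in> S \<Longrightarrow> y \<in> T \<Longrightarrow> y * x \<in> T"
    using T(1) by (auto simp: assoc_ideal_def)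
  have slT: "sl b \<subseteq> T"
    using TS comm_span_subalgebra[of T] unfolding T(2)[symmetric] assoc_subalgebra_def by blast
  have car: "\<psi> x \<in> carrier_mat n n" if "x \<in> T" for x using surj that by blast
  \<comment> \<open>\<open>T\<close> is only known to have \<open>sl b\<close> as its commutator
    span. Its idempotents are recovered as \<open>E e f * E f e\<close>, a product of an element of
    \<open>sl b\<close> with one of \<open>S\<close>.\<close>
  have eT: "e \<in> T" if e: "e \<in> P" "r e = r b" for e
  proof -
    obtain f where f: "f \<in> P" "f \<noteq> e" "r f = r e" using nontrivial_block[OF e(1)] by blast
    have "E e f \<in> T"
      using E_in_sl[OF e(1) f(1) f(3)[symmetric] f(2)[symmetric]] sl_cong[OF e(2)] slT by blast
    then have "E e f * E f e \<in> T" using TS(4) E_in[OF f(1) e(1) f(3)] by blast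
    then show ?thesis using E_mult[OF e(1) f(1) e(1) f(3)[symmetric] f(3)] E_diag[OF e(1)] by simp
  qed
  have zero: "\<psi> 0 *\<^sub>v v = 0\<^sub>v n"
  proof -
    have "\<psi> (s 0 b) = 0 \<cdot>\<^sub>m \<psi> b" by (rule scale) (use eT b in simp)
    then have "\<psi> 0 = 0\<^sub>m n n" using car[OF eT[OF b]] by (intro eq_matI) auto
    then show ?thesis using v(1) by (intro eq_vecI) auto
  qed
  \<comment> \<open>If all idempotents of the block killed \<open>v\<close>, so would the block
    unit. Being central, it would then kill every image of \<open>v\<close> under \<open>T\<close>,
    that is, every vector, against injectivity of \<open>\<psi>\<close>.\<close>
  have "\<exists>e\<in>P. r e = r b \<and> \<psi> e *\<^sub>v v \<noteq> 0\<^sub>v n"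
  proof (rule ccontr)
    assume no: "\<not> (\<exists>e\<in>P. r e = r b \<and> \<psi> e *\<^sub>v v \<noteq> 0\<^sub>v n)"
    have "\<Sum>F \<in> T \<and> \<psi> (\<Sum>F) *\<^sub>v v = 0\<^sub>v n" if "finite F" "F \<subseteq> {f\<in>P. r f = r b}" for F
      using that
    proof (induction F rule: finite_induct)
      case (insert e F)
      then have e: "e \<in> T" "\<psi> e *\<^sub>v v = 0\<^sub>v n" and F: "\<Sum>F \<in> T" "\<psi> (\<Sum>F) *\<^sub>v v = 0\<^sub>v n"
        using no eT by auto
      have "\<psi> (e + \<Sum>F) *\<^sub>v v = \<psi> e *\<^sub>v v + \<psi> (\<Sum>F) *\<^sub>v v"
        unfolding add[OF e(1) F(1)] using car[OF e(1)] car[OF F(1)] v(1) by (rule add_mult_distrib_mat_vec)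
      then show ?case using insert.hyps e F subspace_add[OF TS(2)] by simp
    qed (use zero subspace_0[OF TS(2)] in simp)
    from this[of "{f\<in>P. r f = r b}"]
    have u: "block_unit b \<in> T" "\<psi> (block_unit b) *\<^sub>v v = 0\<^sub>v n"
      using PD(1) by (simp_all add: block_unit_def)
    have kill: "\<psi> (block_unit b) *\<^sub>v w = 0\<^sub>v n" if w: "w \<in> carrier_vec n" for w
    proof -
      obtain M where M: "M \<in> carrier_mat n n" "M *\<^sub>v v = w"
        using exists_matrix_mapping_vec[OF v w] by blast
      then obtain t where t: "t \<in> T" "\<psi> t = M" using surj by (metis imageE)
      have ut: "block_unit b * t = t * block_unit b" using block_unit_central t(1) TS(1) by blast
      have "\<psi> (block_unit b) *\<^sub>v w = (\<psi> (block_unit b) * \<psi> t) *\<^sub>v v"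
        using car[OF u(1)] car[OF t(1)] v(1) M t(2) by simp
      also have "\<dots> = (\<psi> t * \<psi> (block_unit b)) *\<^sub>v v"
        using mult[OF u(1) t(1) ut] mult[OF t(1) u(1) ut[symmetric]] ut by simp
      also have "\<dots> = \<psi> t *\<^sub>v 0\<^sub>v n"
        using car[OF u(1)] car[OF t(1)] v(1) u(2) by simp
      also have "\<dots> = 0\<^sub>v n" using car[OF t(1)] by (intro eq_vecI) auto
      finally show ?thesis .
    qed
    have "\<psi> (block_unit b) = 0\<^sub>m n n"
    proof (rule eq_matI)
      fix i j assume ij: "i < dim_row (0\<^sub>m n n)" "j < dim_col (0\<^sub>m n n)"
      then have "\<psi> (block_unit b) $$ (i, j) = (\<psi> (block_unit b) *\<^sub>v unit_vec n j) $ i"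
        using row_unit_vec[OF car[OF u(1)]] by simp
      then show "\<psi> (block_unit b) $$ (i, j) = 0\<^sub>m n n $$ (i, j)" using ij kill[of "unit_vec n j"] by simp
    qed (use car[OF u(1)] in auto)
    moreover have "\<psi> 0 = 0\<^sub>m n n"
    proof -
      have "\<psi> (s 0 b) = 0 \<cdot>\<^sub>m \<psi> b" by (rule scale) (use eT b in simp)
      then show ?thesis using car[OF eT[OF b]] by (intro eq_matI) auto
    qed
    ultimately have "block_unit b = 0" using inj u(1) subspace_0[OF TS(2)] by (metis inj_onD)
    then show False using idempotent_block_unit(1)[OF b, of b] PD(5)[OF b] by simp
  qed
  then obtain e where e: "e \<in> P" "r e = r b" "\<psi> e *\<^sub>v v \<noteq> 0\<^sub>v n" by blast
  have "\<omega> x = eps e x" if x: "x \<in> h \<inter> sl b" for x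
  proof -
    have xT: "x \<in> T" and xh: "x \<in> h" using x slT by auto
    have ex: "e * x = s (eps e x) e" "x * e = s (eps e x) e"
      using h_mult[OF xh e(1)] xh by (simp_all add: eps_def)
    \<comment> \<open>Since \<open>e\<close> and \<open>x\<close> commute and \<open>e * x\<close>
      is a multiple of \<open>e\<close>, the matrix of \<open>e * x\<close> sends \<open>v\<close>
      both to \<open>eps e x\<close> times \<open>w\<close> and to \<open>\<omega> x\<close> times
      \<open>w\<close>, and \<open>w\<close> is nonzero.\<close>
    define w where "w = \<psi> e *\<^sub>v v"
    have w: "w \<in> carrier_vec n" using car[OF eT[OF e(1,2)]] v(1) by (auto simp: w_def)
    have "eps e x \<cdot>\<^sub>v w = (eps e x \<cdot>\<^sub>m \<psi> e) *\<^sub>v v"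
      unfolding w_def using car[OF eT[OF e(1,2)]] v(1) by (intro eq_vecI) auto
    also have "\<dots> = \<psi> (e * x) *\<^sub>v v" unfolding ex using scale[OF eT[OF e(1,2)]] by simp
    also have "\<dots> = (\<psi> e * \<psi> x) *\<^sub>v v" using mult[OF eT[OF e(1,2)] xT] ex by simp
    also have "\<dots> = \<psi> e *\<^sub>v (\<omega> x \<cdot>\<^sub>v v)"
      using car[OF eT[OF e(1,2)]] car[OF xT] v(1) weight[OF x] by simp
    also have "\<dots> = \<omega> x \<cdot>\<^sub>v w"
      unfolding w_def using car[OF eT[OF e(1,2)]] v(1) by (intro mult_mat_vec)
    finally have eq: "eps e x \<cdot>\<^sub>v w = \<omega> x \<cdot>\<^sub>v w" .
    obtain k where k: "k < n" "w $ k \<noteq> 0"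
      using w e(3) unfolding w_def[symmetric] by (metis carrier_vecD eq_vecI index_zero_vec)
    have "(eps e x \<cdot>\<^sub>v w) $ k = (\<omega> x \<cdot>\<^sub>v w) $ k" using eq by simp
    then show ?thesis using k w by simp
  qed
  then show ?thesis using e by blast
qed

text \<open>\<open>h\<close> is spanned by the differences \<open>e - r e\<close>, and each of them
  lies in a single component.\<close>

lemma weight_eqI:
  assumes "\<alpha> \<in> dual_space s h" "\<beta> \<in> dual_space s h"
    and eq: "\<And>b x. b \<in> P \<Longrightarrow> x \<in> h \<inter> sl b \<Longrightarrow> \<alpha> x = \<beta> x"
  shows "\<alpha> = \<beta>"
proof (rule dual_eqI[OF assms(1,2)])
  fix t assume t: "t \<in> h"
  have sub: "subspace {t\<in>h. \<alpha> t = \<beta> t}"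
  proof (rule subspaceI)
    have "\<gamma> 0 = 0" if "\<gamma> \<in> dual_space s h" for \<gamma> :: "'a \<Rightarrow> 'f"
    proof -
      have "\<gamma> (s 0 0) = 0 * \<gamma> 0" using that subspace_0[OF subspace_h] unfolding dual_space_def by blast
      then show ?thesis by simp
    qed
    from this[OF assms(1)] this[OF assms(2)]
    show "0 \<in> {t\<in>h. \<alpha> t = \<beta> t}" using subspace_0[OF subspace_h] by simp
  qed (use assms(1,2) subspace_add[OF subspace_h] subspace_scale[OF subspace_h] in \<open>auto simp: dual_space_def\<close>)
  have t': "t \<in> g" "\<And>e f. e \<in> P \<Longrightarrow> f \<in> P \<Longrightarrow> e \<noteq> f \<Longrightarrow> co e f t = 0" using t by (auto simp: h_def)
  have "t \<in> {t\<in>h. \<alpha> t = \<beta> t}"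
  proof (rule traceless_generators[OF _ _ sub])
    fix e assume e: "e \<in> P"
    have "e - r e \<in> h" "e - r e \<in> sl e"
      using diff_in_h[OF e r_in[OF e]] diff_in_sl[OF e r_in[OF e]] r_r[OF e] by simp_all
    then show "e - r e \<in> {t\<in>h. \<alpha> t = \<beta> t}" using eq[OF e] by blast
  qed (use t' g_iff in auto)
  then show "\<alpha> t = \<beta> t" by simp
qed

lemma eps_other_block:
  assumes "x \<in> h \<inter> sl b" "r e \<noteq> r b"
  shows "eps e x = 0"
  using assms sl_subset_block by (auto simp: eps_def block_def)

lemma extended_weights_eq:
  assumes b: "b \<in> P" and e: "e \<in> P" "r e = r b"
    and \<omega>: "\<omega> \<in> dual_space s h" "\<And>Q x. Q \<in> simple_components s commutator g - {sl b} \<Longrightarrow> x \<in> h \<inter> Q \<Longrightarrow> \<omega> x = 0"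
    and eq: "\<And>x. x \<in> h \<inter> sl b \<Longrightarrow> \<omega> x = eps e x"
  shows "\<omega> = eps e"
proof (rule weight_eqI[OF \<omega>(1) eps_dual])
  fix b' x assume b': "b' \<in> P" "x \<in> h \<inter> sl b'"
  show "\<omega> x = eps e x"
  proof (cases "sl b' = sl b")
    case False
    then have "r e \<noteq> r b'" using sl_cong[of b' b] e(2) by metis
    moreover have "sl b' \<in> simple_components s commutator g - {sl b}"
      using simple_components_eq b'(1) False by blast
    ultimately show ?thesis using \<omega>(2) eps_other_block b'(2) by simp
  qed (use eq b'(2) in simp)
qed

lemma natural_weights_subset:
  assumes b: "b \<in> P"
  shows "natural_weights s S h (sl b) \<subseteq> eps ` P"
proof
  fix \<omega> assume "\<omega> \<in> natural_weights s S h (sl b)"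
  then obtain T n \<phi> where T: "assoc_ideal s S T" "comm_span s T = sl b" and \<phi>: "matrix_iso s T n \<phi>"
    and ext: "\<omega> \<in> extended_weights s commutator g h (sl b) n \<phi>"
    unfolding natural_weights_def by blast
  then have \<omega>: "\<omega> \<in> dual_space s h"
    and other': "\<forall>Q\<in>simple_components s commutator g - {sl b}. \<forall>x\<in>h \<inter> Q. \<omega> x = 0"
    unfolding extended_weights_def mem_Collect_eq by metis+
  obtain v where v: "v \<in> carrier_vec n" "v \<noteq> 0\<^sub>v n" "\<forall>x\<in>h \<inter> sl b. \<phi> x *\<^sub>v v = \<omega> x \<cdot>\<^sub>v v"
    using ext unfolding extended_weights_def mem_Collect_eq by metis
  have other: "\<omega> x = 0" if "Q \<in> simple_components s commutator g - {sl b}" "x \<in> h \<inter> Q" for Q x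
    using other' that by blast
  have \<phi>': "inj_on \<phi> T" "\<phi> ` T = carrier_mat n n"
    "\<And>x y. x \<in> T \<Longrightarrow> y \<in> T \<Longrightarrow> \<phi> (x + y) = \<phi> x + \<phi> y"
    "\<And>x y. x \<in> T \<Longrightarrow> y \<in> T \<Longrightarrow> \<phi> (x * y) = \<phi> x * \<phi> y"
    "\<And>c x. x \<in> T \<Longrightarrow> \<phi> (s c x) = c \<cdot>\<^sub>m \<phi> x"
    using \<phi> by (auto simp: matrix_iso_def bij_betw_def)
  have "\<exists>e\<in>P. r e = r b \<and> (\<forall>x\<in>h \<inter> sl b. \<omega> x = eps e x)"
    using v(3) by (intro matrix_weight[OF b T \<phi>'(1-3,5) \<phi>'(4) v(1,2)]) blast+
  then obtain e where e: "e \<in> P" "r e = r b" "\<And>x. x \<in> h \<inter> sl b \<Longrightarrow> \<omega> x = eps e x" by blast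
  have "\<omega> = eps e"
    by (rule extended_weights_eq[OF b e(1,2) \<omega>]) (use other e(3) in auto)
  then show "\<omega> \<in> eps ` P" using e(1) by blast
qed

text \<open>The negative transpose is not multiplicative even on commuting pairs, so
  \<open>matrix_weight\<close> is applied to the transpose and to the functional with the opposite
  sign. The transpose reverses products, which does no harm on commuting pairs.\<close>

lemma conatural_weights_subset:
  assumes b: "b \<in> P"
  shows "conatural_weights s S h (sl b) \<subseteq> (\<lambda>e t. - eps e t) ` P"
proof
  fix \<omega> assume "\<omega> \<in> conatural_weights s S h (sl b)"
  then obtain T n \<phi> where T: "assoc_ideal s S T" "comm_span s T = sl b" and \<phi>: "matrix_iso s T n \<phi>"
    and ext: "\<omega> \<in> extended_weights s commutator g h (sl b) n (\<lambda>x. - transpose_mat (\<phi> x))"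
    unfolding conatural_weights_def by blast
  then have \<omega>: "\<omega> \<in> dual_space s h"
    and other': "\<forall>Q\<in>simple_components s commutator g - {sl b}. \<forall>x\<in>h \<inter> Q. \<omega> x = 0"
    unfolding extended_weights_def mem_Collect_eq by metis+
  obtain v where v: "v \<in> carrier_vec n" "v \<noteq> 0\<^sub>v n" "\<forall>x\<in>h \<inter> sl b. (- transpose_mat (\<phi> x)) *\<^sub>v v = \<omega> x \<cdot>\<^sub>v v"
    using ext unfolding extended_weights_def mem_Collect_eq by metis
  have other: "\<omega> x = 0" if "Q \<in> simple_components s commutator g - {sl b}" "x \<in> h \<inter> Q" for Q x
    using other' that by blast
  have \<phi>': "inj_on \<phi> T" "\<phi> ` T = carrier_mat n n"
    "\<And>x y. x \<in> T \<Longrightarrow> y \<in> T \<Longrightarrow> \<phi> (x + y) = \<phi> x + \<phi> y"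
    "\<And>x y. x \<in> T \<Longrightarrow> y \<in> T \<Longrightarrow> \<phi> (x * y) = \<phi> x * \<phi> y"
    "\<And>c x. x \<in> T \<Longrightarrow> \<phi> (s c x) = c \<cdot>\<^sub>m \<phi> x"
    using \<phi> by (auto simp: matrix_iso_def bij_betw_def)
  have car: "\<phi> x \<in> carrier_mat n n" if "x \<in> T" for x using \<phi>'(2) that by blast
  have slT: "sl b \<subseteq> T"
    using T(1) comm_span_subalgebra[of T] unfolding T(2)[symmetric] assoc_subalgebra_def assoc_ideal_def
    by blast
  have "\<exists>e\<in>P. r e = r b \<and> (\<forall>x\<in>h \<inter> sl b. - \<omega> x = eps e x)"
  proof (rule matrix_weight[OF b T _ _ _ _ _ v(1,2)])
    show "inj_on (\<lambda>x. transpose_mat (\<phi> x)) T"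
      using \<phi>'(1) by (auto simp: inj_on_def)
    show "(\<lambda>x. transpose_mat (\<phi> x)) ` T = carrier_mat n n"
    proof
      show "carrier_mat n n \<subseteq> (\<lambda>x. transpose_mat (\<phi> x)) ` T"
      proof
        fix M :: "'f mat" assume "M \<in> carrier_mat n n"
        then have "transpose_mat M \<in> \<phi> ` T" unfolding \<phi>'(2) by simp
        then obtain x where "x \<in> T" "\<phi> x = transpose_mat M" by auto
        then show "M \<in> (\<lambda>x. transpose_mat (\<phi> x)) ` T" by (metis Matrix.transpose_transpose image_eqI)
      qed
    qed (use car in auto)
    show "transpose_mat (\<phi> (x + y)) = transpose_mat (\<phi> x) + transpose_mat (\<phi> y)"
      if "x \<in> T" "y \<in> T" for x y
      unfolding \<phi>'(3)[OF that] using car[OF that(1)] car[OF that(2)] by (rule transpose_add)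
    show "transpose_mat (\<phi> (s c x)) = c \<cdot>\<^sub>m transpose_mat (\<phi> x)" if "x \<in> T" for c x
      unfolding \<phi>'(5)[OF that] by (intro eq_matI) auto
    show "transpose_mat (\<phi> (x * y)) = transpose_mat (\<phi> x) * transpose_mat (\<phi> y)"
      if "x \<in> T" "y \<in> T" "x * y = y * x" for x y
      unfolding that(3) \<phi>'(4)[OF that(2,1)] using car[OF that(2)] car[OF that(1)] by (rule transpose_mult)
    show "transpose_mat (\<phi> x) *\<^sub>v v = (- \<omega> x) \<cdot>\<^sub>v v" if x: "x \<in> h \<inter> sl b" for x
    proof -
      have c: "\<phi> x \<in> carrier_mat n n" using x slT car by blast
      have "(- transpose_mat (\<phi> x)) *\<^sub>v v = - (transpose_mat (\<phi> x) *\<^sub>v v)"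
        using c v(1) by (intro eq_vecI) auto
      then have "- (transpose_mat (\<phi> x) *\<^sub>v v) = \<omega> x \<cdot>\<^sub>v v" using bspec[OF v(3) x] by simp
      then have "- (- (transpose_mat (\<phi> x) *\<^sub>v v)) = - (\<omega> x \<cdot>\<^sub>v v)" by simp
      moreover have "- (\<omega> x \<cdot>\<^sub>v v) = (- \<omega> x) \<cdot>\<^sub>v v" by (intro eq_vecI) auto
      ultimately show ?thesis by simp
    qed
  qed
  then obtain e where e: "e \<in> P" "r e = r b" "\<And>x. x \<in> h \<inter> sl b \<Longrightarrow> - \<omega> x = eps e x" by blast
  have "(\<lambda>t. - \<omega> t) = eps e"
    by (rule extended_weights_eq[OF b e(1,2) dual_neg[OF \<omega>]]) (use other e(3) in auto)
  then have "\<omega> = (\<lambda>t. - eps e t)" by (metis add.inverse_inverse)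
  then show "\<omega> \<in> (\<lambda>e t. - eps e t) ` P" using e(1) by blast
qed

text \<open>Matrices are indexed by numbers below \<open>n\<close> and matrix units by idempotents;
  an enumeration of the block translates between them. This supplies the isomorphism that the
  definitions of natural and conatural weights ask for.\<close>

lemma block_matrix_iso:
  assumes enum: "bij_betw enum {0..<n} {f\<in>P. r f = r b}"
  shows "matrix_iso s (block b) n (\<lambda>x. mat n n (\<lambda>(i, j). co (enum i) (enum j) x))"
    (is "matrix_iso s _ n ?\<phi>")
proof -
  have en: "enum i \<in> P" "r (enum i) = r b" if "i < n" for i
    using bij_betwE[OF enum] that by auto
  have en_inj: "enum i = enum j \<longleftrightarrow> i = j" if "i < n" "j < n" for i j
    using bij_betw_imp_inj_on[OF enum] that by (auto simp: inj_on_def)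
  have en_surj: "\<exists>i<n. e = enum i" if "e \<in> P" "r e = r b" for e
  proof -
    have "e \<in> enum ` {0..<n}" unfolding bij_betw_imp_surj_on[OF enum] using that by simp
    then show ?thesis by auto
  qed
  have "inj_on ?\<phi> (block b)"
  proof (rule inj_onI)
    fix x y assume x: "x \<in> block b" and y: "y \<in> block b" and eq: "?\<phi> x = ?\<phi> y"
    show "x = y"
    proof (rule co_eqI)
      fix e f assume ef: "e \<in> P" "f \<in> P" "r e = r f"
      show "co e f x = co e f y"
      proof (cases "r e = r b")
        case True
        then obtain i j where ij: "i < n" "j < n" "e = enum i" "f = enum j"
          using en_surj ef by metis
        have "?\<phi> x $$ (i, j) = ?\<phi> y $$ (i, j)" using eq by simp
        then show ?thesis using ij by simp
      qed (use x y in \<open>simp add: block_def\<close>)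
    qed (use x y block_subset in auto)
  qed
  moreover have "?\<phi> ` block b = carrier_mat n n"
  proof
    show "carrier_mat n n \<subseteq> ?\<phi> ` block b"
    proof
      fix M :: "'f mat" assume M: "M \<in> carrier_mat n n"
      define x where "x = (\<Sum>i\<in>{0..<n}. \<Sum>j\<in>{0..<n}. s (M $$ (i, j)) (E (enum i) (enum j)))"
      have Eb: "E (enum i) (enum j) \<in> block b" if "i < n" "j < n" for i j
        using E_in_block[of "enum i" "enum j"] en[OF that(1)] en[OF that(2)] block_cong by metis
      have "x \<in> block b"
        unfolding x_def using Eb by (intro subspace_sum[OF subspace_block] subspace_scale[OF subspace_block]) auto
      have co: "co (enum k) (enum l) x = M $$ (k, l)" if kl: "k < n" "l < n" for k l
      proof -
        have Es: "E (enum i) (enum j) \<in> S" if "i < n" "j < n" for i j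
          using Eb that block_subset by blast
        have coE: "co (enum k) (enum l) (s c (E (enum i) (enum j))) = (if i = k then if j = l then c else 0 else 0)"
          if ij: "i < n" "j < n" for i j c
        proof -
          have "r (enum i) = r (enum j)" using en ij by simp
          then show ?thesis
            using co_E[OF en(1)[OF ij(1)] en(1)[OF ij(2)], of "enum k" "enum l"] kl ij Es
            by (auto simp: co_scale en_inj)
        qed
        have "co (enum k) (enum l) x
            = (\<Sum>i\<in>{0..<n}. \<Sum>j\<in>{0..<n}. co (enum k) (enum l) (s (M $$ (i, j)) (E (enum i) (enum j))))"
        proof -
          have sS: "s c (E (enum i) (enum j)) \<in> S" if "i \<in> {0..<n}" "j \<in> {0..<n}" for c i j
            using Es S'(6) that by simp
          have "co (enum k) (enum l) x
              = (\<Sum>i\<in>{0..<n}. co (enum k) (enum l) (\<Sum>j\<in>{0..<n}. s (M $$ (i, j)) (E (enum i) (enum j))))"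
            unfolding x_def by (rule co_sum) (rule subspace_sum[OF S'(1)], rule sS)
          also have "\<dots> = (\<Sum>i\<in>{0..<n}. \<Sum>j\<in>{0..<n}. co (enum k) (enum l) (s (M $$ (i, j)) (E (enum i) (enum j))))"
            by (intro sum.cong refl) (rule co_sum, rule sS)
          finally show ?thesis .
        qed
        also have "\<dots> = (\<Sum>i\<in>{0..<n}. if i = k then M $$ (i, l) else 0)"
          using coE kl by (intro sum.cong refl) simp
        finally show ?thesis using kl by simp
      qed
      have "?\<phi> x = M" using M co by (intro eq_matI) auto
      then show "M \<in> ?\<phi> ` block b" using \<open>x \<in> block b\<close> by (metis image_eqI)
    qed
  qed auto
  moreover have "?\<phi> (x * y) = ?\<phi> x * ?\<phi> y" if x: "x \<in> block b" and y: "y \<in> block b" for x y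
  proof (rule eq_matI)
    fix i j assume "i < dim_row (?\<phi> x * ?\<phi> y)" "j < dim_col (?\<phi> x * ?\<phi> y)"
    then have ij: "i < n" "j < n" by auto
    have "co (enum i) (enum j) (x * y) = (\<Sum>k\<in>P. co (enum i) k x * co k (enum j) y)"
      using x y block_subset by (intro co_mult) auto
    also have "\<dots> = (\<Sum>k\<in>{f\<in>P. r f = r b}. co (enum i) k x * co k (enum j) y)"
      using PD(1) y by (intro sum.mono_neutral_right) (auto simp: block_def)
    also have "\<dots> = (\<Sum>k\<in>{0..<n}. co (enum i) (enum k) x * co (enum k) (enum j) y)"
      by (rule sum.reindex_bij_betw[OF enum, symmetric])
    finally show "?\<phi> (x * y) $$ (i, j) = (?\<phi> x * ?\<phi> y) $$ (i, j)"
      using ij by (simp add: scalar_prod_def)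
  qed auto
  moreover have "?\<phi> (x + y) = ?\<phi> x + ?\<phi> y" if "x \<in> block b" "y \<in> block b" for x y
    using that block_subset by (intro eq_matI) (auto simp: co_add subset_iff)
  moreover have "?\<phi> (s c x) = c \<cdot>\<^sub>m ?\<phi> x" if "x \<in> block b" for c x
    using that block_subset by (intro eq_matI) (auto simp: co_scale subset_iff)
  ultimately show ?thesis unfolding matrix_iso_def bij_betw_def by blast
qed

text \<open>The unit vector at the position of \<open>e\<close> is a weight vector for both modules,
  as elements of \<open>h\<close> become diagonal matrices, equal to their transposes.\<close>

lemma eps_in_component_weights:
  assumes e: "e \<in> P"
  shows "eps e \<in> natural_weights s S h (sl e)" "(\<lambda>t. - eps e t) \<in> conatural_weights s S h (sl e)"
proof -
  obtain n enum where enum: "bij_betw enum {0..<n::nat} {f\<in>P. r f = r e}"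
    using ex_bij_betw_nat_finite[of "{f\<in>P. r f = r e}"] PD(1) by auto
  have en: "enum i \<in> P" "r (enum i) = r e" if "i < n" for i
    using bij_betwE[OF enum] that by auto
  have "e \<in> enum ` {0..<n}" unfolding bij_betw_imp_surj_on[OF enum] using e by simp
  then obtain m where m: "m < n" "enum m = e" by auto
  have en_m: "enum i = e \<longleftrightarrow> i = m" if "i < n" for i
    using bij_betw_imp_inj_on[OF enum] that m by (auto simp: inj_on_def)
  define \<phi> where "\<phi> x = mat n n (\<lambda>(i, j). co (enum i) (enum j) x)" for x
  have iso: "matrix_iso s (block e) n \<phi>" unfolding \<phi>_def by (rule block_matrix_iso[OF enum])
  have car: "\<phi> x \<in> carrier_mat n n" for x by (simp add: \<phi>_def)
  have u: "unit_vec n m \<in> carrier_vec n" "unit_vec n m \<noteq> (0\<^sub>v n :: 'f vec)"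
    using m(1) by auto
  have other: "eps e x = 0" if "Q \<in> simple_components s commutator g - {sl e}" "x \<in> h \<inter> Q" for Q x
  proof -
    have "Q \<in> sl ` P" "Q \<noteq> sl e" using that(1) by (simp_all add: simple_components_eq)
    then obtain b where b: "Q = sl b" "r e \<noteq> r b" using sl_cong by (metis imageE)
    then show ?thesis using eps_other_block that(2) by simp
  qed
  have diag: "co (enum i) e x = (if i = m then eps e x else 0)" "co e (enum i) x = (if i = m then eps e x else 0)"
    if "x \<in> h" "i < n" for x i
    using that en[OF that(2)] en_m[OF that(2)] e by (auto simp: eps_def h_def)
  have "\<phi> x *\<^sub>v unit_vec n m = eps e x \<cdot>\<^sub>v unit_vec n m" if "x \<in> h \<inter> sl e" for x
  proof (rule eq_vecI)
    fix i assume "i < dim_vec (eps e x \<cdot>\<^sub>v unit_vec n m)"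
    then show "(\<phi> x *\<^sub>v unit_vec n m) $ i = (eps e x \<cdot>\<^sub>v unit_vec n m) $ i"
      using m row_unit_vec[OF car, of i m x] diag that by (simp add: \<phi>_def)
  qed (simp add: \<phi>_def)
  then have "eps e \<in> extended_weights s commutator g h (sl e) n \<phi>"
    unfolding extended_weights_def using eps_dual other u by blast
  then show "eps e \<in> natural_weights s S h (sl e)"
    unfolding natural_weights_def using block_ideal iso sl_def by blast
  have "(- transpose_mat (\<phi> x)) *\<^sub>v unit_vec n m = (- eps e x) \<cdot>\<^sub>v unit_vec n m" if "x \<in> h \<inter> sl e" for x
  proof (rule eq_vecI)
    fix i assume "i < dim_vec ((- eps e x) \<cdot>\<^sub>v unit_vec n m)"
    then show "((- transpose_mat (\<phi> x)) *\<^sub>v unit_vec n m) $ i = ((- eps e x) \<cdot>\<^sub>v unit_vec n m) $ i"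
      using m row_unit_vec[of "- transpose_mat (\<phi> x)" n i m] diag that by (simp add: \<phi>_def)
  qed (simp add: \<phi>_def)
  then have "(\<lambda>t. - eps e t) \<in> extended_weights s commutator g h (sl e) n (\<lambda>x. - transpose_mat (\<phi> x))"
    unfolding extended_weights_def using dual_neg[OF eps_dual] other u by auto
  then show "(\<lambda>t. - eps e t) \<in> conatural_weights s S h (sl e)"
    unfolding conatural_weights_def using block_ideal iso sl_def by blast
qed

end

subsection \<open>The set of weights\<close>

context perfect_matrix_units
begin

text \<open>Sums of two of these bound \<open>\<Gamma>\<close> from above, coarsely but well enough
  for finiteness and integrality.\<close>

definition basic_weights :: "('a \<Rightarrow> 'f) set" where
  "basic_weights = {\<lambda>_. 0} \<union> eps ` P \<union> (\<lambda>e t. - eps e t) ` P"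

abbreviation \<Gamma> :: "('a \<Rightarrow> 'f) set" where
  "\<Gamma> \<equiv> Gamma_set s S h"

lemma component_weights_subset: "b \<in> P \<Longrightarrow> component_weights s S h (sl b) \<subseteq> basic_weights"
  using natural_weights_subset[of b] conatural_weights_subset[of b]
  unfolding component_weights_def basic_weights_def by blast

lemma Gamma_subset: "\<Gamma> \<subseteq> {\<lambda>t. \<mu> t + \<nu> t |\<mu> \<nu>. \<mu> \<in> basic_weights \<and> \<nu> \<in> basic_weights}" (is "_ \<subseteq> ?W")
proof
  fix \<omega> assume "\<omega> \<in> \<Gamma>"
  then consider "\<omega> \<in> roots s commutator g h" | "\<omega> = (\<lambda>_. 0)"
    | Q where "Q \<in> sl ` P" "\<omega> \<in> component_weights s S h Q"
    | Q Q' \<mu> \<nu> where "Q \<in> sl ` P" "Q' \<in> sl ` P" "\<mu> \<in> component_weights s S h Q"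
        "\<nu> \<in> component_weights s S h Q'" "\<omega> = (\<lambda>x. \<mu> x + \<nu> x)"
    unfolding Gamma_set_def simple_components_eq by blast
  then show "\<omega> \<in> ?W"
  proof cases
    case 1
    then obtain e f where "\<omega> = wt e f" "e \<in> P" "f \<in> P" unfolding roots_eq by blast
    then have "\<omega> = (\<lambda>t. eps e t + - eps f t)" "eps e \<in> basic_weights" "(\<lambda>t. - eps f t) \<in> basic_weights"
      by (auto simp: wt_def basic_weights_def)
    then show ?thesis
      by (intro CollectI exI[of _ "eps e"] exI[of _ "\<lambda>t. - eps f t"] conjI)
  next
    case 2
    moreover have "(\<lambda>_. 0) \<in> basic_weights" by (simp add: basic_weights_def)
    ultimately show ?thesis by (intro CollectI exI[of _ "\<lambda>_. 0"] conjI) simp_all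
  next
    case 3
    then have "\<omega> \<in> basic_weights" "(\<lambda>_. 0) \<in> basic_weights"
      using component_weights_subset by (auto simp: basic_weights_def)
    then show ?thesis by (intro CollectI exI[of _ \<omega>] exI[of _ "\<lambda>_. 0"] conjI) simp_all
  next
    case 4
    then show ?thesis using component_weights_subset by blast
  qed
qed

lemma finite_Gamma: "finite \<Gamma>"
proof (rule finite_subset[OF Gamma_subset])
  have "{\<lambda>t. \<mu> t + \<nu> t |\<mu> \<nu>. \<mu> \<in> basic_weights \<and> \<nu> \<in> basic_weights}
      = (\<lambda>(\<mu>, \<nu>) t. \<mu> t + \<nu> t) ` (basic_weights \<times> basic_weights)" by auto
  moreover have "finite basic_weights" using PD(1) by (simp add: basic_weights_def)
  ultimately show "finite {\<lambda>t. \<mu> t + \<nu> t |\<mu> \<nu>. \<mu> \<in> basic_weights \<and> \<nu> \<in> basic_weights}" by simp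
qed

text \<open>Opposite root spaces are the lines through \<open>E e f\<close> and
  \<open>E f e\<close>, so their brackets span the line through \<open>e - f\<close>; the value 2
  fixes the scalar.\<close>

lemma coroot:
  assumes ef: "e \<in> P" "f \<in> P" "r e = r f" "e \<noteq> f"
    and t: "t \<in> prod_span s commutator (weight_space s commutator h g (wt e f))
      (weight_space s commutator h g (\<lambda>x. - wt e f x))"
    and two: "wt e f t = 2"
  shows "t = e - f"
proof -
  note fe = ef(2,1) ef(3)[symmetric] ef(4)[symmetric]
  have neg: "(\<lambda>x. - wt e f x) = wt f e" by (simp add: wt_def)
  have "prod_span s commutator (weight_space s commutator h g (wt e f))
      (weight_space s commutator h g (\<lambda>x. - wt e f x)) \<subseteq> span {e - f}"
    unfolding prod_span_def neg
  proof (intro span_minimal subspace_span subsetI)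
    fix x assume "x \<in> {commutator x y |x y. x \<in> weight_space s commutator h g (wt e f)
        \<and> y \<in> weight_space s commutator h g (wt f e)}"
    then obtain y z where yz: "x = commutator y z" "y \<in> weight_space s commutator h g (wt e f)"
        "z \<in> weight_space s commutator h g (wt f e)" by blast
    obtain c where c: "y = s c (E e f)" using root_weight_space[OF ef yz(2)] by blast
    obtain d where d: "z = s d (E f e)" using root_weight_space[OF fe yz(3)] by blast
    have "x = s d (s c (e - f))"
      unfolding yz(1) c d commutator_simps commutator_E[OF ef(1-3)] ..
    then show "x \<in> span {e - f}" using span_scale[OF span_scale[OF span_base]] by simp
  qed
  then obtain k where k: "t = s k (e - f)" using t span_singleton by blast
  have ef_h: "e - f \<in> h" by (rule diff_in_h[OF ef(1-3)])
  have "wt e f t = k * wt e f (e - f)"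
    unfolding k using wt_dual[of e f] ef_h unfolding dual_space_def by blast
  also have "wt e f (e - f) = 2" using ef(4) by (auto simp: wt_def eps_diff[OF ef(1-3)])
  finally have "k = 1" using two numeral_nonzero(1) by simp
  then show ?thesis using k by simp
qed

lemma Gamma_integral: "\<Gamma> \<subseteq> integral_weights s commutator g h"
proof
  fix \<omega> assume "\<omega> \<in> \<Gamma>"
  then obtain \<mu> \<nu> where \<omega>: "\<omega> = (\<lambda>t. \<mu> t + \<nu> t)" and \<mu>: "\<mu> \<in> basic_weights" and \<nu>: "\<nu> \<in> basic_weights"
    using Gamma_subset by blast
  have dual: "\<gamma> \<in> dual_space s h" if "\<gamma> \<in> basic_weights" for \<gamma>
    using that dual_zero eps_dual dual_neg[OF eps_dual] by (auto simp: basic_weights_def)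
  have int: "\<gamma> (e - f) \<in> \<int>" if "\<gamma> \<in> basic_weights" "e \<in> P" "f \<in> P" "r e = r f" for \<gamma> e f
    using that(1) by (auto simp: basic_weights_def eps_diff[OF that(2-4)])
  have "\<omega> t \<in> \<int>" if \<alpha>: "\<alpha> \<in> roots s commutator g h"
    and t: "t \<in> prod_span s commutator (weight_space s commutator h g \<alpha>)
      (weight_space s commutator h g (\<lambda>x. - \<alpha> x))" "\<alpha> t = 2" for \<alpha> t
  proof -
    obtain e f where ef: "\<alpha> = wt e f" "e \<in> P" "f \<in> P" "r e = r f" "e \<noteq> f"
      using \<alpha> unfolding roots_eq by blast
    have "t = e - f" by (rule coroot[OF ef(2-5)]) (use t ef(1) in auto)
    then show ?thesis using int[OF \<mu> ef(2-4)] int[OF \<nu> ef(2-4)] by (simp add: \<omega>)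
  qed
  then show "\<omega> \<in> integral_weights s commutator g h"
    unfolding integral_weights_def using dual_add[OF dual[OF \<mu>] dual[OF \<nu>]] \<omega> by simp
qed

lemma roots_subset_Gamma: "insert (\<lambda>_. 0) (roots s commutator g h) \<subseteq> \<Gamma>"
  unfolding Gamma_set_def by blast

text \<open>An index 0 leaves a natural or a conatural weight alone, two indices in one block give a
  root, and indices in different blocks give a natural weight of one component plus a conatural
  weight of another.\<close>

lemma wt_in_Gamma:
  assumes "e \<in> insert 0 P" "f \<in> insert 0 P"
  shows "wt e f \<in> \<Gamma>"
proof -
  have nat: "eps k \<in> component_weights s S h (sl k)" "(\<lambda>t. - eps k t) \<in> component_weights s S h (sl k)"
    if "k \<in> P" for k
    using eps_in_component_weights[OF that] by (simp_all add: component_weights_def)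
  have single: "\<omega> \<in> \<Gamma>" if "k \<in> P" "\<omega> \<in> component_weights s S h (sl k)" for k \<omega>
    unfolding Gamma_set_def simple_components_eq using that by blast
  consider "e = f" | "e = 0" "f \<in> P" | "e \<in> P" "f = 0" | "e \<in> P" "f \<in> P" "e \<noteq> f" "r e = r f"
    | "e \<in> P" "f \<in> P" "r e \<noteq> r f"
    using assms by blast
  then show ?thesis
  proof cases
    case 1
    then have "wt e f = (\<lambda>_. 0)" by (simp add: wt_def)
    then show ?thesis using roots_subset_Gamma by simp
  next
    case 2
    then have "wt e f = (\<lambda>t. - eps f t)" by (simp add: wt_def eps_0)
    then show ?thesis using single nat 2 by simp
  next
    case 3
    then have "wt e f = eps e" by (simp add: wt_def eps_0)
    then show ?thesis using single nat 3 by simp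
  next
    case 4
    then show ?thesis using roots_subset_Gamma unfolding roots_eq by blast
  next
    case 5
    have "sl e \<noteq> sl f" using sl_inj[of e f] 5 by blast
    moreover have "wt e f = (\<lambda>t. eps e t + - eps f t)" by (simp add: wt_def)
    ultimately have "\<exists>Q\<in>sl ` P. \<exists>Q'\<in>sl ` P. Q \<noteq> Q' \<and>
        (\<exists>\<mu>\<in>component_weights s S h Q. \<exists>\<nu>\<in>component_weights s S h Q'. wt e f = (\<lambda>x. \<mu> x + \<nu> x))"
      using nat(1)[OF 5(1)] nat(2)[OF 5(2)] imageI[OF 5(1), of sl] imageI[OF 5(2), of sl]
      by (intro bexI[of _ "sl e"] bexI[of _ "sl f"] conjI bexI[of _ "eps e"] bexI[of _ "\<lambda>t. - eps f t"])
    then show ?thesis unfolding Gamma_set_def simple_components_eq by simp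
  qed
qed

lemma Gamma_dual: "\<Gamma> \<subseteq> dual_space s h"
  using Gamma_integral by (auto simp: integral_weights_def)

subsection \<open>The grading\<close>

abbreviation L :: "'a set" where
  "L \<equiv> comm_span s UNIV"

lemma subalgebra_UNIV: "assoc_subalgebra s UNIV"
  by (simp add: assoc_subalgebra_def)

lemma commutator_in_L: "commutator x y \<in> L"
  by (rule comm_span_base) auto

lemma g_subset_L: "g \<subseteq> L"
  by (rule comm_span_subset[OF subspace_comm_span commutator_in_L])

text \<open>Some \<open>t\<close> in \<open>h\<close> acts on an off-diagonal component by a nonzero
  scalar, so the component is itself a multiple of a commutator.\<close>

lemma pc_in_L:
  assumes "e \<in> insert 0 P" "f \<in> insert 0 P" "e \<noteq> f" "pc e f x = x"
  shows "x \<in> L"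
proof -
  obtain t where t: "t \<in> h" "wt e f t \<noteq> 0" using wt_neq[OF assms(1-3)] by blast
  have "s (1 / wt e f t) (commutator t (pc e f x)) = pc e f x"
    unfolding pc_commutator(2)[OF t(1) assms(1,2)] using t(2) by simp
  moreover have "s (1 / wt e f t) (commutator t (pc e f x)) \<in> L"
    by (intro subspace_scale[OF subspace_comm_span] commutator_in_L)
  ultimately show ?thesis using assms(4) by simp
qed

lemma pc_weight:
  assumes "e \<in> insert 0 P" "f \<in> insert 0 P" "e \<noteq> f" "pc e f x = x"
  shows "x \<in> weight_space s commutator h L (wt e f)"
  using pc_in_L[OF assms] pc_commutator(2)[OF _ assms(1,2), of _ x] assms(4)
  by (simp add: weight_space_def)

definition diag :: "'a \<Rightarrow> 'a" where
  "diag x = (\<Sum>e\<in>insert 0 P. pc e e x)"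

lemma pc_idem:
  assumes "e \<in> insert 0 P" "f \<in> insert 0 P"
  shows "pc e f (pc e f x) = pc e f x"
  using pc_pc[OF assms assms] by simp

lemma diag_linear: "diag (x + y) = diag x + diag y" "diag (x - y) = diag x - diag y"
  "diag (s c x) = s c (diag x)" "diag 0 = 0"
  by (simp_all add: diag_def pc_linear sum.distrib sum_subtractf scale_sum_right scale_right_distrib
      scale_right_diff_distrib del: sum.insert)

lemma diag_off: "x = diag x + (\<Sum>e\<in>insert 0 P. \<Sum>f\<in>insert 0 P - {e}. pc e f x)"
proof -
  have "(\<Sum>f\<in>insert 0 P. pc e f x) = pc e e x + (\<Sum>f\<in>insert 0 P - {e}. pc e f x)" if "e \<in> insert 0 P" for e
    using that PD(1) by (subst sum.remove[of _ e]) auto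
  then have "(\<Sum>e\<in>insert 0 P. \<Sum>f\<in>insert 0 P. pc e f x)
      = (\<Sum>e\<in>insert 0 P. pc e e x + (\<Sum>f\<in>insert 0 P - {e}. pc e f x))"
    by (intro sum.cong refl)
  then show ?thesis using pc_sum[of x] unfolding diag_def sum.distrib by simp
qed

lemma L_generated: "L \<subseteq> span (\<Union>\<alpha>\<in>\<Gamma>. weight_space s commutator h L \<alpha>)"
proof
  fix x assume x: "x \<in> L"
  let ?W = "\<Union>\<alpha>\<in>\<Gamma>. weight_space s commutator h L \<alpha>"
  have off: "pc e f x \<in> weight_space s commutator h L (wt e f)"
    if "e \<in> insert 0 P" "f \<in> insert 0 P - {e}" for e f
    using pc_weight[of e f "pc e f x"] pc_idem[of e f x] that by blast
  then have offL: "pc e f x \<in> L" if "e \<in> insert 0 P" "f \<in> insert 0 P - {e}" for e f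
    using that unfolding weight_space_def by blast
  \<comment> \<open>A single component \<open>pc e e x\<close> need not lie in \<open>L\<close>.
    Their sum does, being \<open>x\<close> minus off-diagonal components, each of which is in
    \<open>L\<close>.\<close>
  have "diag x = x - (\<Sum>e\<in>insert 0 P. \<Sum>f\<in>insert 0 P - {e}. pc e f x)"
    using diag_off[of x] by (simp add: algebra_simps)
  then have "diag x \<in> L"
    using subspace_diff[OF subspace_comm_span x] subspace_sum[OF subspace_comm_span]
      offL by (metis (no_types, lifting))
  moreover have "commutator t (diag x) = s 0 (diag x)" if t: "t \<in> h" for t
  proof -
    have "commutator t (pc e e x) = 0" if "e \<in> insert 0 P" for e
      using pc_commutator(2)[OF t that that] by (simp add: wt_def)
    then show ?thesis unfolding diag_def commutator_sum_right by simp
  qed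
  ultimately have "diag x \<in> weight_space s commutator h L (\<lambda>_. 0)" by (simp add: weight_space_def)
  then have "diag x \<in> span ?W" using roots_subset_Gamma by (intro span_base) blast
  moreover have "(\<Sum>e\<in>insert 0 P. \<Sum>f\<in>insert 0 P - {e}. pc e f x) \<in> span ?W"
  proof (intro span_sum span_base)
    fix e f assume ef: "e \<in> insert 0 P" "f \<in> insert 0 P - {e}"
    then have "wt e f \<in> \<Gamma>" using wt_in_Gamma by blast
    then show "pc e f x \<in> ?W" using off[OF ef] by blast
  qed
  ultimately have "diag x + (\<Sum>e\<in>insert 0 P. \<Sum>f\<in>insert 0 P - {e}. pc e f x) \<in> span ?W"
    by (rule span_add)
  then show "x \<in> span ?W" using diag_off[of x] by simp
qed

section \<open>The zero weight space and condition \<open>(\<Gamma>3)\<close>\<close>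

definition zero_part :: "'a set" where
  "zero_part = span (\<Union>\<alpha>\<in>{\<alpha> \<in> \<Gamma> - {\<lambda>_. 0}. (\<lambda>x. - \<alpha> x) \<in> \<Gamma> - {\<lambda>_. 0}}.
     prod_span s commutator (weight_space s commutator h L \<alpha>) (weight_space s commutator h L (\<lambda>x. - \<alpha> x)))"

lemma subspace_zero_part: "subspace zero_part"
  by (simp add: zero_part_def)

lemma zero_part_subset: "zero_part \<subseteq> weight_space s commutator h L (\<lambda>_. 0)"
  unfolding zero_part_def
proof (intro span_minimal subspace_weight_space subspace_comm_span UN_least)
  fix \<alpha> :: "'a \<Rightarrow> 'f"
  show "prod_span s commutator (weight_space s commutator h L \<alpha>) (weight_space s commutator h L (\<lambda>x. - \<alpha> x))
      \<subseteq> weight_space s commutator h L (\<lambda>_. 0)"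
    unfolding prod_span_def
  proof (intro span_minimal subspace_weight_space subspace_comm_span subsetI)
    fix z assume "z \<in> {commutator x y |x y. x \<in> weight_space s commutator h L \<alpha> \<and>
        y \<in> weight_space s commutator h L (\<lambda>x. - \<alpha> x)}"
    then obtain x y where z: "z = commutator x y"
      and x: "\<And>t. t \<in> h \<Longrightarrow> commutator t x = s (\<alpha> t) x" and y: "\<And>t. t \<in> h \<Longrightarrow> commutator t y = s (- \<alpha> t) y"
      unfolding weight_space_def by blast
    have "commutator t z = 0" if t: "t \<in> h" for t
    proof -
      have "commutator t z = commutator (commutator t x) y + commutator x (commutator t y)"
        unfolding z commutator_def by (simp add: algebra_simps)
      then show ?thesis unfolding x[OF t] y[OF t] commutator_simps by simp
    qed
    then show "z \<in> weight_space s commutator h L (\<lambda>_. 0)"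
      using commutator_in_L z by (simp add: weight_space_def)
  qed
qed

text \<open>The source of every membership in \<open>zero_part\<close> below; the remaining
  commutators of diagonal components are rewritten as combinations of such opposite pairs.\<close>

lemma opposite_commutator:
  assumes "e \<in> insert 0 P" "f \<in> insert 0 P" "e \<noteq> f" "pc e f x = x" "pc f e y = y"
  shows "commutator x y \<in> zero_part"
proof -
  have neg: "(\<lambda>t. - wt e f t) = wt f e" by (simp add: wt_def)
  have "wt e f \<noteq> (\<lambda>_. 0)" "wt f e \<noteq> (\<lambda>_. 0)"
    using wt_neq[of e f] wt_neq[of f e] assms(1-3) by auto
  then have \<alpha>: "wt e f \<in> {\<alpha> \<in> \<Gamma> - {\<lambda>_. 0}. (\<lambda>x. - \<alpha> x) \<in> \<Gamma> - {\<lambda>_. 0}}"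
    using wt_in_Gamma assms(1,2) by (simp add: neg)
  have "y \<in> weight_space s commutator h L (\<lambda>t. - wt e f t)"
    unfolding neg by (rule pc_weight) (use assms in auto)
  then have "commutator x y \<in> prod_span s commutator (weight_space s commutator h L (wt e f))
      (weight_space s commutator h L (\<lambda>t. - wt e f t))"
    unfolding prod_span_def using pc_weight[OF assms(1-4)] by (intro span_base) blast
  then show ?thesis unfolding zero_part_def by (intro span_base UN_I[OF \<alpha>])
qed

lemma pcI: "lp e x = x \<Longrightarrow> rp f x = x \<Longrightarrow> pc e f x = x"
  by (simp add: pc_def)

lemma pcD:
  assumes "e \<in> insert 0 P" "f \<in> insert 0 P" "pc e f x = x"
  shows "lp e x = x" "rp f x = x"
proof -
  have "lp e (pc e f x) = pc e f x" using lp_lp[OF assms(1,1)] by (simp add: pc_def)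
  then show "lp e x = x" using assms(3) by simp
  have "rp f (pc e f x) = pc e f x"
    unfolding pc_def lp_rp[of e f x] using rp_rp[OF assms(2,2)] by simp
  then show "rp f x = x" using assms(3) by simp
qed

text \<open>For \<open>u, v \<in> e A e\<close> and matrix units \<open>a = E e f\<close>, \<open>c = E f e\<close>:
  \<open>2 [u, v] = [u a, c v] - [v a, c u] + [[u, v] a, c]\<close>.\<close>

lemma diagonal_commutator:
  assumes e: "e \<in> P" and u: "pc e e u = u" and v: "pc e e v = v"
  shows "commutator u v \<in> zero_part"
proof -
  obtain f where f: "f \<in> P" "f \<noteq> e" "r f = r e" using nontrivial_block[OF e] by blast
  define a c where "a = E e f" and "c = E f e"
  have e0: "e \<in> insert 0 P" "f \<in> insert 0 P" and ne0: "e \<noteq> 0" "f \<noteq> 0" using e f PD(3) by auto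
  have ac: "a * c = e" "rp f a = a" "lp f c = c" "lp e a = a" "rp e c = c"
    unfolding a_def c_def lp_def rp_def
    using E_mult[OF e f(1) e f(3)[symmetric] f(3)] E_diag[OF e] ne0
      E_right[OF e f(1) f(3)[symmetric] f(1)] E_left[OF f(1) e f(3) f(1)]
      E_left[OF e f(1) f(3)[symmetric] e] E_right[OF f(1) e f(3) e] by simp_all
  have uv: "lp e u = u" "rp e u = u" "lp e v = v" "rp e v = v"
    using pcD[OF e0(1,1)] u v by auto
  have eq: "x * e = x" "e * x = x" if "lp e x = x" "rp e x = x" for x
    using that ne0(1) by (simp_all add: lp_def rp_def)
  have mem: "commutator (x * a) (c * y) \<in> zero_part" if x: "lp e x = x" and y: "rp e y = y" for x y
  proof (rule opposite_commutator[OF e0 f(2)[symmetric]])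
    show "pc e f (x * a) = x * a" by (rule pcI) (simp_all add: lp_mult rp_mult x ac)
    show "pc f e (c * y) = c * y" by (rule pcI) (simp_all add: lp_mult rp_mult y ac)
  qed
  define w where "w = commutator u v"
  have w: "lp e w = w" "rp e w = w"
    by (simp_all add: w_def commutator_def lp_linear rp_linear lp_mult rp_mult uv)
  have 1: "commutator (x * a) (c * y) = x * y - c * y * x * a" if "rp e x = x" "lp e x = x" for x y
  proof -
    have "x * a * (c * y) = x * (a * c) * y" by (simp add: mult.assoc)
    then show ?thesis using eq[OF that(2,1)] by (simp add: commutator_def ac(1) mult.assoc)
  qed
  have "commutator (u * a) (c * v) - commutator (v * a) (c * u) = w + c * w * a"
    unfolding 1[OF uv(2,1)] 1[OF uv(4,3)] w_def by (simp add: commutator_def algebra_simps)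
  \<comment> \<open>The factor \<open>e\<close> changes nothing, as \<open>c * e = c\<close>; it
    keeps the shape that \<open>1\<close> and \<open>mem\<close> cover.\<close>
  moreover have "commutator (w * a) (c * e) = w - c * w * a"
    unfolding 1[OF w(2,1)] using eq[OF w] by (simp add: mult.assoc)
  ultimately have "s 2 w = commutator (u * a) (c * v) - commutator (v * a) (c * u) + commutator (w * a) (c * e)"
    using scale_left_distrib[of 1 1 w] by simp
  moreover have "rp e e = e" using PD(6)[OF e] ne0 by (simp add: rp_def)
  ultimately have "s 2 w \<in> zero_part"
    using mem uv w subspace_add[OF subspace_zero_part] subspace_diff[OF subspace_zero_part] by simp
  then show ?thesis
    using subspace_scale[OF subspace_zero_part, of "s 2 w" "1/2"] numeral_nonzero(1) by (simp add: w_def)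
qed

text \<open>The resolution of the identity is inserted between the two factors. Exchanging the
  summation indices in \<open>y * x\<close> then pairs it with \<open>x * y\<close>, so that every
  summand is a commutator of opposite components.\<close>

lemma diag_commutator:
  "diag (commutator x y) = (\<Sum>e\<in>insert 0 P. \<Sum>k\<in>insert 0 P. commutator (pc e k x) (pc k e y))"
proof -
  have prod: "diag (x * y) = (\<Sum>e\<in>insert 0 P. \<Sum>k\<in>insert 0 P. pc e k x * pc k e y)" for x y
    unfolding diag_def
  proof (intro sum.cong refl)
    fix e assume "e \<in> insert 0 P"
    have "pc e e (x * y) = lp e x * (\<Sum>k\<in>insert 0 P. lp k (rp e y))"
      unfolding lp_sum by (simp add: pc_def rp_mult lp_mult)
    also have "\<dots> = (\<Sum>k\<in>insert 0 P. lp e x * lp k (rp e y))" by (rule sum_distrib_left)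
    also have "\<dots> = (\<Sum>k\<in>insert 0 P. pc e k x * pc k e y)"
    proof (intro sum.cong refl)
      fix k assume k: "k \<in> insert 0 P"
      have "pc e k x * pc k e y = lp e x * lp k (lp k (rp e y))"
        by (simp add: pc_def lp_rp middle)
      then show "lp e x * lp k (rp e y) = pc e k x * pc k e y" using lp_lp[OF k k] by simp
    qed
    finally show "pc e e (x * y) = (\<Sum>k\<in>insert 0 P. pc e k x * pc k e y)" .
  qed
  have "diag (y * x) = (\<Sum>e\<in>insert 0 P. \<Sum>k\<in>insert 0 P. pc k e y * pc e k x)"
    unfolding prod by (rule sum.swap)
  then show ?thesis
    unfolding commutator_def diag_linear prod sum_subtractf by simp
qed

text \<open>The preimage of the span under \<open>x \<mapsto> (1 - p) x (1 - p)\<close>, closed up under multiplication, is an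
  ideal containing \<open>S\<close>.\<close>

lemma complement_generated:
  assumes gen: "generated_ideal s UNIV S = UNIV"
  shows "pc 0 0 x \<in> span {u * v |u v e. e \<in> P \<and> pc 0 e u = u \<and> pc e 0 v = v}" (is "_ \<in> ?K")
proof -
  \<comment> \<open>With no unit in \<open>A\<close>, multiplication on neither side, on one side
    and on both sides has to be listed separately.\<close>
  define I where "I = {x. \<forall>a b. pc 0 0 x \<in> ?K \<and> pc 0 0 (a * x) \<in> ?K \<and> pc 0 0 (x * b) \<in> ?K \<and> pc 0 0 (a * x * b) \<in> ?K}"
  have "assoc_ideal s UNIV I"
    unfolding assoc_ideal_def
  proof (intro conjI ballI subspaceI)
    fix b x assume x: "x \<in> I"
    have I: "pc 0 0 x \<in> ?K" "pc 0 0 (a * x) \<in> ?K" "pc 0 0 (x * a) \<in> ?K" "pc 0 0 (a * x * a') \<in> ?K" for a a'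
      using x unfolding I_def by blast+
    have "pc 0 0 (a * (b * x)) \<in> ?K" "pc 0 0 (a * (b * x) * a') \<in> ?K" for a a'
      using I(2)[of "a * b"] I(4)[of "a * b" a'] by (simp_all add: mult.assoc)
    then show "b * x \<in> I" unfolding I_def using I by blast
    have "pc 0 0 (x * b * a) \<in> ?K" "pc 0 0 (a' * (x * b)) \<in> ?K" "pc 0 0 (a' * (x * b) * a) \<in> ?K" for a a'
      using I(3)[of "b * a"] I(4)[of a' b] I(4)[of a' "b * a"] by (simp_all add: mult.assoc)
    then show "x * b \<in> I" unfolding I_def using I by blast
  qed (auto simp: I_def distrib_left distrib_right scale_mult_left scale_mult_right pc_linear
      span_zero span_add span_scale)
  moreover have "S \<subseteq> I"
  proof
    fix x assume x: "x \<in> S"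
    have l: "lp 0 x = 0" and r: "rp 0 x = 0" using unit_left[OF x] unit_right[OF x] by (simp_all add: lp_def rp_def)
    have "pc 0 0 x = 0" "pc 0 0 (x * b) = 0" for b
      by (simp_all add: pc_def lp_rp l lp_mult rp_linear)
    moreover have "pc 0 0 (a * x) = 0" for a by (simp add: pc_def rp_mult r lp_linear)
    moreover have "pc 0 0 (a * x * b) \<in> ?K" for a b
    proof -
      \<comment> \<open>Each idempotent is written twice, so that one copy remains with each of the
        factors \<open>u\<close> and \<open>v\<close>.\<close>
      have "x = (\<Sum>e\<in>P. e * (e * x))"
        using unit_left[OF x] PD(6) by (simp add: sum_distrib_right mult.assoc[symmetric])
      then have "lp 0 a * rp 0 (x * b) = lp 0 a * rp 0 ((\<Sum>e\<in>P. e * (e * x)) * b)" by simp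
      also have "\<dots> = (\<Sum>e\<in>P. (lp 0 a * e) * (e * x * rp 0 b))"
        by (subst rp_mult) (simp add: sum_distrib_left sum_distrib_right mult.assoc)
      also have "\<dots> \<in> ?K"
      proof (intro span_sum span_base)
        fix e assume e: "e \<in> P"
        have e0: "e \<in> insert 0 P" "(0::'a) \<in> insert 0 P" "e \<noteq> 0" using e PD(3) by auto
        have "pc 0 e (lp 0 a * e) = lp 0 a * e"
        proof (rule pcI)
          show "lp 0 (lp 0 a * e) = lp 0 a * e" using lp_lp[OF e0(2,2)] by (simp add: lp_mult)
          show "rp e (lp 0 a * e) = lp 0 a * e"
            using e0(3) PD(6)[OF e] by (simp add: rp_def mult.assoc)
        qed
        moreover have "pc e 0 (e * x * rp 0 b) = e * x * rp 0 b"
        proof (rule pcI)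
          show "lp e (e * x * rp 0 b) = e * x * rp 0 b"
            using e0(3) PD(6)[OF e] by (simp add: lp_def mult.assoc[symmetric])
          show "rp 0 (e * x * rp 0 b) = e * x * rp 0 b" using rp_rp[OF e0(2,2)] by (simp add: rp_mult)
        qed
        ultimately show "lp 0 a * e * (e * x * rp 0 b) \<in> {u * v |u v e. e \<in> P \<and> pc 0 e u = u \<and> pc e 0 v = v}"
          using e by blast
      qed
      finally show ?thesis by (simp add: pc_def rp_mult lp_mult mult.assoc)
    qed
    ultimately show "x \<in> I" unfolding I_def by (simp add: span_zero)
  qed
  ultimately have "I = UNIV" using gen unfolding generated_ideal_def by blast
  then show ?thesis unfolding I_def by blast
qed

text \<open>For \<open>u \<in> (1 - p) A e\<close>, \<open>v \<in> e A (1 - p)\<close> and \<open>y \<in> (1 - p) A (1 - p)\<close>: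
  \<open>[u v, y] = [u, v y] - [y u, v]\<close>.\<close>

lemma complement_commutator:
  assumes gen: "generated_ideal s UNIV S = UNIV" and y: "pc 0 0 y = y"
  shows "commutator (pc 0 0 x) y \<in> zero_part"
  using complement_generated[OF gen, of x]
proof (induction rule: span_induct_alt)
  case base
  then show ?case by (simp add: commutator_simps subspace_0[OF subspace_zero_part])
next
  case (step c z w)
  then obtain u v e where z: "z = u * v" "e \<in> P" "pc 0 e u = u" "pc e 0 v = v" by blast
  have e0: "(0::'a) \<in> insert 0 P" "e \<in> insert 0 P" "0 \<noteq> e" using z(2) PD(3) by auto
  note u = pcD[OF e0(1,2) z(3)] and v = pcD[OF e0(2,1) z(4)] and y' = pcD[OF e0(1,1) y]
  have "pc e 0 (v * y) = v * y" by (rule pcI) (simp_all add: lp_mult rp_mult v y')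
  then have "commutator u (v * y) \<in> zero_part" by (rule opposite_commutator[OF e0 z(3)])
  moreover have "pc 0 e (y * u) = y * u" by (rule pcI) (simp_all add: lp_mult rp_mult u y')
  then have "commutator (y * u) v \<in> zero_part" by (rule opposite_commutator[OF e0 _ z(4)])
  moreover have "commutator z y = commutator u (v * y) - commutator (y * u) v"
    unfolding z(1) commutator_def by (simp add: algebra_simps)
  ultimately have "commutator z y \<in> zero_part" using subspace_diff[OF subspace_zero_part] by simp
  then show ?case
    using step.IH subspace_add[OF subspace_zero_part] subspace_scale[OF subspace_zero_part]
    by (simp add: commutator_simps)
qed

text \<open>\<open>diag\<close> fixes vectors of weight zero, so it is enough that it maps
  commutators into \<open>zero_part\<close>. Its summands there are commutators of opposite
  off-diagonal components, within one corner \<open>e A e\<close>, or within the complement.\<close>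

lemma zero_weight_space:
  assumes gen: "generated_ideal s UNIV S = UNIV"
  shows "weight_space s commutator h L (\<lambda>_. 0) = zero_part"
proof (intro equalityI zero_part_subset subsetI)
  fix z assume z: "z \<in> weight_space s commutator h L (\<lambda>_. 0)"
  have "diag (commutator x y) \<in> zero_part" for x y
    unfolding diag_commutator
  proof (intro subspace_sum[OF subspace_zero_part])
    fix e k assume ek: "e \<in> insert 0 P" "k \<in> insert 0 P"
    note idem = pc_idem[OF ek, of x] pc_idem[OF ek(2,1), of y]
    consider "e \<noteq> k" | "e = k" "e \<in> P" | "e = 0" "k = 0" using ek by blast
    then show "commutator (pc e k x) (pc k e y) \<in> zero_part"
    proof cases
      case 1
      then show ?thesis using opposite_commutator[OF ek] idem by blast
    next
      case 2
      then show ?thesis using diagonal_commutator[of e] idem by simp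
    next
      case 3
      then show ?thesis using complement_commutator[OF gen] idem by simp
    qed
  qed
  then have "L \<subseteq> {x. diag x \<in> zero_part}"
    using subspace_0[OF subspace_zero_part] subspace_add[OF subspace_zero_part] subspace_scale[OF subspace_zero_part]
    by (intro comm_span_subset subspaceI) (simp_all add: diag_linear)
  then have "diag z \<in> zero_part" using z by (auto simp: weight_space_def)
  moreover have "diag z = z"
  proof -
    have "(\<Sum>e\<in>insert 0 P. \<Sum>f\<in>insert 0 P - {e}. pc e f z) = 0"
      using weight_zero[OF z] by (intro sum.neutral ballI) auto
    then show ?thesis using diag_off[of z] by simp
  qed
  ultimately show "z \<in> zero_part" by simp
qed

lemma graded:
  assumes gen: "generated_ideal s UNIV S = UNIV" and fd: "finite_dim s S"
  shows "gamma_graded s commutator L g h \<Gamma>"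
proof -
  obtain B where B: "finite B" "S \<subseteq> span B" using fd by (auto simp: finite_dim_def)
  have "finite_dim s g"
  proof -
    obtain C where C: "C \<subseteq> g" "independent C" "g \<subseteq> span C"
      using maximal_independent_subset[of g] by blast
    have "finite C"
      using independent_span_bound[OF B(1) C(2)] C(1) g_subset B(2) by blast
    then show ?thesis using C unfolding finite_dim_def by blast
  qed
  moreover have "lie_subalgebra s commutator L g"
    unfolding lie_subalgebra_def using g_subset_L subspace_comm_span g_commutator g_subset by blast
  moreover have "direct_sum L \<Gamma> (weight_space s commutator h L)"
    by (rule weight_direct_sum[OF finite_Gamma Gamma_dual subspace_comm_span L_generated])
  ultimately show ?thesis
    unfolding gamma_graded_def zero_weight_space[OF gen]
    using char_0 lie_algebra_comm_span[OF subalgebra_UNIV] finite_Gamma Gamma_integral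
      roots_subset_Gamma semisimple_g split_cartan_h zero_part_def by blast
qed

end

subsection \<open>Arbitrary split Cartan subalgebras\<close>

text \<open>The centralizer \<open>H\<close> of a split Cartan subalgebra \<open>h'\<close> in \<open>S\<close> is commutative. It is semiprime: an
  \<open>x \<in> H\<close> with \<open>x\<^sup>2 = 0\<close> acts on \<open>g\<close> nilpotently and diagonalizably, hence is central in \<open>S\<close>. So \<open>H\<close> is
  spanned by orthogonal idempotents, and these are primitive in \<open>S\<close>.\<close>

locale perfect_semiprime_algebra = alg_closed_algebra s
  for s :: "'f::alg_closed_field \<Rightarrow> 'a::ring \<Rightarrow> 'a" +
  fixes S :: "'a set" and B :: "'a set"
  assumes subalgebra: "assoc_subalgebra s S" and spanning: "finite B" "S \<subseteq> span B"
    and semiprime: "semiprime S" and perfect: "k_perfect s 1 S" and char_0: "CHAR('f) = 0"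
begin

lemma perfect_units:
  assumes "primitive_system S P" "\<And>x. x \<in> S \<Longrightarrow> \<Sum>P * x = x" "\<And>x. x \<in> S \<Longrightarrow> x * \<Sum>P = x"
  shows "\<exists>r E. perfect_matrix_units s S P r E"
proof -
  obtain r E where "matrix_units s S P r E"
    using matrix_units_exist[OF subalgebra semiprime assms] by blast
  then interpret matrix_units s S P r E .
  have "perfect_matrix_units s S P r E"
    by unfold_locales (use one_perfect_block[OF perfect] char_0 in auto)
  then show ?thesis by blast
qed

lemma units_exist: "\<exists>P r E. perfect_matrix_units s S P r E"
  using complete_primitive_system_exists[OF subalgebra spanning semiprime] perfect_units by metis

lemma units_of_split_cartan:
  assumes split: "split_cartan s commutator (comm_span s S) h'"
  shows "\<exists>P r E. perfect_matrix_units s S P r E \<and> h' = comm_span s S \<inter> span P"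
proof -
  \<comment> \<open>These auxiliary matrix units are unrelated to \<open>h'\<close>. They provide
    the unit of \<open>S\<close> and the decomposition into a central and a traceless part.\<close>
  obtain P0 r0 E0 where "perfect_matrix_units s S P0 r0 E0" using units_exist by blast
  then interpret M: perfect_matrix_units s S P0 r0 E0 .
  note S' = M.S'
  let ?g = "comm_span s S"
  have h0: "h' = weight_space s commutator h' ?g (\<lambda>_. 0)"
    and sum: "direct_sum ?g (insert (\<lambda>_. 0) (roots s commutator ?g h')) (weight_space s commutator h' ?g)"
    using split by (auto simp: split_cartan_def)
  have h'_g: "h' \<subseteq> ?g" using h0 by (auto simp: weight_space_def)
  have h'_iff: "x \<in> h' \<longleftrightarrow> x \<in> ?g \<and> (\<forall>t\<in>h'. t * x = x * t)" for x
    by (subst h0) (auto simp: weight_space_def commutator_def)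
  define H where "H = {x\<in>S. \<forall>t\<in>h'. t * x = x * t}"
  have h'_H: "h' \<subseteq> H" unfolding H_def using h'_iff h'_g M.g_subset by blast
  \<comment> \<open>Modulo the center of \<open>S\<close> an element of the centralizer is
    traceless, and a traceless element that centralizes \<open>h'\<close> belongs to
    \<open>h'\<close>.\<close>
  have H_split: "\<exists>z\<in>S. (\<forall>y\<in>S. y * z = z * y) \<and> x - z \<in> h'" if x: "x \<in> H" for x
  proof -
    have xS: "x \<in> S" using x by (simp add: H_def)
    obtain z where z: "z \<in> S" "\<And>y. y \<in> S \<Longrightarrow> y * z = z * y" "x - z \<in> ?g"
      using M.central_part[OF xS] by blast
    have "t * (x - z) = (x - z) * t" if t: "t \<in> h'" for t
    proof -
      have "t \<in> S" using t h'_g M.g_subset by blast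
      then show ?thesis using x t z(2) by (simp add: H_def algebra_simps)
    qed
    then show ?thesis using z h'_iff by blast
  qed
  have H_comm: "x * y = y * x" if x: "x \<in> H" and y: "y \<in> H" for x y
  proof -
    obtain z where z: "z \<in> S" "\<And>y. y \<in> S \<Longrightarrow> y * z = z * y" "x - z \<in> h'" using H_split[OF x] by blast
    have "(x - z) * y = y * (x - z)" "y * z = z * y" using y z by (auto simp: H_def)
    then show ?thesis by (simp add: algebra_simps)
  qed
  have H_sub: "assoc_subalgebra s H"
    unfolding assoc_subalgebra_def
  proof (intro conjI ballI subspaceI)
    fix x y assume xy: "x \<in> H" "y \<in> H"
    have "t * (x * y) = x * y * t" if "t \<in> h'" for t
    proof -
      have "t * (x * y) = (t * x) * y" by (simp add: mult.assoc)
      also have "\<dots> = x * (t * y)" using xy(1) that by (simp add: H_def mult.assoc)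
      also have "\<dots> = x * y * t" using xy(2) that by (simp add: H_def mult.assoc)
      finally show ?thesis .
    qed
    then show "x * y \<in> H" using xy S'(2) by (simp add: H_def)
  qed (use S' in \<open>auto simp: H_def distrib_left distrib_right scale_mult_left scale_mult_right\<close>)
  have one: "\<Sum>P0 \<in> S" by (intro subspace_sum[OF S'(1)]) (use M.PD(4) in auto)
  have one_H: "\<Sum>P0 \<in> H"
    using one M.unit_left M.unit_right h'_g M.g_subset by (auto simp: H_def subset_iff)
  have "semiprime H"
    unfolding semiprime_def
  proof (intro ballI impI)
    fix x assume x: "x \<in> H" and x0: "\<forall>y\<in>H. x * y * x = 0"
    have xS: "x \<in> S" using x by (simp add: H_def)
    have xx: "x * x = 0" using x0 one_H M.unit_right[OF xS] by (metis)
    obtain z where z: "z \<in> S" "\<And>y. y \<in> S \<Longrightarrow> y * z = z * y" "x - z \<in> h'" using H_split[OF x] by blast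
    \<comment> \<open>\<open>x\<close> and \<open>x - z\<close> have the same bracket with
      \<open>w\<close>, so \<open>x w - w x = c w\<close>. With \<open>x x = 0\<close>, multiplying
      by \<open>x\<close> on both sides gives \<open>c (x w x) = 0\<close>, and on one side
      \<open>c (x w) = - x w x\<close> and \<open>c (w x) = x w x\<close>. So \<open>c = 0\<close>
      or both products vanish, and \<open>x\<close> commutes with \<open>w\<close> in either
      case.\<close>
    have root: "x * w = w * x" if w: "w \<in> weight_space s commutator h' ?g \<alpha>" for w \<alpha>
    proof -
      have wS: "w \<in> S" and wt: "commutator (x - z) w = s (\<alpha> (x - z)) w"
        using w z(3) M.g_subset by (auto simp: weight_space_def)
      define c where "c = \<alpha> (x - z)"
      have xw: "x * w - w * x = s c w"
        using wt z(2)[OF wS] by (simp add: commutator_def c_def algebra_simps)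
      have "x * (x * w - w * x) * x = x * x * w * x - x * w * (x * x)" by (simp add: algebra_simps)
      then have "s c (x * w * x) = 0" unfolding xw using xx by (simp add: scale_mult_left scale_mult_right)
      moreover have "x * (x * w - w * x) = x * x * w - x * w * x" "(x * w - w * x) * x = x * w * x - w * (x * x)"
        by (simp_all add: algebra_simps)
      then have "s c (x * w) = - (x * w * x)" "s c (w * x) = x * w * x"
        unfolding xw using xx by (simp_all add: scale_mult_left scale_mult_right)
      ultimately have "c = 0 \<or> (x * w = 0 \<and> w * x = 0)" by auto
      then show ?thesis using xw by auto
    qed
    have "x * y = y * x" if y: "y \<in> ?g" for y
    proof -
      let ?R = "insert (\<lambda>_. 0) (roots s commutator ?g h')"
      obtain f where f: "f \<in> Pi\<^sub>E ?R (weight_space s commutator h' ?g)" "y = (\<Sum>i\<in>?R. f i)"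
        using sum y unfolding direct_sum_def by blast
      have "x * f i = f i * x" if "i \<in> ?R" for i using root PiE_mem[OF f(1) that] by blast
      then show ?thesis unfolding f(2) sum_distrib_left sum_distrib_right by (intro sum.cong refl)
    qed
    then have "x * y = y * x" if y: "y \<in> S" for y
    proof -
      obtain z where z: "z \<in> S" "\<And>u. u \<in> S \<Longrightarrow> u * z = z * u" "y - z \<in> ?g" using M.central_part[OF y] by blast
      have "x * (y - z) = (y - z) * x" "x * z = z * x"
        using \<open>\<And>y. y \<in> ?g \<Longrightarrow> x * y = y * x\<close> z xS by auto
      then show ?thesis by (simp add: algebra_simps)
    qed
    then have "x * y * x = 0" if "y \<in> S" for y using that xx by (metis mult.assoc mult_zero_right)
    then show "x = 0" using semiprimeD[OF semiprime xS] by blast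
  qed
  moreover have "H \<subseteq> span B" using spanning(2) by (auto simp: H_def)
  ultimately obtain P where P: "primitive_system H P"
    and unit: "\<And>x. x \<in> H \<Longrightarrow> \<Sum>P * x = x" "\<And>x. x \<in> H \<Longrightarrow> x * \<Sum>P = x"
    using complete_primitive_system_exists[OF H_sub spanning(1)] by metis
  have PH: "P \<subseteq> H" "\<And>e. e \<in> P \<Longrightarrow> e * e = e" "\<And>e x. e \<in> P \<Longrightarrow> x \<in> H \<Longrightarrow> \<exists>c. e * x * e = s c e"
    using P by (auto simp: primitive_system_def)
  have "\<Sum>P \<in> H" using subspace_sum[of H P "\<lambda>x. x"] subalgebraD(1)[OF H_sub] PH(1) by blast
  \<comment> \<open>One sum is the unit of \<open>H\<close>, the other the unit of \<open>S\<close>,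
    and the latter lies in \<open>H\<close>.\<close>
  then have "\<Sum>P = \<Sum>P0" using unit(2)[OF one_H] M.unit_left H_def by (metis (no_types, lifting) mem_Collect_eq unit(1) one_H M.unit_right)
  then have unitS: "\<And>x. x \<in> S \<Longrightarrow> \<Sum>P * x = x" "\<And>x. x \<in> S \<Longrightarrow> x * \<Sum>P = x"
    using M.unit_left M.unit_right by simp_all
  have H_span: "H = span P"
  proof
    show "span P \<subseteq> H" using PH(1) subalgebraD(1)[OF H_sub] by (rule span_minimal)
    show "H \<subseteq> span P"
    proof
      fix x assume x: "x \<in> H"
      have "e * x \<in> span P" if e: "e \<in> P" for e
      proof -
        have "e * x = e * (e * x)" using PH(2)[OF e] by (simp add: mult.assoc[symmetric])
        also have "\<dots> = e * x * e" using H_comm[OF x, of e] e PH(1) by (auto simp: mult.assoc)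
        finally obtain c where "e * x = s c e" using PH(3)[OF e x] by metis
        then show ?thesis using e by (simp add: span_scale span_base)
      qed
      then have "(\<Sum>e\<in>P. e * x) \<in> span P" by (intro span_sum)
      then show "x \<in> span P" using unit(1)[OF x] by (simp add: sum_distrib_right[symmetric])
    qed
  qed
  have "primitive_system S P"
    unfolding primitive_system_def
  proof (intro conjI ballI)
    fix e x assume e: "e \<in> P" and x: "x \<in> S"
    \<comment> \<open>\<open>y\<close> commutes with all of \<open>P\<close>, hence with
      \<open>h'\<close> inside \<open>span P\<close>, so it lies in \<open>H\<close>. Primitivity of
      \<open>e\<close> in \<open>H\<close> then makes \<open>y = e y e\<close> a multiple of
      \<open>e\<close>, which is primitivity in \<open>S\<close>.\<close>
    define y where "y = e * x * e"
    have yS: "y \<in> S" using e x PH(1) S'(2) by (auto simp: y_def H_def)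
    have "f * y = y * f" if f: "f \<in> P" for f
    proof (cases "f = e")
      case True
      then show ?thesis using PH(2)[OF e] by (simp add: y_def mult.assoc) (simp add: mult.assoc[symmetric])
    next
      case False
      then have "f * e = 0" "e * f = 0" using P e f by (auto simp: primitive_system_def)
      then have "f * y = 0" "y * f = 0" by (simp_all add: y_def mult.assoc) (simp add: mult.assoc[symmetric])
      then show ?thesis by simp
    qed
    then have "P \<subseteq> {t. t * y = y * t}" by blast
    moreover have "subspace {t. t * y = y * t}"
      by (rule subspaceI) (simp_all add: distrib_left distrib_right scale_mult_left scale_mult_right)
    ultimately have "span P \<subseteq> {t. t * y = y * t}" by (rule span_minimal)
    then have "y \<in> H" using yS h'_H unfolding H_def H_span[symmetric] by blast
    then obtain c where "e * y * e = s c e" using PH(3)[OF e] by blast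
    moreover have "e * y * e = y"
      unfolding y_def using PH(2)[OF e] by (metis mult.assoc)
    ultimately show "\<exists>c. e * x * e = s c e" unfolding y_def by metis
  qed (use P in \<open>auto simp: primitive_system_def H_def\<close>)
  then obtain r E where "perfect_matrix_units s S P r E" using perfect_units unitS by blast
  moreover have "h' = ?g \<inter> span P"
    unfolding H_span[symmetric] H_def using h'_iff M.g_subset by blast
  ultimately show ?thesis by blast
qed

end

text \<open>Existence of a split Cartan subalgebra is part of the conclusion, so that the claim
  about all of them is not vacuous.\<close>

theorem theorem1p4:
  fixes scale :: "'f::alg_closed_field \<Rightarrow> 'a::ring \<Rightarrow> 'a"
    and S :: "'a set"
  assumes "assoc_algebra scale"
    and "assoc_subalgebra scale S" and "S \<noteq> {0}"
    and "finite_dim scale S" and "semisimple_algebra scale S"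
    and "generated_ideal scale UNIV S = UNIV"
    and "(k_perfect scale 1 S \<and> CHAR('f) \<noteq> 2) \<or> (k_perfect scale 4 S \<and> CHAR('f) = 2)"
    and "CHAR('f) = 0"
  shows "(\<exists>h. split_cartan scale commutator (comm_span scale S) h) \<and>
    (\<forall>h. split_cartan scale commutator (comm_span scale S) h \<longrightarrow>
      gamma_graded scale commutator (comm_span scale UNIV) (comm_span scale S) h
        (Gamma_set scale S h))"
proof -
  interpret alg_closed_algebra scale
    using assms(1) by (simp add: alg_closed_algebra_def)
  obtain B where B: "finite B" "S \<subseteq> span B" using assms(4) by (auto simp: finite_dim_def)
  have "perfect_semiprime_algebra scale S B"
    by unfold_locales
      (use assms(2,7,8) B semisimple_imp_semiprime[OF assms(2,5)] in auto)
  then interpret perfect_semiprime_algebra scale S B .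
  show ?thesis
  proof (intro conjI allI impI)
    obtain P r E where "perfect_matrix_units scale S P r E" using units_exist by blast
    then show "\<exists>h. split_cartan scale commutator (comm_span scale S) h"
      using perfect_matrix_units.split_cartan_h by blast
  next
    fix h assume "split_cartan scale commutator (comm_span scale S) h"
    then obtain P r E where units: "perfect_matrix_units scale S P r E" and h: "h = comm_span scale S \<inter> span P"
      using units_of_split_cartan by blast
    show "gamma_graded scale commutator (comm_span scale UNIV) (comm_span scale S) h (Gamma_set scale S h)"
      unfolding h perfect_matrix_units.h_eq_span[OF units, symmetric]
      by (rule perfect_matrix_units.graded[OF units assms(6,4)])
  qed
qed

end
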